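(* Assume that $R=R^*$, that $R$ is one to one, and that there is an orthonormal basis of $X$ consisting of eigenvectors of $R$. Let $u\in L^p(X,\nu)$ for some $p>1$. Then $u\in BV_0(X,\nu)$ if and only if $V_0(u)<+\infty$. In this case the measure $m_0$ from the definition of $BV_0(X,\nu)$ satisfies $|m_0|(X)=V_0(u)$.
   Context: $X$ is a separable real Hilbert space with inner product $\langle\cdot,\cdot\rangle$ and norm $\|\cdot\|$, $\nu$ is a Borel probability measure on $X$, $R\in\mathcal L(X)$. $C^1_b(X)$ is the space of bounded, continuously Fréchet differentiable $\varphi:X\to\mathbb R$ with bounded gradient; $\partial\varphi/\partial y:=\langle\nabla\varphi,y\rangle$. Standing assumption: for every $z\in X$ there exists $v_z\in\bigcap_{p>1}L^p(X,\nu)$ with $\int_X\langle R\nabla\varphi,z\rangle\,d\nu=\int_X v_z\varphi\,d\nu$ for all $\varphi\in C^1_b(X)$. $\widetilde C^1_b(X,R(X))$ is the set of vector fields $F=\sum_{i=1}^n f_iy_i$ with $f_i\in C^1_b(X)$, $y_i\in R(X)$; for such $F$ set $\nabla^*F:=\sum_{i=1}^n\big(-\frac{\partial f_i}{\partial y_i}+v_{R^{-1}y_i}f_i\big)$. For $u\in L^1(X,\nu)$ with $uv_z\in L^1(X,\nu)$ for all $z$, $V_0(u):=\sup\{\int_X u\,\nabla^*F\,d\nu:\ F\in\widetilde C^1_b(X,R(X)),\ \|F(x)\|\le1\ \forall x\}$. $\mathcal M(X,X)$ is the set of countably additive $X$-valued Borel measures with finite total variation $|m|(X)=\sup\sum_n\|m(B_n)\|$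 over countable Borel partitions. Such $u$ belongs to $BV_0(X,\nu)$ if there is $m_0\in\mathcal M(X,X)$ with $\int_X u(\langle\nabla\varphi,y\rangle-v_{R^{-1}y}\varphi)\,d\nu=-\int_X\varphi\,d\langle m_0,y\rangle$ for all $y\in R(X)$ and $\varphi\in C^1_b(X)$, where $\langle m_0,y\rangle(B):=\langle m_0(B),y\rangle$. *)

theory Defs
  imports "HOL-Probability.Probability"
begin

definition grad :: "('a::real_inner \<Rightarrow> real) \<Rightarrow> 'a \<Rightarrow> 'a" where
  "grad \<phi> x = (THE g. (\<phi> has_derivative (\<lambda>h. g \<bullet> h)) (at x))"

definition C1b :: "('a::real_inner \<Rightarrow> real) \<Rightarrow> bool" where
  "C1b \<phi> \<longleftrightarrow> bounded (range \<phi>) \<and>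
     (\<exists>g. (\<forall>x. (\<phi> has_derivative (\<lambda>h. g x \<bullet> h)) (at x)) \<and>
          continuous_on UNIV g \<and> bounded (range g))"

definition Lp :: "'a measure \<Rightarrow> real \<Rightarrow> ('a \<Rightarrow> real) \<Rightarrow> bool" where
  "Lp M p f \<longleftrightarrow> f \<in> borel_measurable M \<and> integrable M (\<lambda>x. \<bar>f x\<bar> powr p)"

definition standing_assumption ::
  "'a::real_inner measure \<Rightarrow> ('a \<Rightarrow> 'a) \<Rightarrow> ('a \<Rightarrow> 'a \<Rightarrow> real) \<Rightarrow> bool" where
  "standing_assumption \<nu> R v \<longleftrightarrow>
     (\<forall>z. (\<forall>p>1. Lp \<nu> p (v z)) \<and>
          (\<forall>\<phi>. C1b \<phi> \<longrightarrow>
             (\<integral>x. R (grad \<phi> x) \<bullet> z \<partial>\<nu>) = (\<integral>x. v z x * \<phi> x \<partial>\<nu>)))"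

text \<open>A vector field F = sum f_i y_i in tilde C^1_b(X,R(X)), given by its representation
  as a finite list of pairs (f_i, y_i).\<close>
definition field_of :: "(('a::real_inner \<Rightarrow> real) \<times> 'a) list \<Rightarrow> 'a \<Rightarrow> 'a" where
  "field_of F x = sum_list (map (\<lambda>(f, y). f x *\<^sub>R y) F)"

definition admissible_field ::
  "('a::real_inner \<Rightarrow> 'a) \<Rightarrow> (('a \<Rightarrow> real) \<times> 'a) list \<Rightarrow> bool" where
  "admissible_field R F \<longleftrightarrow> (\<forall>(f, y) \<in> set F. C1b f \<and> y \<in> range R)"

definition nabla_star ::
  "('a::real_inner \<Rightarrow> 'a) \<Rightarrow> ('a \<Rightarrow> 'a \<Rightarrow> real) \<Rightarrow> (('a \<Rightarrow> real) \<times> 'a) list \<Rightarrow> 'a \<Rightarrow> real" where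
  "nabla_star R v F x =
     sum_list (map (\<lambda>(f, y). - (grad f x \<bullet> y) + v (inv R y) x * f x) F)"

definition V0 ::
  "'a::real_inner measure \<Rightarrow> ('a \<Rightarrow> 'a) \<Rightarrow> ('a \<Rightarrow> 'a \<Rightarrow> real) \<Rightarrow> ('a \<Rightarrow> real) \<Rightarrow> ereal" where
  "V0 \<nu> R v u = Sup {ereal (\<integral>x. u x * nabla_star R v F x \<partial>\<nu>) | F.
       admissible_field R F \<and> (\<forall>x. norm (field_of F x) \<le> 1)}"

definition countably_additive_vm :: "('a::topological_space set \<Rightarrow> 'b::real_normed_vector) \<Rightarrow> bool" where
  "countably_additive_vm m \<longleftrightarrow>
     (\<forall>B :: nat \<Rightarrow> 'a set. (\<forall>n. B n \<in> sets borel) \<longrightarrow> disjoint_family B \<longrightarrow>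
        (\<lambda>n. m (B n)) sums m (\<Union>n. B n))"

definition total_variation :: "('a::topological_space set \<Rightarrow> 'b::real_normed_vector) \<Rightarrow> ennreal" where
  "total_variation m = (SUP B \<in> {B :: nat \<Rightarrow> 'a set. (\<forall>n. B n \<in> sets borel) \<and>
        disjoint_family B \<and> (\<Union>n. B n) = UNIV}. (\<Sum>n. ennreal (norm (m (B n)))))"

definition vector_measure :: "('a::topological_space set \<Rightarrow> 'b::real_normed_vector) \<Rightarrow> bool" where
  "vector_measure m \<longleftrightarrow> countably_additive_vm m \<and> total_variation m < \<infinity>"

text \<open>Integral of phi against a finite real signed Borel measure mu, via any decomposition
  mu = P - N into finite positive Borel measures (independent of the decomposition).\<close>
definition signed_integral :: "('a::topological_space set \<Rightarrow> real) \<Rightarrow> ('a \<Rightarrow> real) \<Rightarrow> real" where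
  "signed_integral \<mu> \<phi> = (THE r. \<exists>P N. finite_measure P \<and> finite_measure N \<and>
       sets P = sets borel \<and> sets N = sets borel \<and>
       (\<forall>B \<in> sets borel. \<mu> B = measure P B - measure N B) \<and>
       r = (\<integral>x. \<phi> x \<partial>P) - (\<integral>x. \<phi> x \<partial>N))"

definition BV0_measure ::
  "'a::real_inner measure \<Rightarrow> ('a \<Rightarrow> 'a) \<Rightarrow> ('a \<Rightarrow> 'a \<Rightarrow> real) \<Rightarrow> ('a \<Rightarrow> real) \<Rightarrow> ('a set \<Rightarrow> 'a) \<Rightarrow> bool" where
  "BV0_measure \<nu> R v u m0 \<longleftrightarrow> vector_measure m0 \<and>
     (\<forall>y \<in> range R. \<forall>\<phi>. C1b \<phi> \<longrightarrow>
        (\<integral>x. u x * (grad \<phi> x \<bullet> y - v (inv R y) x * \<phi> x) \<partial>\<nu>)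
          = - signed_integral (\<lambda>B. m0 B \<bullet> y) \<phi>)"

definition BV0 ::
  "'a::real_inner measure \<Rightarrow> ('a \<Rightarrow> 'a) \<Rightarrow> ('a \<Rightarrow> 'a \<Rightarrow> real) \<Rightarrow> ('a \<Rightarrow> real) \<Rightarrow> bool" where
  "BV0 \<nu> R v u \<longleftrightarrow> integrable \<nu> u \<and> (\<forall>z. integrable \<nu> (\<lambda>x. u x * v z x)) \<and>
     (\<exists>m0. BV0_measure \<nu> R v u m0)"

end

theory Submission
  imports Defs
begin

text \<open>
  If \<open>m\<close> represents the distributional gradient of \<open>u\<close>, then \<open>\<integral> u \<nabla>* F d\<nu>\<close> is the integral of \<open>F\<close>
  against \<open>m\<close>. This gives \<open>V0 \<le> |m|(X)\<close> by approximation with step functions, and \<open>|m|(X) \<le> V0\<close> by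
  approximating the indicators of a Borel partition by C1 functions with sum at most 1.

  Conversely let \<open>V0\<close> be finite and let \<open>L e \<phi>\<close> denote \<open>\<integral> u (v \<phi> - \<partial>\<phi>/\<partial>e) d\<nu>\<close> for \<open>e\<close> in the eigenbasis,
  which lies in \<open>R(X)\<close> as \<open>R\<close> is injective. In infinite dimension boundedness alone does not yield a
  countably additive measure; tightness comes from the following observation. Choose a field \<open>F\<close>, with
  values in a finite-dimensional space \<open>W\<close>, that almost attains \<open>V0\<close>. For \<open>0 \<le> \<theta> \<le> 1\<close> the variation of
  \<open>L\<close> on \<open>\<theta>\<close> is then, up to a small error, at most \<open>L(\<theta> F) = \<integral> u \<theta> \<nabla>* F d\<nu> - \<integral> u \<langle>F, \<nabla>\<theta>\<rangle> d\<nu>\<close>. This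
  tends to 0 when \<open>\<theta>\<close> runs through complements of cutoffs to larger and larger sets, provided that the
  derivatives of the cutoffs along \<open>W\<close> tend to 0, and cutoffs with this property can be chosen with
  support in finitely many small balls. By Dini's argument the variation of \<open>L\<close> is countably
  subadditive, the Daniell construction yields a finite measure dominating it, and \<open>L\<close> extends by
  density from C1 functions to indicators, which defines \<open>m\<close>. The identity for a general
  \<open>y \<in> R(X)\<close> follows by applying the bound \<open>V0\<close> to fields \<open>\<phi> (y - y')\<close> with \<open>y'\<close> in the span of the
  basis.
\<close>

section \<open>Bounded C1 functions\<close>

text \<open>In infinite dimension closed balls are not compact, so a bounded functional may lose
  mass and ordinary cutoffs to balls do not stop it. The way out is that the integral formula sees a
  cutoff only through its values and its derivatives in the finitely many directions of the chosen
  field; in the other directions it may be arbitrarily steep. Near-optimality of \<open>F\<close>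
  localizes because variations are superadditive: the variation on \<open>\<theta>\<close> plus that
  on \<open>1 - \<theta>\<close> is at most the total, and \<open>L((1 - \<theta>) F)\<close> is at
  most the variation on \<open>1 - \<theta>\<close>, so on \<open>\<theta>\<close> the field cannot
  fall short by more than it does globally. Cutoffs to finitely many balls of radius
  \<open>1 / Suc j\<close>, taken for all \<open>j\<close>, confine a sequence to a totally bounded
  set; this replaces local compactness. Domination of the variation by the Daniell measure, rather
  than equality, suffices: it makes \<open>L\<close> Lipschitz for the L1 norm of that measure. The
  exponent \<open>p > 1\<close> supplies, through Hoelder's inequality, the integrability of
  \<open>u\<close> and of all \<open>u v_z\<close>, on which every limit rests.\<close>

lemma le_if_le_add_mult_epsilon:
  fixes x y K :: real
  assumes "0 \<le> K" "\<And>\<delta>. 0 < \<delta> \<Longrightarrow> x \<le> y + K * \<delta>"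
  shows "x \<le> y"
proof (rule field_le_epsilon)
  fix e :: real assume "0 < e"
  then have "0 < e / (K + 1)" "K * (e / (K + 1)) \<le> e"
    using assms(1) by (auto simp: field_simps)
  then show "x \<le> y + e"
    using assms(2)[of "e / (K + 1)"] by simp
qed

lemma grad_eqI:
  assumes "(\<phi> has_derivative (\<lambda>h. g \<bullet> h)) (at x)"
  shows "grad \<phi> x = g"
  unfolding grad_def
proof (rule the_equality)
  fix g' assume "(\<phi> has_derivative (\<lambda>h. g' \<bullet> h)) (at x)"
  then have "(\<lambda>h. g' \<bullet> h) = (\<lambda>h. g \<bullet> h)"
    using assms has_derivative_unique by blast
  then show "g' = g"
    by (metis vector_eq_ldot inner_commute)
qed (use assms in auto)

lemma C1bI:
  assumes "\<And>x. \<bar>\<phi> x\<bar> \<le> B" "\<And>x. (\<phi> has_derivative (\<lambda>h. g x \<bullet> h)) (at x)"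
    "continuous_on UNIV g" "\<And>x. norm (g x) \<le> C"
  shows "C1b \<phi>"
  unfolding C1b_def bounded_iff
proof (intro conjI exI[of _ g])
  show "\<exists>a. \<forall>x\<in>range \<phi>. norm x \<le> a"
    using assms(1) by (intro exI[of _ B]) auto
  show "\<exists>a. \<forall>x\<in>range g. norm x \<le> a"
    using assms(4) by (intro exI[of _ C]) auto
qed (use assms in auto)

text \<open>\<open>C1b\<close> only asserts that some continuous bounded gradient exists; uniqueness
  of the derivative identifies it with \<open>grad\<close>, which thereby inherits continuity and
  boundedness.\<close>

lemma
  assumes "C1b \<phi>"
  shows C1b_has_derivative: "(\<phi> has_derivative (\<lambda>h. grad \<phi> x \<bullet> h)) (at x)"
    and C1b_continuous_grad: "continuous_on UNIV (grad \<phi>)"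
    and C1b_bounded_grad: "bounded (range (grad \<phi>))"
proof -
  from assms obtain g where g: "\<And>x. (\<phi> has_derivative (\<lambda>h. g x \<bullet> h)) (at x)"
      "continuous_on UNIV g" "bounded (range g)"
    unfolding C1b_def by blast
  then have "grad \<phi> = g"
    using grad_eqI by blast
  with g show "(\<phi> has_derivative (\<lambda>h. grad \<phi> x \<bullet> h)) (at x)"
    "continuous_on UNIV (grad \<phi>)" "bounded (range (grad \<phi>))" by auto
qed

lemma C1b_continuous: "C1b \<phi> \<Longrightarrow> continuous_on UNIV \<phi>"
  by (meson C1b_has_derivative continuous_at_imp_continuous_on has_derivative_continuous)

lemma C1b_measurable: "C1b \<phi> \<Longrightarrow> \<phi> \<in> borel_measurable borel"
  by (simp add: C1b_continuous borel_measurable_continuous_onI)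

lemma C1b_bound: "C1b \<phi> \<Longrightarrow> \<exists>B>0. \<forall>x. \<bar>\<phi> x\<bar> \<le> B"
  unfolding C1b_def bounded_pos by auto

lemma C1b_grad_bound: "C1b \<phi> \<Longrightarrow> \<exists>B>0. \<forall>x. norm (grad \<phi> x) \<le> B"
  using C1b_bounded_grad unfolding bounded_pos by auto

lemma C1b_grad_inner_measurable:
  assumes "C1b \<phi>"
  shows "(\<lambda>x. grad \<phi> x \<bullet> y) \<in> borel_measurable borel"
  by (intro borel_measurable_continuous_onI continuous_intros C1b_continuous_grad assms)

lemma C1b_const: "C1b (\<lambda>_. c)"
  by (rule C1bI[of _ "\<bar>c\<bar>" "\<lambda>_. 0" 0]) (auto simp: has_derivative_const)

lemma grad_const: "grad (\<lambda>_. c) x = 0"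
  by (rule grad_eqI) (auto simp: has_derivative_const)

lemma
  assumes "C1b \<phi>" "C1b \<psi>"
  shows C1b_add: "C1b (\<lambda>x. \<phi> x + \<psi> x)"
    and grad_add: "grad (\<lambda>x. \<phi> x + \<psi> x) x = grad \<phi> x + grad \<psi> x"
proof -
  have d: "((\<lambda>x. \<phi> x + \<psi> x) has_derivative (\<lambda>h. (grad \<phi> x + grad \<psi> x) \<bullet> h)) (at x)" for x
    unfolding inner_add_left by (intro has_derivative_add C1b_has_derivative assms)
  then show "grad (\<lambda>x. \<phi> x + \<psi> x) x = grad \<phi> x + grad \<psi> x"
    by (rule grad_eqI)
  obtain A where A: "0 < A" "\<And>x. \<bar>\<phi> x\<bar> \<le> A"
    using C1b_bound[OF assms(1)] by auto
  obtain B where B: "0 < B" "\<And>x. \<bar>\<psi> x\<bar> \<le> B"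
    using C1b_bound[OF assms(2)] by auto
  obtain A' where A': "0 < A'" "\<And>x. norm (grad \<phi> x) \<le> A'"
    using C1b_grad_bound[OF assms(1)] by auto
  obtain B' where B': "0 < B'" "\<And>x. norm (grad \<psi> x) \<le> B'"
    using C1b_grad_bound[OF assms(2)] by auto
  show "C1b (\<lambda>x. \<phi> x + \<psi> x)"
  proof (rule C1bI[OF _ d])
    show "\<bar>\<phi> x + \<psi> x\<bar> \<le> A + B" for x
      using A(2)[of x] B(2)[of x] by linarith
    show "norm (grad \<phi> x + grad \<psi> x) \<le> A' + B'" for x
      by (rule norm_triangle_mono[OF A'(2) B'(2)])
    show "continuous_on UNIV (\<lambda>x. grad \<phi> x + grad \<psi> x)"
      by (intro continuous_intros C1b_continuous_grad assms)
  qed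
qed

lemma
  assumes "C1b \<phi>" "C1b \<psi>"
  shows C1b_mult: "C1b (\<lambda>x. \<phi> x * \<psi> x)"
    and grad_mult: "grad (\<lambda>x. \<phi> x * \<psi> x) x = \<phi> x *\<^sub>R grad \<psi> x + \<psi> x *\<^sub>R grad \<phi> x"
proof -
  have d: "((\<lambda>x. \<phi> x * \<psi> x) has_derivative
      (\<lambda>h. (\<phi> x *\<^sub>R grad \<psi> x + \<psi> x *\<^sub>R grad \<phi> x) \<bullet> h)) (at x)" for x
    by (rule has_derivative_eq_rhs[OF has_derivative_mult[OF assms[THEN C1b_has_derivative]]])
      (auto simp: inner_add_left)
  then show "grad (\<lambda>x. \<phi> x * \<psi> x) x = \<phi> x *\<^sub>R grad \<psi> x + \<psi> x *\<^sub>R grad \<phi> x"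
    by (rule grad_eqI)
  obtain A where A: "0 < A" "\<And>x. \<bar>\<phi> x\<bar> \<le> A"
    using C1b_bound[OF assms(1)] by auto
  obtain B where B: "0 < B" "\<And>x. \<bar>\<psi> x\<bar> \<le> B"
    using C1b_bound[OF assms(2)] by auto
  obtain A' where A': "0 < A'" "\<And>x. norm (grad \<phi> x) \<le> A'"
    using C1b_grad_bound[OF assms(1)] by auto
  obtain B' where B': "0 < B'" "\<And>x. norm (grad \<psi> x) \<le> B'"
    using C1b_grad_bound[OF assms(2)] by auto
  show "C1b (\<lambda>x. \<phi> x * \<psi> x)"
  proof (rule C1bI[OF _ d])
    show "\<bar>\<phi> x * \<psi> x\<bar> \<le> A * B" for x
      using A B by (simp add: abs_mult mult_mono')
    show "norm (\<phi> x *\<^sub>R grad \<psi> x + \<psi> x *\<^sub>R grad \<phi> x) \<le> A * B' + B * A'" for x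
      by (rule norm_triangle_mono)
        (use A B in \<open>auto intro!: mult_mono A(2) B(2) A'(2) B'(2)\<close>)
    show "continuous_on UNIV (\<lambda>x. \<phi> x *\<^sub>R grad \<psi> x + \<psi> x *\<^sub>R grad \<phi> x)"
      by (intro continuous_intros C1b_continuous_grad C1b_continuous assms)
  qed
qed

lemma C1b_cmult: "C1b \<phi> \<Longrightarrow> C1b (\<lambda>x. c * \<phi> x)"
  by (intro C1b_mult C1b_const)

lemma grad_cmult: "C1b \<phi> \<Longrightarrow> grad (\<lambda>x. c * \<phi> x) x = c *\<^sub>R grad \<phi> x"
  by (simp add: grad_mult C1b_const grad_const)

lemma C1b_diff: "C1b \<phi> \<Longrightarrow> C1b \<psi> \<Longrightarrow> C1b (\<lambda>x. \<phi> x - \<psi> x)"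
  using C1b_add[OF _ C1b_cmult[of \<psi> "-1"]] by simp

lemma C1b_sum: "(\<And>i. i \<in> I \<Longrightarrow> C1b (f i)) \<Longrightarrow> C1b (\<lambda>x. \<Sum>i\<in>I. f i x)"
  by (induction I rule: infinite_finite_induct) (auto intro: C1b_const C1b_add)

lemma C1b_prod: "(\<And>i. i \<in> I \<Longrightarrow> C1b (f i)) \<Longrightarrow> C1b (\<lambda>x. \<Prod>i\<in>I. f i x)"
  by (induction I rule: infinite_finite_induct) (auto intro: C1b_const C1b_mult)

lemma C1b_power: "C1b f \<Longrightarrow> C1b (\<lambda>x. f x ^ n)"
  by (induction n) (auto intro: C1b_const C1b_mult)

text \<open>The uniform lower bound keeps both the reciprocal and its gradient bounded. In the
  application it is provided by a small constant added to a nonnegative denominator.\<close>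

lemma C1b_inverse:
  assumes "C1b \<phi>" "0 < \<epsilon>" "\<And>x. \<epsilon> \<le> \<phi> x"
  shows "C1b (\<lambda>x. inverse (\<phi> x))"
proof -
  have pos: "\<phi> x > 0" "\<phi> x \<noteq> 0" for x
    using assms(2) assms(3)[of x] by auto
  have inv_le: "inverse (\<phi> x) \<le> inverse \<epsilon>" for x
    using assms by (simp add: le_imp_inverse_le)
  obtain A' where A': "0 < A'" "\<And>x. norm (grad \<phi> x) \<le> A'"
    using C1b_grad_bound[OF assms(1)] by auto
  show ?thesis
  proof (rule C1bI)
    show "\<bar>inverse (\<phi> x)\<bar> \<le> inverse \<epsilon>" for x
      using inv_le[of x] pos(1)[of x] by simp
    show "((\<lambda>x. inverse (\<phi> x)) has_derivative
        (\<lambda>h. (- (inverse (\<phi> x) * inverse (\<phi> x)) *\<^sub>R grad \<phi> x) \<bullet> h)) (at x)" for x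
      by (rule has_derivative_eq_rhs[OF Deriv.has_derivative_inverse[OF pos(2) C1b_has_derivative[OF assms(1)]]])
        (auto simp: mult_ac)
    show "continuous_on UNIV (\<lambda>x. - (inverse (\<phi> x) * inverse (\<phi> x)) *\<^sub>R grad \<phi> x)"
      by (intro continuous_intros C1b_continuous_grad C1b_continuous assms) (use pos in auto)
    show "norm (- (inverse (\<phi> x) * inverse (\<phi> x)) *\<^sub>R grad \<phi> x) \<le> inverse \<epsilon> * inverse \<epsilon> * A'" for x
      using pos(1)[of x] inv_le[of x] assms(2)
      by (auto simp: abs_mult intro!: mult_mono A'(2))
  qed
qed

text \<open>The cutoff is C1 because the positive part is squared. With \<open>T\<close> a multiple of the identity it
  is supported in a ball; with \<open>T\<close> a multiple of an orthogonal projection it depends on some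
  coordinates only.\<close>

definition bump :: "('a::real_inner \<Rightarrow> 'a) \<Rightarrow> 'a \<Rightarrow> 'a \<Rightarrow> real" where
  "bump T d x = (max 0 (1 - (norm (T (x - d)))\<^sup>2))\<^sup>2"

lemma bump_range: "0 \<le> bump T d x" "bump T d x \<le> 1"
  by (auto simp: bump_def max_def power_le_one)

lemma bump_pos_iff: "0 < bump T d x \<longleftrightarrow> norm (T (x - d)) < 1"
proof -
  have "0 < bump T d x \<longleftrightarrow> (norm (T (x - d)))\<^sup>2 < 1"
    by (auto simp: bump_def max_def zero_less_power2)
  then show ?thesis
    by (simp add: power_less_one_iff abs_square_less_1)
qed

lemma has_derivative_max_sq:
  "((\<lambda>s::real. (max 0 s)\<^sup>2) has_real_derivative 2 * max 0 s) (at s)"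
proof -
  consider "s < 0" | "s > 0" | "s = 0" by linarith
  then show ?thesis
  proof cases
    case 1
    have "\<forall>\<^sub>F x in nhds s. (max 0 x)\<^sup>2 = 0"
      using eventually_nhds_in_open[of "{..<0}" s] 1 by (auto elim: eventually_mono)
    then show ?thesis
      using 1 by (subst DERIV_cong_ev[OF refl _ refl, where g = "\<lambda>_. 0"]) auto
  next
    case 2
    have "\<forall>\<^sub>F x in nhds s. (max 0 x)\<^sup>2 = x\<^sup>2"
      using eventually_nhds_in_open[of "{0<..}" s] 2 by (auto elim: eventually_mono)
    then show ?thesis
      using 2 by (subst DERIV_cong_ev[OF refl _ refl, where g = "\<lambda>x. x\<^sup>2"]) (auto intro!: derivative_eq_intros)
  next
    case 3
    have "((\<lambda>h::real. (max 0 h)\<^sup>2 / h) \<longlongrightarrow> 0) (at 0)"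
    proof (rule Lim_null_comparison[of _ "\<lambda>h. \<bar>h\<bar>"])
      show "\<forall>\<^sub>F h::real in at 0. norm ((max 0 h)\<^sup>2 / h) \<le> \<bar>h\<bar>"
        by (intro always_eventually) (auto simp: max_def power2_eq_square)
    qed (auto intro!: tendsto_eq_intros)
    then show ?thesis
      by (simp add: 3 DERIV_def)
  qed
qed

text \<open>The gradient of \<open>(norm (T (x - d)))\<^sup>2\<close> is
  \<open>2 T' (T (x - d))\<close>, hence the adjoint \<open>T'\<close> as a parameter. The
  directional form of the gradient mentions \<open>T\<close> alone and shows that the bump is
  constant to first order along the kernel of \<open>T\<close>.\<close>

lemma
  fixes T T' :: "'a::real_inner \<Rightarrow> 'a"
  assumes T: "bounded_linear T" and T': "bounded_linear T'" and adj: "\<And>x y. T x \<bullet> y = x \<bullet> T' y"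
  shows C1b_bump: "C1b (bump T d)"
    and grad_bump: "grad (bump T d) x \<bullet> h
          = - 4 * max 0 (1 - (norm (T (x - d)))\<^sup>2) * (T (x - d) \<bullet> T h)"
proof -
  let ?g = "\<lambda>x. (- 4 * max 0 (1 - (norm (T (x - d)))\<^sup>2)) *\<^sub>R T' (T (x - d))"
  have d1: "((\<lambda>x. 1 - (norm (T (x - d)))\<^sup>2) has_derivative (\<lambda>h. - 2 * (T (x - d) \<bullet> T h))) (at x)" for x
    unfolding power2_norm_eq_inner
    by (auto intro!: derivative_eq_intros bounded_linear.has_derivative[OF T] simp: inner_commute)
  have d: "(bump T d has_derivative (\<lambda>h. ?g x \<bullet> h)) (at x)" for x
    unfolding bump_def
    by (rule has_derivative_eq_rhs[OF has_derivative_compose[OF d1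
          has_field_derivative_imp_has_derivative[OF has_derivative_max_sq]]])
      (auto simp: fun_eq_iff inner_commute adj[symmetric])
  have "?g x \<bullet> h = - 4 * max 0 (1 - (norm (T (x - d)))\<^sup>2) * (T (x - d) \<bullet> T h)"
    by (simp add: adj inner_commute)
  then show "grad (bump T d) x \<bullet> h = - 4 * max 0 (1 - (norm (T (x - d)))\<^sup>2) * (T (x - d) \<bullet> T h)"
    using grad_eqI[OF d[of x]] by metis
  obtain K where K: "K > 0" "\<And>x. norm (T' x) \<le> norm x * K"
    using bounded_linear.pos_bounded[OF T'] by blast
  show "C1b (bump T d)"
  proof (rule C1bI[OF _ d])
    show "\<bar>bump T d x\<bar> \<le> 1" for x
      using bump_range[of T d x] by simp
    show "continuous_on UNIV ?g"
      by (intro continuous_intros bounded_linear.continuous_on[OF T'] bounded_linear.continuous_on[OF T])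
    \<comment> \<open>The factor \<open>T' (T (x - d))\<close> may grow linearly, but where
      \<open>norm (T (x - d)) < 1\<close> it is at most \<open>K\<close>, and elsewhere the
      \<open>max\<close> factor vanishes.\<close>
    show "norm (?g x) \<le> 4 * (1 * K)" for x
    proof (cases "norm (T (x - d)) < 1")
      case True
      have "norm (?g x) = 4 * (max 0 (1 - (norm (T (x - d)))\<^sup>2) * norm (T' (T (x - d))))"
        by (simp add: abs_mult)
      also have "\<dots> \<le> 4 * (1 * K)"
        by (intro mult_left_mono mult_mono order.trans[OF K(2)])
          (use True K in \<open>auto\<close>)
      finally show ?thesis .
    next
      case False
      then have "1 \<le> (norm (T (x - d)))\<^sup>2"
        by (simp add: one_le_power)
      then show ?thesis using K by simp
    qed
  qed
qed

section \<open>Approximation of indicators by bounded C1 functions\<close>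

lemma finite_measure_bounded_convergence:
  fixes f :: "nat \<Rightarrow> 'b \<Rightarrow> real"
  assumes "finite_measure M" "\<And>n. f n \<in> borel_measurable M" "g \<in> borel_measurable M"
    and "\<And>n x. x \<in> space M \<Longrightarrow> \<bar>f n x\<bar> \<le> C"
    and "\<And>x. x \<in> space M \<Longrightarrow> (\<lambda>n. f n x) \<longlonglongrightarrow> g x"
  shows "(\<lambda>n. \<integral>x. f n x \<partial>M) \<longlonglongrightarrow> (\<integral>x. g x \<partial>M)"
proof (rule integral_dominated_convergence[where w = "\<lambda>_. C"])
  show "integrable M (\<lambda>_. C)"
    using assms(1) by (simp add: finite_measure.integrable_const)
qed (use assms in auto)

lemma finite_measure_integrable_bounded:
  fixes f :: "'b \<Rightarrow> real"
  assumes "finite_measure M" "f \<in> borel_measurable M" "\<And>x. \<bar>f x\<bar> \<le> C"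
  shows "integrable M f"
  using finite_measure.integrable_const_bound[OF assms(1), of f C] assms by auto

text \<open>Balls with centres in the countable dense set and rational radii form a base, so every
  open set is a countable union of them. Claims about all Borel sets are thus reduced to balls, both
  for approximation by C1 functions and for Caratheodory measurability.\<close>

lemma sets_borel_subset_if_balls:
  fixes D :: "'a::metric_space set"
  assumes D: "countable D" "closure D = UNIV"
    and \<A>: "sigma_algebra UNIV \<A>" and balls: "\<And>(d::'a) r. 0 < r \<Longrightarrow> ball d r \<in> \<A>"
  shows "sets borel \<subseteq> \<A>"
proof -
  interpret sigma_algebra UNIV \<A> by (rule \<A>)
  have "U \<in> \<A>" if U: "open U" for U :: "'a set"
  proof -
    let ?I = "{(d, r). d \<in> D \<and> r \<in> \<rat> \<and> 0 < r \<and> ball d r \<subseteq> U}"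
    have "U \<subseteq> (\<Union>(d, r)\<in>?I. ball d r)"
    proof
      fix x assume "x \<in> U"
      with U obtain e where e: "e > 0" "ball x e \<subseteq> U"
        using openE by blast
      \<comment> \<open>The window has two ends: a centre within \<open>e / 3\<close> of
        \<open>x\<close> has \<open>x\<close> in its ball of radius \<open>q\<close>, and
        \<open>e / 2 + e / 3 < e\<close> keeps that ball inside \<open>ball x e\<close>.\<close>
      obtain q where q: "q \<in> \<rat>" "e / 3 < q" "q < e / 2"
        using Rats_dense_in_real[of "e / 3" "e / 2"] e by auto
      have "x \<in> closure D"
        using D by simp
      then obtain d where d: "d \<in> D" "dist d x < e / 3"
        using e(1) unfolding closure_approachable by (metis divide_pos_pos zero_less_numeral)
      have "ball d q \<subseteq> ball x e"
      proof
        fix z assume "z \<in> ball d q"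
        then show "z \<in> ball x e"
          using d q dist_triangle[of x z d] by (simp add: dist_commute)
      qed
      then have "(d, q) \<in> ?I" "x \<in> ball d q"
        using d q e by auto
      then show "x \<in> (\<Union>(d, r)\<in>?I. ball d r)"
        by blast
    qed
    then have "U = (\<Union>(d, r)\<in>?I. ball d r)"
      by blast
    moreover have "countable ?I"
      by (rule countable_subset[of _ "D \<times> \<rat>"]) (auto intro: D countable_SIGMA countable_rat)
    then have "(\<Union>(d, r)\<in>?I. ball d r) \<in> \<A>"
      by (intro countable_UN') (auto intro: balls)
    ultimately show ?thesis by simp
  qed
  then have "sigma_sets UNIV {U. open U} \<subseteq> \<A>"
    by (intro sigma_sets_subset) auto
  then show ?thesis
    unfolding borel_def by simp
qed

section \<open>Functions with values between 0 and 1 and their L1 distance\<close>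

definition unit_borel :: "('a::topological_space \<Rightarrow> real) \<Rightarrow> bool" where
  "unit_borel f \<longleftrightarrow> f \<in> borel_measurable borel \<and> (\<forall>x. 0 \<le> f x \<and> f x \<le> 1)"

lemma unit_borel_indicator: "B \<in> sets borel \<Longrightarrow> unit_borel (indicator B)"
  by (auto simp: unit_borel_def indicator_def)

lemma unit_borel_mult: "unit_borel f \<Longrightarrow> unit_borel g \<Longrightarrow> unit_borel (\<lambda>x. f x * g x)"
  by (auto simp: unit_borel_def mult_le_one)

lemma unit_borel_Compl: "unit_borel f \<Longrightarrow> unit_borel (\<lambda>x. 1 - f x)"
  by (auto simp: unit_borel_def)

lemma unit_borel_prod: "(\<And>i. i \<in> I \<Longrightarrow> unit_borel (f i)) \<Longrightarrow> unit_borel (\<lambda>x. \<Prod>i\<in>I. f i x)"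
  by (auto simp: unit_borel_def intro!: prod_nonneg prod_le_1 borel_measurable_prod)

definition finite_borel :: "'a::topological_space measure \<Rightarrow> bool" where
  "finite_borel M \<longleftrightarrow> finite_measure M \<and> sets M = sets borel"

definition L1_dist :: "'a measure \<Rightarrow> ('a \<Rightarrow> real) \<Rightarrow> ('a \<Rightarrow> real) \<Rightarrow> real" where
  "L1_dist M f g = (\<integral>x. \<bar>f x - g x\<bar> \<partial>M)"

lemma finite_borel_measurable: "finite_borel M \<Longrightarrow> borel_measurable M = borel_measurable borel"
  unfolding finite_borel_def using measurable_cong_sets by blast

lemma unit_borel_abs_diff:
  assumes "unit_borel f" "unit_borel g"
  shows "(\<lambda>x. \<bar>f x - g x\<bar>) \<in> borel_measurable borel" "\<bar>\<bar>f x - g x\<bar>\<bar> \<le> 1"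
proof -
  show "(\<lambda>x. \<bar>f x - g x\<bar>) \<in> borel_measurable borel"
    using assms by (auto simp: unit_borel_def)
  show "\<bar>\<bar>f x - g x\<bar>\<bar> \<le> 1"
    using assms[unfolded unit_borel_def, THEN conjunct2, THEN spec, of x] by (simp add: abs_le_iff)
qed

text \<open>The pointwise bound is left open so that the triangle inequality and the estimate for
  products are both instances; \<open>unit_borel\<close> makes all three differences
  integrable.\<close>

lemma L1_dist_le_add:
  assumes M: "finite_borel M"
    and u: "unit_borel f" "unit_borel f'" "unit_borel g" "unit_borel g'" "unit_borel h" "unit_borel h'"
    and le: "\<And>x. \<bar>f x - f' x\<bar> \<le> \<bar>g x - g' x\<bar> + \<bar>h x - h' x\<bar>"
  shows "L1_dist M f f' \<le> L1_dist M g g' + L1_dist M h h'"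
proof -
  have int: "integrable M (\<lambda>x. \<bar>a x - b x\<bar>)" if "unit_borel a" "unit_borel b" for a b
    using M unit_borel_abs_diff[OF that]
    by (intro finite_measure_integrable_bounded[of _ _ 1]) (simp_all add: finite_borel_measurable finite_borel_def)
  have "L1_dist M f f' \<le> (\<integral>x. \<bar>g x - g' x\<bar> + \<bar>h x - h' x\<bar> \<partial>M)"
    unfolding L1_dist_def by (intro integral_mono Bochner_Integration.integrable_add int u le)
  then show ?thesis
    by (simp add: L1_dist_def int u)
qed

lemma L1_dist_mult:
  assumes M: "finite_borel M" and u: "unit_borel f" "unit_borel f'" "unit_borel g" "unit_borel g'"
  shows "L1_dist M (\<lambda>x. f x * g x) (\<lambda>x. f' x * g' x) \<le> L1_dist M f f' + L1_dist M g g'"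
proof (rule L1_dist_le_add[OF M])
  fix x
  have b: "0 \<le> f' x" "f' x \<le> 1" "0 \<le> g x" "g x \<le> 1"
    using u by (auto simp: unit_borel_def)
  have "f x * g x - f' x * g' x = (f x - f' x) * g x + f' x * (g x - g' x)"
    by (simp add: algebra_simps)
  also have "\<bar>\<dots>\<bar> \<le> \<bar>f x - f' x\<bar> * 1 + 1 * \<bar>g x - g' x\<bar>"
    using b by (intro order.trans[OF abs_triangle_ineq] add_mono) (auto simp: abs_mult mult_left_le mult_left_le_one_le)
  finally show "\<bar>f x * g x - f' x * g' x\<bar> \<le> \<bar>f x - f' x\<bar> + \<bar>g x - g' x\<bar>"
    by simp
qed (intro u unit_borel_mult)+

lemma L1_dist_Compl: "L1_dist M (\<lambda>x. 1 - f x) (\<lambda>x. 1 - g x) = L1_dist M f g"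
  unfolding L1_dist_def by (rule arg_cong[where f = "integral\<^sup>L M"]) (auto simp: fun_eq_iff)

lemma L1_dist_tendsto_zero:
  assumes M: "finite_borel M" and u: "\<And>n. unit_borel (f n)" "unit_borel g"
    and lim: "\<And>x. (\<lambda>n. f n x) \<longlonglongrightarrow> g x"
  shows "(\<lambda>n. L1_dist M (f n) g) \<longlonglongrightarrow> 0"
proof -
  have "(\<lambda>n. \<integral>x. \<bar>f n x - g x\<bar> \<partial>M) \<longlonglongrightarrow> (\<integral>x. 0 \<partial>M)"
    using M unit_borel_abs_diff[OF u]
    by (intro finite_measure_bounded_convergence[of _ _ _ 1] tendsto_rabs_zero LIM_zero lim)
      (simp_all add: finite_borel_measurable finite_borel_def)
  then show ?thesis
    by (simp add: L1_dist_def)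
qed

lemma integral_diff_measure_le_L1_dist:
  assumes M: "finite_borel M" and f: "unit_borel f" and B: "B \<in> sets borel"
  shows "\<bar>(\<integral>x. f x \<partial>M) - measure M B\<bar> \<le> L1_dist M f (indicator B)"
proof -
  have int: "integrable M g" if "unit_borel g" for g
    using M that by (intro finite_measure_integrable_bounded[of _ _ 1])
      (auto simp: finite_borel_measurable finite_borel_def unit_borel_def)
  have "(\<integral>x. f x \<partial>M) - measure M B = (\<integral>x. f x - indicator B x \<partial>M)"
    using int[OF f] int[OF unit_borel_indicator[OF B]] M B by (simp add: finite_borel_def sets_eq_imp_space_eq)
  also have "\<bar>\<dots>\<bar> \<le> L1_dist M f (indicator B)"
    unfolding L1_dist_def by (rule integral_abs_bound)
  finally show ?thesis .
qed

text \<open>A single \<open>\<phi>\<close> has to serve all measures of the family. Later the family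
  consists of the positive and negative parts of finitely many scalar components of a vector
  measure.\<close>

definition C1b_approximable :: "'i set \<Rightarrow> ('i \<Rightarrow> 'a::real_inner measure) \<Rightarrow> 'a set \<Rightarrow> bool" where
  "C1b_approximable I M B \<longleftrightarrow> B \<in> sets borel \<and> (\<forall>\<epsilon>>0. \<exists>\<phi>. C1b \<phi> \<and> unit_borel \<phi> \<and>
     (\<forall>i\<in>I. L1_dist (M i) \<phi> (indicator B) < \<epsilon>))"

lemma C1b_approximable_Compl:
  assumes "C1b_approximable I M B"
  shows "C1b_approximable I M (- B)"
  unfolding C1b_approximable_def
proof (intro conjI allI impI)
  show "- B \<in> sets borel"
    using assms by (auto simp: C1b_approximable_def)
  fix \<epsilon> :: real assume "\<epsilon> > 0"
  then obtain \<phi> where \<phi>: "C1b \<phi>" "unit_borel \<phi>" "\<And>i. i \<in> I \<Longrightarrow> L1_dist (M i) \<phi> (indicator B) < \<epsilon>"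
    using assms unfolding C1b_approximable_def by blast
  have "indicator (- B) = (\<lambda>x. 1 - indicator B x :: real)"
    by (auto simp: indicator_def)
  then show "\<exists>\<phi>. C1b \<phi> \<and> unit_borel \<phi> \<and> (\<forall>i\<in>I. L1_dist (M i) \<phi> (indicator (- B)) < \<epsilon>)"
    using \<phi> by (intro exI[of _ "\<lambda>x. 1 - \<phi> x"]) (simp add: L1_dist_Compl C1b_diff C1b_const unit_borel_Compl)
qed

lemma C1b_approximable_Int:
  assumes M: "\<forall>i\<in>I. finite_borel (M i)"
    and A: "C1b_approximable I M A" and B: "C1b_approximable I M B"
  shows "C1b_approximable I M (A \<inter> B)"
  unfolding C1b_approximable_def
proof (intro conjI allI impI)
  have AB: "A \<in> sets borel" "B \<in> sets borel"
    using A B by (auto simp: C1b_approximable_def)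
  then show "A \<inter> B \<in> sets borel"
    by simp
  fix \<epsilon> :: real assume \<epsilon>: "\<epsilon> > 0"
  obtain \<phi> where \<phi>: "C1b \<phi>" "unit_borel \<phi>" "\<And>i. i \<in> I \<Longrightarrow> L1_dist (M i) \<phi> (indicator A) < \<epsilon> / 2"
    using A \<epsilon> unfolding C1b_approximable_def by (meson half_gt_zero)
  obtain \<psi> where \<psi>: "C1b \<psi>" "unit_borel \<psi>" "\<And>i. i \<in> I \<Longrightarrow> L1_dist (M i) \<psi> (indicator B) < \<epsilon> / 2"
    using B \<epsilon> unfolding C1b_approximable_def by (meson half_gt_zero)
  have eq: "indicator (A \<inter> B) = (\<lambda>x. indicator A x * indicator B x :: real)"
    by (simp add: indicator_inter_arith fun_eq_iff)
  have "L1_dist (M i) (\<lambda>x. \<phi> x * \<psi> x) (indicator (A \<inter> B)) < \<epsilon>" if i: "i \<in> I" for i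
    unfolding eq using L1_dist_mult[OF bspec[OF M i] \<phi>(2) _ \<psi>(2), of "indicator A" "indicator B"] \<phi>(3)[OF i] \<psi>(3)[OF i] AB
    by (simp add: unit_borel_indicator)
  then show "\<exists>\<phi>. C1b \<phi> \<and> unit_borel \<phi> \<and> (\<forall>i\<in>I. L1_dist (M i) \<phi> (indicator (A \<inter> B)) < \<epsilon>)"
    using C1b_mult[OF \<phi>(1) \<psi>(1)] unit_borel_mult[OF \<phi>(2) \<psi>(2)] by blast
qed

lemma eventually_L1_dist_less:
  assumes I: "finite I" and M: "\<forall>i\<in>I. finite_borel (M i)"
    and u: "\<And>n. unit_borel (f n)" "unit_borel g"
    and lim: "\<And>x. (\<lambda>n. f n x) \<longlonglongrightarrow> g x" and \<epsilon>: "0 < \<epsilon>"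
  shows "\<exists>n. \<forall>i\<in>I. L1_dist (M i) (f n) g < \<epsilon>"
proof -
  have "\<forall>\<^sub>F n in sequentially. \<forall>i\<in>I. L1_dist (M i) (f n) g < \<epsilon>"
    by (intro eventually_ball_finite[OF I] ballI order_tendstoD(2)[OF L1_dist_tendsto_zero[OF _ u lim] \<epsilon>] bspec[OF M])
  then show ?thesis
    by (auto simp: eventually_sequentially)
qed

lemma C1b_approximable_limit:
  assumes I: "finite I" and M: "\<forall>i\<in>I. finite_borel (M i)"
    and A: "\<And>n. C1b_approximable I M (A n)" and B: "B \<in> sets borel"
    and lim: "\<And>x. (\<lambda>n. indicator (A n) x :: real) \<longlonglongrightarrow> indicator B x"
  shows "C1b_approximable I M B"
  unfolding C1b_approximable_def
proof (intro conjI allI impI B)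
  have u: "unit_borel (indicator (A n))" "unit_borel (indicator B)" for n
    using A B by (auto simp: C1b_approximable_def intro: unit_borel_indicator)
  fix \<epsilon> :: real assume \<epsilon>: "\<epsilon> > 0"
  obtain n where n: "\<And>i. i \<in> I \<Longrightarrow> L1_dist (M i) (indicator (A n)) (indicator B) < \<epsilon> / 2"
    using eventually_L1_dist_less[OF I M u lim half_gt_zero[OF \<epsilon>]] by blast
  obtain \<phi> where \<phi>: "C1b \<phi>" "unit_borel \<phi>" "\<And>i. i \<in> I \<Longrightarrow> L1_dist (M i) \<phi> (indicator (A n)) < \<epsilon> / 2"
    using A[of n] \<epsilon> unfolding C1b_approximable_def by (meson half_gt_zero)
  have "L1_dist (M i) \<phi> (indicator B) < \<epsilon>" if i: "i \<in> I" for i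
  proof -
    have "L1_dist (M i) \<phi> (indicator B) \<le> L1_dist (M i) \<phi> (indicator (A n)) + L1_dist (M i) (indicator (A n)) (indicator B)"
      by (intro L1_dist_le_add[OF bspec[OF M i]] \<phi> u) simp
    then show ?thesis
      using n[OF i] \<phi>(3)[OF i] by simp
  qed
  then show "\<exists>\<phi>. C1b \<phi> \<and> unit_borel \<phi> \<and> (\<forall>i\<in>I. L1_dist (M i) \<phi> (indicator B) < \<epsilon>)"
    using \<phi> by blast
qed

text \<open>The functions are \<open>1 - (1 - b) ^ k\<close> with a bump \<open>b\<close> that is
  positive exactly on the ball. Besides convergence, the start at 0, the monotonicity in
  \<open>k\<close> and the vanishing off the ball are recorded: their increments will form a
  nonnegative series that sums to the indicator.\<close>

lemma C1b_ball_indicator_limit: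
  fixes d :: "'a::real_inner"
  assumes "0 < r"
  shows "\<exists>\<phi>. (\<forall>k. C1b (\<phi> k) \<and> unit_borel (\<phi> k)) \<and> (\<forall>x. (\<lambda>k. \<phi> k x) \<longlonglongrightarrow> indicator (ball d r) x) \<and>
    (\<forall>x. \<phi> 0 x = 0) \<and> (\<forall>k x. \<phi> k x \<le> \<phi> (Suc k) x) \<and> (\<forall>k x. x \<notin> ball d r \<longrightarrow> \<phi> k x = (0::real))"
proof -
  let ?T = "\<lambda>x::'a. (1 / r) *\<^sub>R x"
  define \<phi> where "\<phi> k x = 1 - (1 - bump ?T d x) ^ k" for k x
  have "C1b (bump ?T d)"
    by (rule C1b_bump[of _ ?T]) (auto intro: bounded_linear_scaleR_right)
  then have C: "C1b (\<phi> k)" for k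
    unfolding \<phi>_def by (intro C1b_diff C1b_const C1b_power)
  have b: "0 \<le> 1 - bump ?T d x" "1 - bump ?T d x \<le> 1" for x
    using bump_range[of ?T d x] by auto
  have pos: "0 < bump ?T d x \<longleftrightarrow> x \<in> ball d r" for x
    using assms by (simp add: bump_pos_iff dist_norm norm_minus_commute)
  have 0: "\<phi> k x = 0" if "x \<notin> ball d r" for k x
    using pos[of x] that bump_range(1)[of ?T d x] by (simp add: \<phi>_def)
  have "(\<lambda>k. \<phi> k x) \<longlonglongrightarrow> indicator (ball d r) x" for x
  proof (cases "x \<in> ball d r")
    case True
    then have "(\<lambda>k. (1 - bump ?T d x) ^ k) \<longlonglongrightarrow> 0"
      using pos[of x] b[of x] by (intro LIMSEQ_realpow_zero) auto
    from tendsto_diff[OF tendsto_const[of 1] this] show ?thesis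
      using True by (simp add: \<phi>_def)
  qed (simp add: 0)
  moreover have "unit_borel (\<phi> k)" for k
    using C1b_measurable[OF C] b by (auto simp: unit_borel_def \<phi>_def power_le_one)
  moreover have "\<phi> k x \<le> \<phi> (Suc k) x" for k x
    using b[of x] by (simp add: \<phi>_def mult_left_le_one_le)
  ultimately show ?thesis
    using C 0 by (intro exI[of _ \<phi>]) (simp add: \<phi>_def)
qed

text \<open>Good sets principle: complements, finite intersections and pointwise limits preserve
  approximability, so the approximable sets form a sigma-algebra, and balls belong to it.\<close>

lemma C1b_approximable_borel:
  fixes M :: "'i \<Rightarrow> 'a::real_inner measure"
  assumes sep: "\<exists>D :: 'a set. countable D \<and> closure D = UNIV"
    and I: "finite I" and M: "\<forall>i\<in>I. finite_borel (M i)" and B: "B \<in> sets borel"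
  shows "C1b_approximable I M B"
proof -
  obtain D :: "'a set" where D: "countable D" "closure D = UNIV"
    using sep by blast
  have empty: "C1b_approximable I M {}"
    unfolding C1b_approximable_def by (auto intro!: exI[of _ "\<lambda>_. 0"] C1b_const simp: L1_dist_def unit_borel_def)
  have "sigma_algebra UNIV (Collect (C1b_approximable I M))"
    unfolding sigma_algebra_iff2
  proof (intro conjI ballI allI impI)
    fix A :: "nat \<Rightarrow> 'a set" assume "range A \<subseteq> Collect (C1b_approximable I M)"
    then have A: "C1b_approximable I M (A n)" for n
      by auto
    have U: "C1b_approximable I M (\<Union>k<n. A k)" for n
    proof (induction n)
      case (Suc n)
      have "(\<Union>k<Suc n. A k) = - (- (\<Union>k<n. A k) \<inter> - A n)"
        by (auto simp: less_Suc_eq)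
      then show ?case
        using C1b_approximable_Compl[OF C1b_approximable_Int[OF M C1b_approximable_Compl[OF Suc] C1b_approximable_Compl[OF A]]]
        by metis
    qed (use empty in simp)
    have "C1b_approximable I M (\<Union>k. A k)"
    proof (rule C1b_approximable_limit[OF I M U])
      show "(\<Union>k. A k) \<in> sets borel"
        using A by (auto simp: C1b_approximable_def)
    qed (rule LIMSEQ_indicator_UN)
    then show "\<Union> (range A) \<in> Collect (C1b_approximable I M)"
      by simp
  qed (use empty C1b_approximable_Compl in \<open>auto simp: Compl_eq_Diff_UNIV[symmetric]\<close>)
  moreover have "ball d r \<in> Collect (C1b_approximable I M)" if r: "0 < r" for d :: 'a and r
  proof -
    obtain \<phi> where \<phi>: "\<And>k::nat. C1b (\<phi> k)" "\<And>k. unit_borel (\<phi> k)"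
      "\<And>x. (\<lambda>k. \<phi> k x) \<longlonglongrightarrow> indicator (ball d r) x"
      using C1b_ball_indicator_limit[OF r, of d] by auto
    have "unit_borel (indicator (ball d r))"
      by (simp add: unit_borel_indicator)
    from eventually_L1_dist_less[OF I M \<phi>(2) this \<phi>(3)] \<phi>(1,2) show ?thesis
      unfolding C1b_approximable_def by simp blast
  qed
  ultimately have "sets borel \<subseteq> Collect (C1b_approximable I M)"
    by (rule sets_borel_subset_if_balls[OF D])
  then show ?thesis
    using B by auto
qed

section \<open>Disjointification of approximate indicators\<close>

lemma partition_of_unity_telescope:
  fixes f :: "nat \<Rightarrow> real"
  shows "(\<Sum>n<N. f n * (\<Prod>j<n. 1 - f j)) = 1 - (\<Prod>j<N. 1 - f j)"
  by (induction N) (auto simp: algebra_simps)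

text \<open>Separate approximations of disjoint indicators may overlap. Multiplying the
  \<open>n\<close>-th one by \<open>1 - \<phi> j\<close> for all earlier \<open>j\<close>, the
  functional analogue of removing earlier sets, forces the sum to be at most 1 everywhere while
  keeping the L1 errors under control.\<close>

lemma C1b_approximate_disjoint_family:
  fixes M :: "'i \<Rightarrow> 'a::real_inner measure"
  assumes sep: "\<exists>D :: 'a set. countable D \<and> closure D = UNIV"
    and I: "finite I" and M: "\<forall>i\<in>I. finite_borel (M i)"
    and B: "\<And>n. B n \<in> sets borel" and disj: "disjoint_family B" and \<epsilon>: "0 < \<epsilon>"
  shows "\<exists>\<psi>. (\<forall>n::nat. C1b (\<psi> n) \<and> unit_borel (\<psi> n)) \<and> (\<forall>x. (\<Sum>n<N. \<psi> n x) \<le> 1) \<and>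
    (\<forall>n<N. \<forall>i\<in>I. L1_dist (M i) (\<psi> n) (indicator (B n)) < \<epsilon>)"
proof -
  \<comment> \<open>In the \<open>n\<close>-th function the errors of its own factor and of the
    \<open>n\<close> earlier factors add up to less than \<open>(n + 1) * \<delta>\<close>.\<close>
  define \<delta> where "\<delta> = \<epsilon> / (N + 1)"
  have \<delta>: "\<delta> > 0"
    using \<epsilon> by (simp add: \<delta>_def)
  have "\<exists>\<phi>. C1b \<phi> \<and> unit_borel \<phi> \<and> (\<forall>i\<in>I. L1_dist (M i) \<phi> (indicator (B n)) < \<delta>)" for n
  proof -
    have "C1b_approximable I M (B n)"
      by (rule C1b_approximable_borel[OF sep I M B])
    then show ?thesis
      using \<delta> unfolding C1b_approximable_def by blast
  qed
  then obtain \<phi> where \<phi>: "\<And>n. C1b (\<phi> n)" "\<And>n. unit_borel (\<phi> n)"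
    "\<And>n i. i \<in> I \<Longrightarrow> L1_dist (M i) (\<phi> n) (indicator (B n)) < \<delta>"
    by metis
  define \<psi> where "\<psi> n = (\<lambda>x. \<phi> n x * (\<Prod>j<n. 1 - \<phi> j x))" for n
  have uB: "unit_borel (indicator (B n))" for n
    by (rule unit_borel_indicator[OF B])
  have u: "unit_borel (\<lambda>x. \<Prod>j<n. 1 - \<phi> j x)" "unit_borel (\<lambda>x. \<Prod>j<n. 1 - indicator (B j) x)" for n
    by (intro unit_borel_prod unit_borel_Compl \<phi> uB)+
  have "L1_dist (M i) (\<psi> n) (indicator (B n)) < \<epsilon>" if n: "n < N" and i: "i \<in> I" for n i
  proof -
    have prod: "L1_dist (M i) (\<lambda>x. \<Prod>j<k. 1 - \<phi> j x) (\<lambda>x. \<Prod>j<k. 1 - indicator (B j) x) \<le> k * \<delta>" for k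
    proof (induction k)
      case (Suc k)
      then show ?case
        using L1_dist_mult[OF bspec[OF M i] u(1)[of k] u(2)[of k] unit_borel_Compl[OF \<phi>(2)[of k]] unit_borel_Compl[OF uB[of k]]]
          \<phi>(3)[OF i, of k]
        by (simp add: L1_dist_Compl distrib_right)
    qed (simp add: L1_dist_def)
    \<comment> \<open>Disjoint sets are unchanged by the removal of earlier ones, so
      \<open>\<psi> n\<close> still approximates \<open>B n\<close> itself.\<close>
    have "indicator (B n) x = (indicator (B n) x * (\<Prod>j<n. 1 - indicator (B j) x) :: real)" for x
    proof (cases "x \<in> B n")
      case True
      have "B j \<inter> B n = {}" if "j < n" for j
        using disj that by (simp add: disjoint_family_on_def)
      with True have "(\<Prod>j<n. 1 - indicator (B j) x) = (1::real)"
        by (intro prod.neutral) (auto simp: indicator_def)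
      then show ?thesis by simp
    qed simp
    then have "L1_dist (M i) (\<psi> n) (indicator (B n))
        = L1_dist (M i) (\<psi> n) (\<lambda>x. indicator (B n) x * (\<Prod>j<n. 1 - indicator (B j) x))"
      by presburger
    also have "\<dots> \<le> L1_dist (M i) (\<phi> n) (indicator (B n)) + n * \<delta>"
      unfolding \<psi>_def by (rule order.trans[OF L1_dist_mult[OF bspec[OF M i] \<phi>(2) uB u]]) (simp add: prod)
    also have "\<dots> < (n + 1) * \<delta>"
      using \<phi>(3)[OF i, of n] by (simp add: distrib_right)
    also have "\<dots> \<le> (N + 1) * \<delta>"
      using n \<delta> by (intro mult_right_mono) auto
    also have "\<dots> = \<epsilon>"
      by (simp add: \<delta>_def)
    finally show ?thesis .
  qed
  moreover have "(\<Sum>n<N. \<psi> n x) \<le> 1" for x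
    using u(1)[of N] unfolding \<psi>_def partition_of_unity_telescope by (simp add: unit_borel_def)
  moreover have "C1b (\<psi> n)" "unit_borel (\<psi> n)" for n
    unfolding \<psi>_def by (intro C1b_mult C1b_prod C1b_diff C1b_const unit_borel_mult \<phi> u)+
  ultimately show ?thesis
    by (intro exI[of _ \<psi>]) simp
qed

section \<open>Signed and vector measures\<close>

text \<open>No minimality is asked of \<open>P\<close> and \<open>N\<close>, in accordance with
  \<open>signed_integral\<close>, which admits every such pair.\<close>

definition signed_decomp :: "('a::topological_space set \<Rightarrow> real) \<Rightarrow> 'a measure \<Rightarrow> 'a measure \<Rightarrow> bool" where
  "signed_decomp \<mu> P N \<longleftrightarrow> finite_borel P \<and> finite_borel N \<and>
     (\<forall>B \<in> sets borel. \<mu> B = measure P B - measure N B)"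

lemma step_function_approx:
  fixes B :: "'j \<Rightarrow> 'a set" and \<phi> :: "'a \<Rightarrow> real"
  assumes J: "finite J" "disjoint_family_on B J" "(\<Union>j\<in>J. B j) = UNIV"
    and c: "\<And>j x. j \<in> J \<Longrightarrow> x \<in> B j \<Longrightarrow> \<bar>\<phi> x - c j\<bar> \<le> \<epsilon>"
  shows "\<bar>\<phi> x - (\<Sum>j\<in>J. c j * indicator (B j) x)\<bar> \<le> \<epsilon>"
proof -
  obtain j where j: "j \<in> J" "x \<in> B j"
    using J(3) by blast
  have "c i * indicator (B i) x = (if i = j then c j else 0)" if "i \<in> J" for i
    using that j J(2) by (auto simp: disjoint_family_on_def indicator_def)
  then have "(\<Sum>i\<in>J. c i * indicator (B i) x) = (\<Sum>i\<in>J. if i = j then c j else 0)"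
    by (rule sum.cong[OF refl])
  also have "\<dots> = c j"
    using j J(1) by simp
  finally show ?thesis
    using c[OF j] by simp
qed

lemma integral_step_approx:
  fixes M :: "'a::topological_space measure" and B :: "'j \<Rightarrow> 'a set"
  assumes fM: "finite_borel M"
    and \<phi>: "\<phi> \<in> borel_measurable borel" "\<And>x. \<bar>\<phi> x\<bar> \<le> C"
    and J: "finite J" "\<And>j. j \<in> J \<Longrightarrow> B j \<in> sets borel" "disjoint_family_on B J" "(\<Union>j\<in>J. B j) = UNIV"
    and c: "\<And>j x. j \<in> J \<Longrightarrow> x \<in> B j \<Longrightarrow> \<bar>\<phi> x - c j\<bar> \<le> \<epsilon>"
  shows "\<bar>(\<integral>x. \<phi> x \<partial>M) - (\<Sum>j\<in>J. c j * measure M (B j))\<bar> \<le> \<epsilon> * measure M UNIV"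
proof -
  have M: "finite_measure M" "sets M = sets borel"
    using fM by (auto simp: finite_borel_def)
  interpret finite_measure M by (rule M)
  note M(2)[measurable_cong]
  note \<phi>(1)[measurable]
  define s where "s x = (\<Sum>j\<in>J. c j * indicator (B j) x)" for x
  have ind: "integrable M (indicator (B j) :: 'a \<Rightarrow> real)" "measure M (B j) = (\<integral>x. indicator (B j) x \<partial>M)"
    if "j \<in> J" for j
    using J(2)[OF that] M(2) by (auto simp: emeasure_eq_measure)
  have s: "integrable M s" "(\<integral>x. s x \<partial>M) = (\<Sum>j\<in>J. c j * measure M (B j))"
    unfolding s_def using ind
    by (auto intro!: Bochner_Integration.integrable_sum simp: Bochner_Integration.integral_sum)
  have i\<phi>: "integrable M \<phi>"
    by (rule integrable_const_bound[where B = C]) (use \<phi> in auto)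
  have "\<bar>\<phi> x - s x\<bar> \<le> \<epsilon>" for x
    unfolding s_def by (rule step_function_approx[OF J(1,3,4) c])
  then have "(\<integral>x. \<bar>\<phi> x - s x\<bar> \<partial>M) \<le> (\<integral>x. \<epsilon> \<partial>M)"
    using s(1) i\<phi> by (intro integral_mono) auto
  moreover have "\<bar>\<integral>x. \<phi> x - s x \<partial>M\<bar> \<le> (\<integral>x. \<bar>\<phi> x - s x\<bar> \<partial>M)"
    by (rule integral_abs_bound)
  moreover have "space M = UNIV"
    using sets_eq_imp_space_eq[OF M(2)] by simp
  ultimately show ?thesis
    using s i\<phi> by (simp add: mult.commute)
qed

lemma signed_decomp_step_approx:
  fixes B :: "'j \<Rightarrow> 'a::topological_space set"
  assumes d: "signed_decomp \<mu> P N"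
    and \<phi>: "\<phi> \<in> borel_measurable borel" "\<And>x. \<bar>\<phi> x\<bar> \<le> C"
    and J: "finite J" "\<And>j. j \<in> J \<Longrightarrow> B j \<in> sets borel" "disjoint_family_on B J" "(\<Union>j\<in>J. B j) = UNIV"
    and c: "\<And>j x. j \<in> J \<Longrightarrow> x \<in> B j \<Longrightarrow> \<bar>\<phi> x - c j\<bar> \<le> \<epsilon>"
  shows "\<bar>(\<integral>x. \<phi> x \<partial>P) - (\<integral>x. \<phi> x \<partial>N) - (\<Sum>j\<in>J. c j * \<mu> (B j))\<bar> \<le> \<epsilon> * (measure P UNIV + measure N UNIV)"
proof -
  have "(\<Sum>j\<in>J. c j * \<mu> (B j)) = (\<Sum>j\<in>J. c j * measure P (B j)) - (\<Sum>j\<in>J. c j * measure N (B j))"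
    using d J(2) by (simp add: signed_decomp_def right_diff_distrib sum_subtractf)
  moreover have "\<bar>(\<integral>x. \<phi> x \<partial>P) - (\<Sum>j\<in>J. c j * measure P (B j))\<bar> \<le> \<epsilon> * measure P UNIV"
    "\<bar>(\<integral>x. \<phi> x \<partial>N) - (\<Sum>j\<in>J. c j * measure N (B j))\<bar> \<le> \<epsilon> * measure N UNIV"
    using d by (auto simp: signed_decomp_def intro!: integral_step_approx \<phi> J c)
  ultimately show ?thesis
    by (simp add: distrib_left)
qed

text \<open>\<open>p j\<close> is a sample point of \<open>B j\<close>; it is arbitrary when \<open>B j\<close> is empty.\<close>

definition step_partition ::
  "'i set \<Rightarrow> ('i \<Rightarrow> 'a::topological_space \<Rightarrow> real) \<Rightarrow> real \<Rightarrow> 'j set \<Rightarrow> ('j \<Rightarrow> 'a set) \<Rightarrow> ('j \<Rightarrow> 'a) \<Rightarrow> bool" where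
  "step_partition I f \<epsilon> J B p \<longleftrightarrow> finite J \<and> (\<forall>j\<in>J. B j \<in> sets borel) \<and>
     disjoint_family_on B J \<and> (\<Union>j\<in>J. B j) = UNIV \<and>
     (\<forall>i\<in>I. \<forall>j\<in>J. \<forall>x\<in>B j. \<bar>f i x - f i (p j)\<bar> \<le> \<epsilon>)"

text \<open>The cells are the joint level sets of the integer vectors
  \<open>\<lfloor>f i x / \<epsilon>\<rfloor>\<close>, which take finitely many values by
  boundedness. One partition fits all \<open>f i\<close> at once, as needed to sample a vector field
  at a single point per cell.\<close>

lemma step_partition_exists:
  fixes f :: "'i \<Rightarrow> 'a::topological_space \<Rightarrow> real"
  assumes I: "finite I" and f: "\<And>i. i \<in> I \<Longrightarrow> f i \<in> borel_measurable borel"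
    "\<And>i x. i \<in> I \<Longrightarrow> \<bar>f i x\<bar> \<le> C" and \<epsilon>: "0 < \<epsilon>"
  shows "\<exists>(J :: ('i \<Rightarrow> int) set) B p. step_partition I f \<epsilon> J B p"
proof -
  define K where "K = \<lceil>C / \<epsilon>\<rceil>"
  let ?J = "Pi\<^sub>E I (\<lambda>_. {- K - 1..K})"
  define B where "B j = {x. \<forall>i\<in>I. \<lfloor>f i x / \<epsilon>\<rfloor> = j i}" for j
  define p where "p j = (SOME x. x \<in> B j)" for j
  have "finite ?J"
    by (intro finite_PiE I) auto
  moreover have "B j \<in> sets borel" for j
  proof -
    have "{x \<in> space borel. \<lfloor>f i x / \<epsilon>\<rfloor> = j i} \<in> sets borel" if "i \<in> I" for i
    proof -
      have "{y::real. \<lfloor>y\<rfloor> = k} = {of_int k..<of_int k + 1}" for k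
        by (auto simp: floor_eq_iff)
      then have "(\<lambda>x. f i x / \<epsilon>) -` {y. \<lfloor>y\<rfloor> = j i} \<in> sets borel"
        using measurable_sets_borel[of "\<lambda>x. f i x / \<epsilon>" borel "{of_int (j i)..<of_int (j i) + 1}"] f(1)[OF that]
        by simp
      then show ?thesis
        by (simp add: vimage_def)
    qed
    then have "{x \<in> space borel. \<forall>i\<in>I. \<lfloor>f i x / \<epsilon>\<rfloor> = j i} \<in> sets borel"
      by (intro sets.sets_Collect_finite_All I) auto
    then show ?thesis
      by (simp add: B_def)
  qed
  moreover have "disjoint_family_on B ?J"
    unfolding disjoint_family_on_def
  proof (intro ballI impI)
    fix j j' assume "j \<in> ?J" "j' \<in> ?J" "j \<noteq> j'"
    then obtain i where "i \<in> I" "j i \<noteq> j' i"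
      by (metis PiE_ext)
    then show "B j \<inter> B j' = {}"
      by (auto simp: B_def)
  qed
  moreover have "(\<Union>j\<in>?J. B j) = UNIV"
  proof (intro UNIV_eq_I[symmetric])
    fix x
    have "- K - 1 \<le> \<lfloor>f i x / \<epsilon>\<rfloor> \<and> \<lfloor>f i x / \<epsilon>\<rfloor> \<le> K" if "i \<in> I" for i
    proof -
      have "- (C / \<epsilon>) \<le> f i x / \<epsilon>" "f i x / \<epsilon> \<le> C / \<epsilon>"
        using f(2)[OF that, of x] \<epsilon> by (auto simp: field_simps abs_le_iff)
      moreover have "C / \<epsilon> \<le> of_int K"
        unfolding K_def by (rule le_of_int_ceiling)
      ultimately have "of_int (- K - 1) \<le> f i x / \<epsilon>" "f i x / \<epsilon> \<le> of_int K"
        by (simp_all add: algebra_simps)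
      then show ?thesis
        by (simp add: le_floor_iff floor_le_iff)
    qed
    then have "restrict (\<lambda>i. \<lfloor>f i x / \<epsilon>\<rfloor>) I \<in> ?J" "x \<in> B (restrict (\<lambda>i. \<lfloor>f i x / \<epsilon>\<rfloor>) I)"
      by (auto simp: B_def)
    then show "x \<in> (\<Union>j\<in>?J. B j)"
      by blast
  qed
  moreover have "\<bar>f i x - f i (p j)\<bar> \<le> \<epsilon>" if "i \<in> I" "x \<in> B j" for i j x
  proof -
    have "p j \<in> B j"
      unfolding p_def using that(2) by (rule someI)
    then have "\<lfloor>f i x / \<epsilon>\<rfloor> = \<lfloor>f i (p j) / \<epsilon>\<rfloor>"
      using that by (auto simp: B_def)
    then have "\<bar>f i x / \<epsilon> - f i (p j) / \<epsilon>\<bar> \<le> 1"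
      by linarith
    then have "\<bar>f i x - f i (p j)\<bar> / \<epsilon> \<le> 1"
      using \<epsilon> by (simp add: diff_divide_distrib[symmetric] abs_divide)
    then show ?thesis
      using \<epsilon> by (simp add: field_simps)
  qed
  ultimately show ?thesis
    by (intro exI[of _ ?J] exI[of _ B] exI[of _ p]) (simp add: step_partition_def)
qed

text \<open>The description in \<open>signed_integral\<close> is unique because both candidate
  values are limits of the same step sums, and these involve \<open>\<mu>\<close> but not the
  decomposition.\<close>

lemma signed_integral_eq:
  assumes d: "signed_decomp \<mu> P N" and \<phi>: "\<phi> \<in> borel_measurable borel" "\<And>x. \<bar>\<phi> x\<bar> \<le> C"
  shows "signed_integral \<mu> \<phi> = (\<integral>x. \<phi> x \<partial>P) - (\<integral>x. \<phi> x \<partial>N)"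
  unfolding signed_integral_def
proof (rule the_equality)
  fix r assume "\<exists>P N. finite_measure P \<and> finite_measure N \<and> sets P = sets borel \<and> sets N = sets borel \<and>
       (\<forall>B \<in> sets borel. \<mu> B = measure P B - measure N B) \<and> r = (\<integral>x. \<phi> x \<partial>P) - (\<integral>x. \<phi> x \<partial>N)"
  then obtain P' N' where d': "signed_decomp \<mu> P' N'" and r: "r = (\<integral>x. \<phi> x \<partial>P') - (\<integral>x. \<phi> x \<partial>N')"
    unfolding signed_decomp_def finite_borel_def by blast
  define s where "s = (\<integral>x. \<phi> x \<partial>P) - (\<integral>x. \<phi> x \<partial>N)"
  define K where "K = measure P UNIV + measure N UNIV + (measure P' UNIV + measure N' UNIV)"
  have "\<bar>r - s\<bar> \<le> 0"
  proof (rule le_if_le_add_mult_epsilon)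
    show "0 \<le> K"
      by (simp add: K_def)
    fix \<delta> :: real assume \<delta>: "0 < \<delta>"
    have "\<exists>(J :: (unit \<Rightarrow> int) set) B p. step_partition (UNIV :: unit set) (\<lambda>_. \<phi>) \<delta> J B p"
      using \<phi> \<delta> by (intro step_partition_exists) auto
    then obtain J :: "(unit \<Rightarrow> int) set" and B p where J: "step_partition (UNIV :: unit set) (\<lambda>_. \<phi>) \<delta> J B p"
      by blast
    have J5: "\<bar>\<phi> x - \<phi> (p j)\<bar> \<le> \<delta>" if "j \<in> J" "x \<in> B j" for x j
      using J that by (auto simp: step_partition_def)
    have J: "finite J" "\<And>j. j \<in> J \<Longrightarrow> B j \<in> sets borel" "disjoint_family_on B J" "(\<Union>j\<in>J. B j) = UNIV"
      using J by (auto simp: step_partition_def)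
    have "\<bar>s - (\<Sum>j\<in>J. \<phi> (p j) * \<mu> (B j))\<bar> \<le> \<delta> * (measure P UNIV + measure N UNIV)"
      unfolding s_def by (rule signed_decomp_step_approx[OF d \<phi> J J5])
    moreover have "\<bar>r - (\<Sum>j\<in>J. \<phi> (p j) * \<mu> (B j))\<bar> \<le> \<delta> * (measure P' UNIV + measure N' UNIV)"
      unfolding r by (rule signed_decomp_step_approx[OF d' \<phi> J J5])
    ultimately show "\<bar>r - s\<bar> \<le> 0 + K * \<delta>"
      by (simp add: K_def algebra_simps)
  qed
  then show "r = (\<integral>x. \<phi> x \<partial>P) - (\<integral>x. \<phi> x \<partial>N)"
    by (simp add: s_def)
qed (use d in \<open>auto simp: signed_decomp_def finite_borel_def\<close>)

section \<open>Countably additive set functions and their positive and negative parts\<close>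

lemma countably_additive_vm_empty:
  assumes "countably_additive_vm m"
  shows "m {} = 0"
proof -
  have "(\<lambda>n::nat. m {}) sums m (\<Union>n::nat. {})"
    using assms[unfolded countably_additive_vm_def, rule_format, of "\<lambda>_. {}"]
    by (simp add: disjoint_family_on_def)
  then have "(\<lambda>n::nat. m {}) \<longlonglongrightarrow> 0"
    using sums_summable summable_LIMSEQ_zero by blast
  then show ?thesis
    by (simp add: LIMSEQ_const_iff)
qed

lemma countably_additive_vm_finite_UN:
  fixes m :: "'a::topological_space set \<Rightarrow> 'b::real_normed_vector"
  assumes m: "countably_additive_vm m" and B: "\<And>i. i < (n::nat) \<Longrightarrow> B i \<in> sets borel"
    and disj: "disjoint_family_on B {..<n}"
  shows "m (\<Union>i<n. B i) = (\<Sum>i<n. m (B i))"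
proof -
  define B' where "B' i = (if i < n then B i else {})" for i
  have "disjoint_family B'" "\<And>i. B' i \<in> sets borel"
    using disj B by (auto simp: B'_def disjoint_family_on_def)
  then have "(\<lambda>i. m (B' i)) sums m (\<Union>i. B' i)"
    using m by (simp add: countably_additive_vm_def)
  moreover have "(\<Union>i. B' i) = (\<Union>i<n. B i)"
    by (auto simp: B'_def split: if_splits)
  moreover have "(\<lambda>i. m (B' i)) sums (\<Sum>i<n. m (B' i))"
    by (rule sums_finite) (auto simp: B'_def countably_additive_vm_empty[OF m])
  moreover have "(\<Sum>i<n. m (B' i)) = (\<Sum>i<n. m (B i))"
    by (rule sum.cong) (auto simp: B'_def)
  ultimately show ?thesis
    using sums_unique2 by metis
qed

lemma countably_additive_vm_inner:
  fixes m :: "'a::topological_space set \<Rightarrow> 'b::real_inner"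
  assumes "countably_additive_vm m"
  shows "countably_additive_vm (\<lambda>B. m B \<bullet> y)"
  using assms bounded_linear.sums[OF bounded_linear_inner_left] unfolding countably_additive_vm_def by blast

lemma finite_borel_measure_of_sums:
  fixes p :: "'a::topological_space set \<Rightarrow> real"
  assumes p: "\<And>B. B \<in> sets borel \<Longrightarrow> 0 \<le> p B" and ca: "countably_additive_vm p"
  obtains P where "finite_measure P" "sets P = sets borel" "\<And>B. B \<in> sets borel \<Longrightarrow> measure P B = p B"
proof
  let ?P = "measure_of UNIV (sets borel) (\<lambda>B. ennreal (p B)) :: 'a measure"
  have sets_P: "sets ?P = sets borel"
    using sets.sigma_sets_eq[of "borel :: 'a measure"] by (simp add: sets_measure_of_conv)
  have em: "emeasure ?P B = ennreal (p B)" if "B \<in> sets borel" for B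
  proof (rule emeasure_measure_of_sigma[OF _ _ _ that])
    show "sigma_algebra UNIV (sets (borel :: 'a measure))"
      using sets.sigma_algebra_axioms[of "borel :: 'a measure"] by simp
    show "positive (sets borel) (\<lambda>B. ennreal (p B))"
      by (simp add: positive_def countably_additive_vm_empty[OF ca])
    show "countably_additive (sets borel) (\<lambda>B. ennreal (p B))"
      unfolding countably_additive_def
    proof (intro allI impI)
      fix B :: "nat \<Rightarrow> 'a set" assume B: "range B \<subseteq> sets borel" "disjoint_family B"
      then have s: "(\<lambda>i. p (B i)) sums p (\<Union>i. B i)"
        using ca by (auto simp: countably_additive_vm_def)
      then show "(\<Sum>i. ennreal (p (B i))) = ennreal (p (\<Union>i. B i))"
        using B(1) by (subst suminf_ennreal2) (auto intro: p simp: sums_iff)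
    qed
  qed
  show "finite_measure ?P"
    by (rule finite_measureI) (simp add: em space_measure_of_conv)
  show "sets ?P = sets borel"
    by (rule sets_P)
  show "measure ?P B = p B" if "B \<in> sets borel" for B
    by (simp add: measure_def em[OF that] p[OF that])
qed

text \<open>The positive part is the upper variation, the supremum \<open>p\<close> of
  \<open>\<mu>\<close> over Borel subsets, and the negative part is \<open>p - \<mu>\<close>; no
  Hahn set is constructed. Near-optimal subsets of disjoint pieces give superadditivity of
  \<open>p\<close>, and cutting a competitor along the pieces gives countable subadditivity.\<close>

lemma signed_decomp_exists:
  fixes \<mu> :: "'a::topological_space set \<Rightarrow> real"
  assumes ca: "countably_additive_vm \<mu>" and C: "\<And>B. B \<in> sets borel \<Longrightarrow> \<bar>\<mu> B\<bar> \<le> C"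
  shows "\<exists>P N. signed_decomp \<mu> P N"
proof -
  define p where "p B = (SUP A\<in>{A \<in> sets borel. A \<subseteq> B}. \<mu> A)" for B
  have bdd: "bdd_above (\<mu> ` {A \<in> sets borel. A \<subseteq> B})" for B
    using C by (intro bdd_aboveI[of _ C]) (auto simp: abs_le_iff)
  have up: "\<mu> A \<le> p B" if "A \<in> sets borel" "A \<subseteq> B" for A B
    unfolding p_def using that by (intro cSUP_upper bdd) auto
  have p0: "0 \<le> p B" for B
    using up[of "{}" B] countably_additive_vm_empty[OF ca] by simp
  have sup_add: "(\<Sum>i<n. p (B i)) \<le> p (\<Union>i<n. B i)"
    if B: "\<And>i. B i \<in> sets borel" "disjoint_family B" for B :: "nat \<Rightarrow> 'a set" and n
  proof (rule field_le_epsilon)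
    fix e :: real assume e: "e > 0"
    have "\<exists>A\<in>{A \<in> sets borel. A \<subseteq> B i}. p (B i) - e / (n + 1) < \<mu> A" for i
      using e unfolding p_def by (intro less_cSUP_iff[THEN iffD1] bdd) (auto intro!: diff_strict_right_mono)
    then obtain A where A: "\<And>i. A i \<in> sets borel" "\<And>i. A i \<subseteq> B i" "\<And>i. p (B i) - e / (n + 1) < \<mu> (A i)"
      by simp metis
    have "(\<Sum>i<n. p (B i)) \<le> (\<Sum>i<n. \<mu> (A i) + e / (n + 1))"
      using A(3) by (intro sum_mono) (simp add: less_imp_le algebra_simps)
    also have "\<dots> = (\<Sum>i<n. \<mu> (A i)) + n * (e / (n + 1))"
      by (simp add: sum.distrib)
    also have "n * (e / (n + 1)) \<le> e"
      using e by (simp add: field_simps)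
    also have "(\<Sum>i<n. \<mu> (A i)) = \<mu> (\<Union>i<n. A i)"
    proof (rule countably_additive_vm_finite_UN[OF ca, symmetric])
      have "A i \<inter> A j = {}" if "i \<noteq> j" for i j
        using A(2)[of i] A(2)[of j] B(2) that unfolding disjoint_family_on_def by blast
      then show "disjoint_family_on A {..<n}"
        by (simp add: disjoint_family_on_def)
    qed (use A in auto)
    also have "\<mu> (\<Union>i<n. A i) \<le> p (\<Union>i<n. B i)"
      using A(1,2) by (intro up) auto
    finally show "(\<Sum>i<n. p (B i)) \<le> p (\<Union>i<n. B i) + e"
      by simp
  qed
  have p_mono: "p A \<le> p B" if "A \<subseteq> B" for A B
    unfolding p_def using that by (intro cSUP_subset_mono bdd) auto
  have p_ca: "countably_additive_vm p"
    unfolding countably_additive_vm_def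
  proof (intro allI impI)
    fix B :: "nat \<Rightarrow> 'a set" assume B: "\<forall>n. B n \<in> sets borel" "disjoint_family B"
    have le: "(\<Sum>i<n. p (B i)) \<le> p (\<Union>i. B i)" for n
    proof -
      have "(\<Sum>i<n. p (B i)) \<le> p (\<Union>i<n. B i)"
        using sup_add B by blast
      also have "\<dots> \<le> p (\<Union>i. B i)"
        by (rule p_mono) blast
      finally show ?thesis .
    qed
    have sm: "summable (\<lambda>i. p (B i))"
      using le by (intro summableI_nonneg_bounded p0)
    have "p (\<Union>i. B i) \<le> (\<Sum>i. p (B i))"
      unfolding p_def[of "\<Union>i. B i"]
    proof (rule cSUP_least)
      fix A assume A: "A \<in> {A \<in> sets borel. A \<subseteq> (\<Union>i. B i)}"
      have "(\<lambda>i. \<mu> (A \<inter> B i)) sums \<mu> (\<Union>i. A \<inter> B i)"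
      proof (rule ca[unfolded countably_additive_vm_def, rule_format])
        show "disjoint_family (\<lambda>i. A \<inter> B i)"
          using B(2) unfolding disjoint_family_on_def by blast
      qed (use A B in auto)
      moreover have "(\<Union>i. A \<inter> B i) = A"
        using A by auto
      moreover have "\<mu> (A \<inter> B i) \<le> p (B i)" for i
        using A B by (intro up) auto
      ultimately show "\<mu> A \<le> (\<Sum>i. p (B i))"
        using sums_le[OF _ _ summable_sums[OF sm], of "\<lambda>i. \<mu> (A \<inter> B i)" "\<mu> A"] by simp
    qed auto
    moreover have "(\<Sum>i. p (B i)) \<le> p (\<Union>i. B i)"
      using le by (intro suminf_le_const sm)
    ultimately show "(\<lambda>n. p (B n)) sums p (\<Union>n. B n)"
      using sm by (simp add: sums_iff)
  qed
  obtain P where P: "finite_measure P" "sets P = sets borel" "\<And>B. B \<in> sets borel \<Longrightarrow> measure P B = p B"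
    using finite_borel_measure_of_sums[OF p0 p_ca] by metis
  have n_ca: "countably_additive_vm (\<lambda>B. p B - \<mu> B)"
    using p_ca ca unfolding countably_additive_vm_def by (simp add: sums_diff)
  have n0: "0 \<le> p B - \<mu> B" if "B \<in> sets borel" for B
    using up[OF that] by simp
  obtain N where N: "finite_measure N" "sets N = sets borel" "\<And>B. B \<in> sets borel \<Longrightarrow> measure N B = p B - \<mu> B"
    using finite_borel_measure_of_sums[OF n0 n_ca] by metis
  show ?thesis
    by (intro exI[of _ P] exI[of _ N]) (simp add: signed_decomp_def finite_borel_def P N)
qed

section \<open>Total variation and the pairing with vector fields\<close>

lemma sum_norm_le_total_variation:
  fixes m :: "'a::topological_space set \<Rightarrow> 'b::real_normed_vector"
  assumes m0: "m {} = 0" and J: "finite J" "\<And>j. j \<in> J \<Longrightarrow> B j \<in> sets borel"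
    "disjoint_family_on B J" "(\<Union>j\<in>J. B j) = UNIV"
  shows "ennreal (\<Sum>j\<in>J. norm (m (B j))) \<le> total_variation m"
proof -
  obtain e where e: "bij_betw e {..<card J} J"
    using ex_bij_betw_nat_finite[OF J(1)] by (auto simp: atLeast0LessThan)
  define B' where "B' n = (if n < card J then B (e n) else {})" for n
  have eJ: "e i \<in> J" if "i < card J" for i
    using e that by (auto simp: bij_betw_def)
  have e_inj: "e i \<noteq> e j" if "i < card J" "j < card J" "i \<noteq> j" for i j
    using e that by (auto simp: bij_betw_def inj_on_def)
  have B': "\<forall>n. B' n \<in> sets borel" "disjoint_family B'" "(\<Union>n. B' n) = UNIV"
  proof -
    show "\<forall>n. B' n \<in> sets borel"
      using J(2) eJ by (auto simp: B'_def)
    show "disjoint_family B'"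
      using J(3) eJ e_inj unfolding disjoint_family_on_def B'_def by simp
    have "x \<in> (\<Union>n. B' n)" for x
    proof -
      obtain j where "j \<in> J" "x \<in> B j"
        using J(4) by blast
      moreover from this obtain i where "i < card J" "e i = j"
        using e unfolding bij_betw_def by (metis imageE lessThan_iff)
      ultimately show ?thesis
        by (auto simp: B'_def intro!: exI[of _ i])
    qed
    then show "(\<Union>n. B' n) = UNIV"
      by blast
  qed
  have "(\<Sum>j\<in>J. norm (m (B j))) = (\<Sum>n<card J. norm (m (B' n)))"
    by (subst sum.reindex_bij_betw[OF e, symmetric]) (simp add: B'_def)
  then have "ennreal (\<Sum>j\<in>J. norm (m (B j))) = (\<Sum>n<card J. ennreal (norm (m (B' n))))"
    by (simp add: sum_ennreal)
  also have "\<dots> \<le> (\<Sum>n. ennreal (norm (m (B' n))))"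
    by (rule sum_le_suminf) auto
  also have "\<dots> \<le> total_variation m"
    unfolding total_variation_def using B' by (intro SUP_upper) auto
  finally show ?thesis .
qed

lemma vector_measure_bounded:
  assumes m: "vector_measure m" and B: "B \<in> sets borel"
  shows "norm (m B) \<le> enn2real (total_variation m)"
proof -
  have ca: "countably_additive_vm m" and fin: "total_variation m < \<infinity>"
    using m by (auto simp: vector_measure_def)
  have "norm (m B) \<le> (\<Sum>b\<in>(UNIV::bool set). norm (m (if b then B else - B)))"
    by (simp add: UNIV_bool)
  also have "\<dots> = enn2real (ennreal (\<Sum>b\<in>(UNIV::bool set). norm (m (if b then B else - B))))"
    by (simp add: sum_nonneg)
  also have "\<dots> \<le> enn2real (total_variation m)"
  proof (rule enn2real_mono[OF sum_norm_le_total_variation])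
    show "m {} = 0"
      by (rule countably_additive_vm_empty[OF ca])
    show "disjoint_family_on (\<lambda>b. if b then B else - B) UNIV"
      by (auto simp: disjoint_family_on_def)
    show "(\<Union>b\<in>UNIV. if b then B else - B) = UNIV"
      by (auto split: if_splits)
  qed (use B fin in auto)
  finally show ?thesis .
qed

lemma vector_measure_signed_decomp:
  fixes m :: "'a::topological_space set \<Rightarrow> 'b::real_inner"
  assumes m: "vector_measure m"
  shows "\<exists>P N. signed_decomp (\<lambda>B. m B \<bullet> y) P N"
proof (rule signed_decomp_exists)
  show "countably_additive_vm (\<lambda>B. m B \<bullet> y)"
    using m by (auto simp: vector_measure_def intro: countably_additive_vm_inner)
  show "\<bar>m B \<bullet> y\<bar> \<le> enn2real (total_variation m) * norm y" if "B \<in> sets borel" for B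
    using Cauchy_Schwarz_ineq2[of "m B" y] vector_measure_bounded[OF m that]
    by (meson mult_right_mono norm_ge_zero order_trans)
qed

text \<open>On a partition fine for all coefficients, the sum of integrals is close to the sum of
  \<open>m (B j) \<bullet> F (p j)\<close>, where \<open>F\<close> is the field. As the step values
  are sampled from \<open>F\<close> itself, they keep the bound \<open>norm \<le> 1\<close>, also at
  the arbitrary sample points of empty cells.\<close>

lemma field_integral_le_total_variation:
  fixes m :: "'a::topological_space set \<Rightarrow> 'b::real_inner" and f :: "nat \<Rightarrow> 'a \<Rightarrow> real"
  assumes m: "vector_measure m"
    and f: "\<And>i. i < n \<Longrightarrow> f i \<in> borel_measurable borel" "\<And>i x. i < n \<Longrightarrow> \<bar>f i x\<bar> \<le> C"
    and F: "\<And>x. norm (\<Sum>i<n. f i x *\<^sub>R y i) \<le> 1"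
  shows "(\<Sum>i<n. signed_integral (\<lambda>B. m B \<bullet> y i) (f i)) \<le> enn2real (total_variation m)"
proof -
  have "\<forall>i. \<exists>PN. signed_decomp (\<lambda>B. m B \<bullet> y i) (fst PN) (snd PN)"
    using vector_measure_signed_decomp[OF m] by simp
  then obtain PN where PN: "\<And>i. signed_decomp (\<lambda>B. m B \<bullet> y i) (fst (PN i)) (snd (PN i))"
    by (rule choice[THEN exE]) blast
  define P N where "P i = fst (PN i)" and "N i = snd (PN i)" for i
  have PN: "signed_decomp (\<lambda>B. m B \<bullet> y i) (P i) (N i)" for i
    using PN by (simp add: P_def N_def)
  define K where "K = (\<Sum>i<n. measure (P i) UNIV + measure (N i) UNIV)"
  show ?thesis
  proof (rule le_if_le_add_mult_epsilon)
    show "0 \<le> K"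
      unfolding K_def by (intro sum_nonneg add_nonneg_nonneg) auto
    fix \<delta> :: real assume \<delta>: "0 < \<delta>"
    have "\<exists>(J :: (nat \<Rightarrow> int) set) B p. step_partition {..<n} f \<delta> J B p"
      using f \<delta> by (intro step_partition_exists) auto
    then obtain J :: "(nat \<Rightarrow> int) set" and B p where "step_partition {..<n} f \<delta> J B p"
      by blast
    then have J: "finite J" "\<And>j. j \<in> J \<Longrightarrow> B j \<in> sets borel" "disjoint_family_on B J" "(\<Union>j\<in>J. B j) = UNIV"
      "\<And>i j x. i < n \<Longrightarrow> j \<in> J \<Longrightarrow> x \<in> B j \<Longrightarrow> \<bar>f i x - f i (p j)\<bar> \<le> \<delta>"
      by (auto simp: step_partition_def)
    have "signed_integral (\<lambda>B. m B \<bullet> y i) (f i)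
        \<le> (\<Sum>j\<in>J. f i (p j) * (m (B j) \<bullet> y i)) + \<delta> * (measure (P i) UNIV + measure (N i) UNIV)" if i: "i < n" for i
      using signed_decomp_step_approx[OF PN[of i] f(1)[OF i] f(2)[OF i] J(1-4), of "\<lambda>j. f i (p j)" \<delta>] J(5)[of i] i
      by (auto simp: signed_integral_eq[OF PN[of i] f(1)[OF i] f(2)[OF i]])
    then have "(\<Sum>i<n. signed_integral (\<lambda>B. m B \<bullet> y i) (f i))
        \<le> (\<Sum>i<n. (\<Sum>j\<in>J. f i (p j) * (m (B j) \<bullet> y i)) + \<delta> * (measure (P i) UNIV + measure (N i) UNIV))"
      by (intro sum_mono) auto
    also have "\<dots> = (\<Sum>j\<in>J. m (B j) \<bullet> (\<Sum>i<n. f i (p j) *\<^sub>R y i)) + \<delta> * K"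
      by (subst sum.distrib, subst sum.swap) (simp add: K_def inner_sum_right sum_distrib_left)
    also have "(\<Sum>j\<in>J. m (B j) \<bullet> (\<Sum>i<n. f i (p j) *\<^sub>R y i)) \<le> (\<Sum>j\<in>J. norm (m (B j)))"
    proof (intro sum_mono)
      fix j
      show "m (B j) \<bullet> (\<Sum>i<n. f i (p j) *\<^sub>R y i) \<le> norm (m (B j))"
        using norm_cauchy_schwarz[of "m (B j)" "\<Sum>i<n. f i (p j) *\<^sub>R y i"] F[of "p j"]
        by (meson mult_left_le norm_ge_zero order_trans)
    qed
    also have "(\<Sum>j\<in>J. norm (m (B j))) \<le> enn2real (total_variation m)"
    proof -
      have "(\<Sum>j\<in>J. norm (m (B j))) = enn2real (ennreal (\<Sum>j\<in>J. norm (m (B j))))"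
        by (simp add: sum_nonneg)
      also have "\<dots> \<le> enn2real (total_variation m)"
        using m by (intro enn2real_mono sum_norm_le_total_variation J countably_additive_vm_empty)
          (auto simp: vector_measure_def)
      finally show ?thesis .
    qed
    finally show "(\<Sum>i<n. signed_integral (\<lambda>B. m B \<bullet> y i) (f i)) \<le> enn2real (total_variation m) + K * \<delta>"
      by (simp add: mult.commute)
  qed
qed

lemma subspace_dense_norming:
  fixes S :: "'b::real_inner set"
  assumes S: "subspace S" "closure S = UNIV" and \<epsilon>: "0 < \<epsilon>"
  obtains w where "w \<in> S" "norm w \<le> 1" "norm a - \<epsilon> \<le> a \<bullet> w"
proof (cases "a = 0")
  case True
  then show ?thesis
    using that[of 0] S(1) \<epsilon> by (simp add: subspace_0)
next
  case False
  \<comment> \<open>The unit vector of \<open>a\<close> is approximated within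
    \<open>\<delta>\<close> in \<open>S\<close> and then shrunk by \<open>1 + \<delta>\<close> into
    the unit ball; each of the two steps costs at most \<open>\<delta> * norm a\<close>.\<close>
  define \<delta> where "\<delta> = \<epsilon> / (2 * norm a)"
  have \<delta>: "\<delta> > 0" "2 * \<delta> * norm a = \<epsilon>"
    using False \<epsilon> by (auto simp: \<delta>_def)
  have "sgn a \<in> closure S"
    using S by simp
  then obtain s where s: "s \<in> S" "norm (s - sgn a) < \<delta>"
    using \<delta>(1) unfolding closure_approachable dist_norm by blast
  define w where "w = (1 / (1 + \<delta>)) *\<^sub>R s"
  have "norm s \<le> 1 + \<delta>"
    using norm_triangle_ineq[of "s - sgn a" "sgn a"] s(2) False by (simp add: norm_sgn)
  then have w1: "norm w \<le> 1"
    using \<delta>(1) by (simp add: w_def)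
  have "a \<bullet> (sgn a - s) \<le> norm a * norm (sgn a - s)"
    by (rule norm_cauchy_schwarz)
  also have "\<dots> \<le> norm a * \<delta>"
    using s(2) by (intro mult_left_mono) (auto simp: norm_minus_commute)
  finally have "norm a - norm a * \<delta> \<le> a \<bullet> s"
    using False by (simp add: inner_diff_right sgn_div_norm dot_square_norm power2_eq_square field_simps)
  moreover have "(1 + \<delta>) * (norm a - 2 * \<delta> * norm a) \<le> norm a - norm a * \<delta>"
    using \<delta>(1) by (simp add: algebra_simps)
  ultimately have "(1 + \<delta>) * (norm a - \<epsilon>) \<le> a \<bullet> s"
    using \<delta>(2) by simp
  then have "norm a - \<epsilon> \<le> a \<bullet> w"
    using \<delta>(1) by (simp add: w_def field_simps)
  with w1 show ?thesis
    using that[of w] S(1) s(1) by (simp add: w_def subspace_scale)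
qed

text \<open>Each \<open>m (B n)\<close> is nearly normed by a vector \<open>w n\<close> of the dense
  subspace. Smoothing the indicators of the \<open>B n\<close> into functions with sum at most 1
  turns the step field with values \<open>w n\<close> into a test field bounded by 1, because every
  \<open>w n\<close> lies in the unit ball.\<close>

lemma total_variation_le:
  fixes m :: "'a::real_inner set \<Rightarrow> 'b::real_inner"
  assumes sep: "\<exists>D :: 'a set. countable D \<and> closure D = UNIV"
    and m: "vector_measure m" and S: "subspace S" "closure S = UNIV"
    and V: "\<And>n \<psi> w. (\<And>i. i < n \<Longrightarrow> C1b (\<psi> i) \<and> w i \<in> S) \<Longrightarrow>
      (\<And>x. norm (\<Sum>i<n. \<psi> i x *\<^sub>R w i) \<le> 1) \<Longrightarrow>
      (\<Sum>i<(n::nat). signed_integral (\<lambda>B. m B \<bullet> w i) (\<psi> i)) \<le> V"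
  shows "total_variation m \<le> ennreal V"
  unfolding total_variation_def
proof (rule SUP_least, clarify)
  fix B :: "nat \<Rightarrow> 'a set" assume B: "\<forall>n. B n \<in> sets borel" "disjoint_family B"
  have "(\<Sum>n<k. norm (m (B n))) \<le> V" for k
  proof (rule le_if_le_add_mult_epsilon)
    \<comment> \<open>Each of the \<open>k\<close> sets costs \<open>3 * \<delta>\<close>: once for
      the norming vector and once for the integral against each of \<open>P n\<close> and
      \<open>N n\<close>.\<close>
    show "0 \<le> 3 * real k"
      by simp
    fix \<delta> :: real assume \<delta>: "0 < \<delta>"
    have "\<exists>w. w \<in> S \<and> norm w \<le> 1 \<and> norm (m (B n)) - \<delta> \<le> m (B n) \<bullet> w" for n
      using subspace_dense_norming[OF S \<delta>] by metis
    then obtain w where w: "\<And>n. w n \<in> S" "\<And>n. norm (w n) \<le> 1" "\<And>n. norm (m (B n)) - \<delta> \<le> m (B n) \<bullet> w n"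
      by metis
    have "\<forall>i. \<exists>PN. signed_decomp (\<lambda>B. m B \<bullet> w i) (fst PN) (snd PN)"
      using vector_measure_signed_decomp[OF m] by simp
    then obtain PN where PN: "\<And>i. signed_decomp (\<lambda>B. m B \<bullet> w i) (fst (PN i)) (snd (PN i))"
      by (rule choice[THEN exE]) blast
    define P N where "P i = fst (PN i)" and "N i = snd (PN i)" for i
    have PN: "signed_decomp (\<lambda>B. m B \<bullet> w i) (P i) (N i)" for i
      using PN by (simp add: P_def N_def)
    \<comment> \<open>The \<open>2 * k\<close> positive measures are gathered in one family, the
      Boolean choosing the part, so that the smoothing can be chosen for all of them
      together.\<close>
    define M where "M = (\<lambda>(i, b). if b then P i else N i)"
    have M: "\<forall>i\<in>{..<k} \<times> UNIV. finite_borel (M i)"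
      using PN by (auto simp: M_def signed_decomp_def)
    have "finite ({..<k} \<times> (UNIV :: bool set))" "\<And>n. B n \<in> sets borel"
      using B(1) by auto
    from C1b_approximate_disjoint_family[OF sep this(1) M this(2) B(2) \<delta>, of k]
    obtain \<psi> :: "nat \<Rightarrow> 'a \<Rightarrow> real" where "\<forall>n. C1b (\<psi> n) \<and> unit_borel (\<psi> n)" "\<forall>x. (\<Sum>n<k. \<psi> n x) \<le> 1"
      "\<forall>n<k. \<forall>i\<in>{..<k} \<times> UNIV. L1_dist (M i) (\<psi> n) (indicator (B n)) < \<delta>"
      by blast
    then have \<psi>: "\<And>n. C1b (\<psi> n)" "\<And>n. unit_borel (\<psi> n)" "\<And>x. (\<Sum>n<k. \<psi> n x) \<le> 1"
      "\<And>n i. n < k \<Longrightarrow> i \<in> {..<k} \<times> UNIV \<Longrightarrow> L1_dist (M i) (\<psi> n) (indicator (B n)) < \<delta>"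
      by blast+
    have "norm (\<Sum>i<k. \<psi> i x *\<^sub>R w i) \<le> 1" for x
    proof -
      have "norm (\<Sum>i<k. \<psi> i x *\<^sub>R w i) \<le> (\<Sum>i<k. \<psi> i x * 1)"
        using \<psi>(2) w(2) by (intro sum_norm_le) (auto simp: unit_borel_def intro!: mult_left_le)
      then show ?thesis
        using \<psi>(3)[of x] by simp
    qed
    then have V': "(\<Sum>i<k. signed_integral (\<lambda>B. m B \<bullet> w i) (\<psi> i)) \<le> V"
      using \<psi>(1) w(1) by (intro V) auto
    have "norm (m (B n)) - 3 * \<delta> \<le> signed_integral (\<lambda>B. m B \<bullet> w n) (\<psi> n)" if n: "n < k" for n
    proof -
      have err: "\<bar>(\<integral>x. \<psi> n x \<partial>M i) - measure (M i) (B n)\<bar> < \<delta>" if "i \<in> {..<k} \<times> UNIV" for i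
        using integral_diff_measure_le_L1_dist[OF bspec[OF M that] \<psi>(2), of "B n" n] \<psi>(4)[OF n that] B(1) by simp
      have "signed_integral (\<lambda>B. m B \<bullet> w n) (\<psi> n) = (\<integral>x. \<psi> n x \<partial>P n) - (\<integral>x. \<psi> n x \<partial>N n)"
        by (rule signed_integral_eq[OF PN, where C = 1]) (use \<psi>(2)[of n] in \<open>auto simp: unit_borel_def\<close>)
      moreover have "m (B n) \<bullet> w n = measure (P n) (B n) - measure (N n) (B n)"
        using PN[of n] B by (simp add: signed_decomp_def)
      moreover have "\<bar>(\<integral>x. \<psi> n x \<partial>P n) - measure (P n) (B n)\<bar> < \<delta>" "\<bar>(\<integral>x. \<psi> n x \<partial>N n) - measure (N n) (B n)\<bar> < \<delta>"
        using err[of "(n, True)"] err[of "(n, False)"] n by (auto simp: M_def)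
      ultimately show ?thesis
        using w(3)[of n] by linarith
    qed
    then have "(\<Sum>n<k. norm (m (B n)) - 3 * \<delta>) \<le> (\<Sum>n<k. signed_integral (\<lambda>B. m B \<bullet> w n) (\<psi> n))"
      by (intro sum_mono) auto
    with V' show "(\<Sum>n<k. norm (m (B n))) \<le> V + 3 * real k * \<delta>"
      by (simp add: sum_subtractf)
  qed
  then have "(\<Sum>n<k. ennreal (norm (m (B n)))) \<le> ennreal V" for k
    by (simp add: sum_ennreal ennreal_leI)
  then show "(\<Sum>n. ennreal (norm (m (B n)))) \<le> ennreal V"
    by (simp add: suminf_eq_SUP SUP_least)
qed

section \<open>Bounded functionals of gradient type are tight\<close>

text \<open>A finite sum of compact segments is compact. This yields the finite net in the
  directions of an almost optimal field, the only directions in which cutoffs must vary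
  slowly.\<close>

lemma compact_coordinate_box:
  fixes S :: "'a::real_normed_vector set"
  assumes "finite S"
  shows "compact {x. \<exists>t. (\<forall>e\<in>S. \<bar>t e\<bar> \<le> (R::real)) \<and> x = (\<Sum>e\<in>S. t e *\<^sub>R e)}"
  using assms
proof induction
  case empty
  have "{x. \<exists>t. (\<forall>e\<in>{}. \<bar>t e\<bar> \<le> R) \<and> x = (\<Sum>e\<in>{}. t e *\<^sub>R e)} = {0::'a}"
    by auto
  then show ?case
    by (metis (no_types, lifting) compact_sing)
next
  case (insert a S)
  let ?K = "{x. \<exists>t. (\<forall>e\<in>S. \<bar>t e\<bar> \<le> R) \<and> x = (\<Sum>e\<in>S. t e *\<^sub>R e)}"
  have "compact ((\<lambda>s. s *\<^sub>R a) ` {-R..R})"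
    by (intro compact_continuous_image continuous_intros) auto
  then have "compact {x + y | x y. x \<in> (\<lambda>s. s *\<^sub>R a) ` {-R..R} \<and> y \<in> ?K}"
    using insert.IH by (rule compact_sums)
  moreover have "{x. \<exists>t. (\<forall>e\<in>insert a S. \<bar>t e\<bar> \<le> R) \<and> x = (\<Sum>e\<in>insert a S. t e *\<^sub>R e)}
      = {x + y | x y. x \<in> (\<lambda>s. s *\<^sub>R a) ` {-R..R} \<and> y \<in> ?K}" (is "?A = ?B")
  proof (intro set_eqI iffI)
    fix z assume "z \<in> ?A"
    then obtain t where t: "\<forall>e\<in>insert a S. \<bar>t e\<bar> \<le> R" "z = (\<Sum>e\<in>insert a S. t e *\<^sub>R e)"
      by blast
    have "z = t a *\<^sub>R a + (\<Sum>e\<in>S. t e *\<^sub>R e)"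
      using t(2) insert.hyps by simp
    moreover have "t a *\<^sub>R a \<in> (\<lambda>s. s *\<^sub>R a) ` {-R..R}" "(\<Sum>e\<in>S. t e *\<^sub>R e) \<in> ?K"
      using t(1) by (auto simp: abs_le_iff)
    ultimately show "z \<in> ?B"
      by blast
  next
    fix z assume "z \<in> ?B"
    then obtain s y where s: "s \<in> {-R..R}" "z = s *\<^sub>R a + y" and y: "y \<in> ?K"
      by blast
    then obtain t where "\<forall>e\<in>S. \<bar>t e\<bar> \<le> R" "y = (\<Sum>e\<in>S. t e *\<^sub>R e)"
      by blast
    with s have st: "\<bar>s\<bar> \<le> R" "\<forall>e\<in>S. \<bar>t e\<bar> \<le> R" "z = s *\<^sub>R a + (\<Sum>e\<in>S. t e *\<^sub>R e)"
      by (auto simp: abs_le_iff)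
    have "(\<Sum>e\<in>S. t e *\<^sub>R e) = (\<Sum>e\<in>S. (t(a := s)) e *\<^sub>R e)"
      using insert.hyps by (intro sum.cong) auto
    then have "z = (\<Sum>e\<in>insert a S. (t(a := s)) e *\<^sub>R e)"
      using st(3) insert.hyps by simp
    moreover have "\<forall>e\<in>insert a S. \<bar>(t(a := s)) e\<bar> \<le> R"
      using st(1,2) by simp
    ultimately show "z \<in> ?A"
      by blast
  qed
  ultimately show ?case
    by simp
qed

lemma norm_orthonormal_sum:
  fixes E :: "'a::real_inner set"
  assumes E: "\<And>e. e \<in> E \<Longrightarrow> norm e = 1" "\<And>e e'. e \<in> E \<Longrightarrow> e' \<in> E \<Longrightarrow> e \<noteq> e' \<Longrightarrow> e \<bullet> e' = 0"
    and S: "finite S" "S \<subseteq> E"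
  shows "norm (\<Sum>e\<in>S. a e *\<^sub>R e) = L2_set a S"
proof -
  have "(norm (\<Sum>e\<in>S. a e *\<^sub>R e))\<^sup>2 = (\<Sum>e\<in>S. (norm (a e *\<^sub>R e))\<^sup>2)"
  proof (rule norm_sum_Pythagorean[OF S(1)])
    show "pairwise (\<lambda>i j. orthogonal (a i *\<^sub>R i) (a j *\<^sub>R j)) S"
      using E(2) S(2) by (auto simp: pairwise_def orthogonal_def)
  qed
  also have "\<dots> = (\<Sum>e\<in>S. (a e)\<^sup>2)"
    using E(1) S(2) by (intro sum.cong) auto
  finally show ?thesis
    unfolding L2_set_def by (metis norm_ge_zero real_sqrt_unique)
qed

lemma orthonormal_inner_sum:
  fixes E :: "'a::real_inner set"
  assumes E: "\<And>e. e \<in> E \<Longrightarrow> norm e = 1" "\<And>e e'. e \<in> E \<Longrightarrow> e' \<in> E \<Longrightarrow> e \<noteq> e' \<Longrightarrow> e \<bullet> e' = 0"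
    and S: "finite S" "S \<subseteq> E" "e \<in> E"
  shows "(\<Sum>e\<in>S. a e *\<^sub>R e) \<bullet> e = (if e \<in> S then a e else 0)"
proof -
  have "(\<Sum>e\<in>S. a e *\<^sub>R e) \<bullet> e = (\<Sum>i\<in>S. if i = e then a e else 0)"
    unfolding inner_sum_left
  proof (rule sum.cong[OF refl])
    fix i assume "i \<in> S"
    then show "a i *\<^sub>R i \<bullet> e = (if i = e then a e else 0)"
      using E(1)[of e] E(2)[of i e] S(2,3) by (auto simp: dot_square_norm)
  qed
  then show ?thesis
    using S(1) by simp
qed

text \<open>At scale \<open>1 / Suc j\<close> the finite set \<open>C j\<close> handles the terms
  beyond index \<open>j\<close>, and the remaining terms are finitely many. So the range is totally
  bounded, and by completeness its closure is compact.\<close>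

lemma convergent_subsequence_if_tail_coverings:
  fixes x :: "nat \<Rightarrow> 'a::complete_space"
  assumes C: "\<And>j. finite (C j)" and x: "\<And>j k. j < k \<Longrightarrow> \<exists>c\<in>C j. dist c (x k) < 1 / Suc j"
  shows "\<exists>l s. strict_mono (s :: nat \<Rightarrow> nat) \<and> (x \<circ> s) \<longlonglongrightarrow> l"
proof -
  have "\<exists>K. finite K \<and> range x \<subseteq> (\<Union>c\<in>K. ball c r)" if "r > 0" for r
  proof -
    obtain j where j: "1 / Suc j < r"
      using \<open>r > 0\<close> by (metis nat_approx_posE)
    have "range x \<subseteq> (\<Union>c\<in>x ` {..j} \<union> C j. ball c r)"
    proof (rule image_subsetI)
      fix k
      show "x k \<in> (\<Union>c\<in>x ` {..j} \<union> C j. ball c r)"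
      proof (cases "k \<le> j")
        case True
        moreover have "x k \<in> ball (x k) r"
          using \<open>r > 0\<close> by simp
        ultimately show ?thesis by blast
      next
        case False
        then obtain c where "c \<in> C j" "dist c (x k) < 1 / Suc j"
          using x[of j k] by auto
        then have "c \<in> x ` {..j} \<union> C j" "x k \<in> ball c r"
          using j by auto
        then show ?thesis by blast
      qed
    qed
    then show ?thesis
      using C by (intro exI[of _ "x ` {..j} \<union> C j"]) auto
  qed
  then have tb: "\<exists>K. finite K \<and> closure (range x) \<subseteq> (\<Union>c\<in>K. ball c r)" if "r > 0" for r
  proof -
    obtain K where K: "finite K" "range x \<subseteq> (\<Union>c\<in>K. ball c (r / 2))"
      using \<open>\<And>r. 0 < r \<Longrightarrow> \<exists>K. finite K \<and> range x \<subseteq> (\<Union>c\<in>K. ball c r)\<close>[of "r / 2"] \<open>r > 0\<close> by auto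
    \<comment> \<open>Closed balls of half the radius: their finite union is closed and therefore
      also contains the closure.\<close>
    have "range x \<subseteq> (\<Union>c\<in>K. cball c (r / 2))"
      by (rule order.trans[OF K(2)]) (intro UN_mono subset_refl ball_subset_cball)
    moreover have "closed (\<Union>c\<in>K. cball c (r / 2))"
      using K(1) by (intro closed_UN) auto
    ultimately have "closure (range x) \<subseteq> (\<Union>c\<in>K. cball c (r / 2))"
      by (rule closure_minimal)
    also have "\<dots> \<subseteq> (\<Union>c\<in>K. ball c r)"
      using \<open>r > 0\<close> by (intro UN_mono subset_refl) (auto simp: subset_iff)
    finally show ?thesis
      using K(1) by blast
  qed
  have "compact (closure (range x))"
    unfolding compact_eq_totally_bounded
  proof (intro conjI allI impI)
    show "Topological_Spaces.complete (closure (range x))"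
      by (simp add: complete_eq_closed)
  qed (rule tb)
  then have sc: "seq_compact (closure (range x))"
    by (simp add: compact_eq_seq_compact_metric)
  have mem: "\<forall>n. x n \<in> closure (range x)"
    by (intro allI subsetD[OF closure_subset] rangeI)
  show ?thesis
  proof (rule seq_compactE[OF sc mem])
    fix l s assume "strict_mono (s :: nat \<Rightarrow> nat)" "(x \<circ> s) \<longlonglongrightarrow> l"
    then show ?thesis by blast
  qed
qed

text \<open>The model is \<open>L e \<phi> = \<integral> u (v \<phi> - \<partial>\<phi>/\<partial>e) d\<nu>\<close>. The last assumption is what remains of the integral
  representation: \<open>L e (f \<theta>)\<close> is small as soon as \<open>\<theta>\<close> and its derivative in the single direction \<open>e\<close>
  are, whatever the other derivatives of \<open>\<theta>\<close> do.\<close>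

locale gradient_functional =
  fixes E :: "'a::{real_inner, complete_space} set"
    and L :: "'a \<Rightarrow> ('a \<Rightarrow> real) \<Rightarrow> real" and V :: real
  assumes sep: "\<exists>D :: 'a set. countable D \<and> closure D = UNIV"
    and E_norm: "\<And>e. e \<in> E \<Longrightarrow> norm e = 1"
    and E_orth: "\<And>e e'. e \<in> E \<Longrightarrow> e' \<in> E \<Longrightarrow> e \<noteq> e' \<Longrightarrow> e \<bullet> e' = 0"
    and E_dense: "closure (span E) = UNIV"
    and L_add: "\<And>e \<phi> \<psi>. e \<in> E \<Longrightarrow> C1b \<phi> \<Longrightarrow> C1b \<psi> \<Longrightarrow> L e (\<lambda>x. \<phi> x + \<psi> x) = L e \<phi> + L e \<psi>"
    and L_cmult: "\<And>e \<phi> c. e \<in> E \<Longrightarrow> C1b \<phi> \<Longrightarrow> L e (\<lambda>x. c * \<phi> x) = c * L e \<phi>"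
    and V_nonneg: "0 \<le> V"
    and L_bound: "\<And>S f c. finite S \<Longrightarrow> S \<subseteq> E \<Longrightarrow> (\<And>e. C1b (f e)) \<Longrightarrow>
        (\<And>x. L2_set (\<lambda>e. f e x) S \<le> c) \<Longrightarrow> (\<Sum>e\<in>S. L e (f e)) \<le> V * c"
    and L_lim: "\<And>e f \<theta> C. e \<in> E \<Longrightarrow> C1b f \<Longrightarrow> (\<And>n. C1b (\<theta> n)) \<Longrightarrow>
        (\<And>n x. \<bar>\<theta> n x\<bar> \<le> C) \<Longrightarrow> (\<And>n x. \<bar>grad (\<theta> n) x \<bullet> e\<bar> \<le> C) \<Longrightarrow>
        (\<And>x. (\<lambda>n. \<theta> n x) \<longlonglongrightarrow> 0) \<Longrightarrow> (\<And>x. (\<lambda>n. grad (\<theta> n) x \<bullet> e) \<longlonglongrightarrow> 0) \<Longrightarrow>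
        (\<lambda>n. L e (\<lambda>x. f x * \<theta> n x)) \<longlonglongrightarrow> 0"
begin

text \<open>The pair stands for the field \<open>\<Sum>e\<in>S. f e x *\<^sub>R e\<close>, whose
  norm is the \<open>L2_set\<close> by orthonormality. Coefficients vanish off \<open>S\<close>, so
  \<open>S\<close> can be enlarged at will and fields with different index sets can be
  added.\<close>

definition admissible :: "'a set \<Rightarrow> ('a \<Rightarrow> 'a \<Rightarrow> real) \<Rightarrow> ('a \<Rightarrow> real) \<Rightarrow> bool" where
  "admissible S f h \<longleftrightarrow> finite S \<and> S \<subseteq> E \<and> (\<forall>e. C1b (f e)) \<and> (\<forall>e. e \<notin> S \<longrightarrow> f e = (\<lambda>_. 0)) \<and>
     (\<forall>x. L2_set (\<lambda>e. f e x) S \<le> h x)"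

definition L_field :: "'a set \<Rightarrow> ('a \<Rightarrow> 'a \<Rightarrow> real) \<Rightarrow> real" where
  "L_field S f = (\<Sum>e\<in>S. L e (f e))"

text \<open>The total variation of \<open>L\<close> as a functional on nonnegative functions; the supremum is only
  meaningful for bounded \<open>h\<close>.\<close>

definition L_var :: "('a \<Rightarrow> real) \<Rightarrow> real" where
  "L_var h = Sup {L_field S f | S f. admissible S f h}"

lemma L_zero: "e \<in> E \<Longrightarrow> L e (\<lambda>_. 0) = 0"
  using L_cmult[of e "\<lambda>_. 0" 0] by (simp add: C1b_const)

lemma L_field_add:
  assumes "S \<subseteq> E" "\<And>e. C1b (f e)" "\<And>e. C1b (g e)"
  shows "L_field S (\<lambda>e x. f e x + g e x) = L_field S f + L_field S g"
  unfolding L_field_def sum.distrib[symmetric] using assms by (intro sum.cong L_add) auto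

lemma admissible_superset:
  assumes "admissible S f h" "finite T" "S \<subseteq> T" "T \<subseteq> E"
  shows "admissible T f h" "L_field T f = L_field S f"
proof -
  have "L2_set (\<lambda>e. f e x) T = L2_set (\<lambda>e. f e x) S" for x
    unfolding L2_set_def using assms
    by (intro arg_cong[of _ _ sqrt] sum.mono_neutral_right) (auto simp: admissible_def)
  then show "admissible T f h"
    using assms by (auto simp: admissible_def)
  show "L_field T f = L_field S f"
    unfolding L_field_def using assms
    by (intro sum.mono_neutral_right) (auto simp: admissible_def intro!: L_zero)
qed

lemma admissible_zero: "(\<And>x. 0 \<le> h x) \<Longrightarrow> admissible {} (\<lambda>_ _. 0) h"
  by (simp add: admissible_def C1b_const)

lemma admissible_le:
  assumes "admissible S f h" "\<And>x. h x \<le> C"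
  shows "L_field S f \<le> V * C"
  unfolding L_field_def using assms by (intro L_bound) (auto simp: admissible_def intro: order_trans)

lemma L_var_upper:
  assumes "admissible S f h" "\<And>x. h x \<le> C"
  shows "L_field S f \<le> L_var h"
  unfolding L_var_def
proof (rule cSup_upper)
  show "bdd_above {L_field S f | S f. admissible S f h}"
    using admissible_le assms(2) by (intro bdd_aboveI[of _ "V * C"]) auto
qed (use assms in auto)

lemma L_var_least:
  assumes "\<And>x. 0 \<le> h x" "\<And>S f. admissible S f h \<Longrightarrow> L_field S f \<le> c"
  shows "L_var h \<le> c"
  unfolding L_var_def using admissible_zero[of h] assms by (intro cSup_least) auto

lemma L_var_nonneg:
  assumes "\<And>x. 0 \<le> h x" "\<And>x. h x \<le> C"
  shows "0 \<le> L_var h"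
  using L_var_upper[OF admissible_zero assms(2)] assms(1) by (simp add: L_field_def)

lemma L_var_le:
  assumes "\<And>x. 0 \<le> h x" "\<And>x. h x \<le> C"
  shows "L_var h \<le> V * C"
  using assms by (intro L_var_least admissible_le) auto

lemma L_var_mono:
  assumes "\<And>x. 0 \<le> h x" "\<And>x. h x \<le> h' x" "\<And>x. h' x \<le> C"
  shows "L_var h \<le> L_var h'"
proof (rule L_var_least)
  fix S f assume "admissible S f h"
  then have "admissible S f h'"
    using assms(2) by (auto simp: admissible_def intro: order_trans)
  then show "L_field S f \<le> L_var h'"
    using assms(3) by (rule L_var_upper)
qed (rule assms)

text \<open>A field below \<open>h\<close> and a field below \<open>k\<close> add up to one below
  \<open>h + k\<close>, by the triangle inequality. No smoothness of \<open>h\<close> and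
  \<open>k\<close> enters, in contrast to the subadditivity, where fields are multiplied by
  quotients of the bounds.\<close>

lemma L_var_superadd:
  assumes h: "\<And>x. 0 \<le> h x" "\<And>x. h x \<le> C" and k: "\<And>x. 0 \<le> k x" "\<And>x. k x \<le> D"
  shows "L_var h + L_var k \<le> L_var (\<lambda>x. h x + k x)"
proof -
  have le: "L_field S f + L_field T g \<le> L_var (\<lambda>x. h x + k x)" if f: "admissible S f h" and g: "admissible T g k" for S f T g
  proof -
    have ST: "finite (S \<union> T)" "S \<union> T \<subseteq> E"
      using f g by (auto simp: admissible_def)
    note f' = admissible_superset[OF f ST(1) _ ST(2)] and g' = admissible_superset[OF g ST(1) _ ST(2)]
    have C: "\<And>e. C1b (f e)" "\<And>e. C1b (g e)"
      using f g by (auto simp: admissible_def)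
    have "L2_set (\<lambda>e. f e x + g e x) (S \<union> T) \<le> h x + k x" for x
      using f'(1) g'(1) by (intro order.trans[OF L2_set_triangle_ineq] add_mono) (auto simp: admissible_def)
    then have "admissible (S \<union> T) (\<lambda>e x. f e x + g e x) (\<lambda>x. h x + k x)"
      using f g ST C by (auto simp: admissible_def C1b_add)
    then have "L_field (S \<union> T) (\<lambda>e x. f e x + g e x) \<le> L_var (\<lambda>x. h x + k x)"
      using h k by (intro L_var_upper[where C = "C + D"]) (auto intro: add_mono)
    then show ?thesis
      using L_field_add[OF ST(2) C] f'(2) g'(2) by simp
  qed
  have "L_var h \<le> L_var (\<lambda>x. h x + k x) - L_field T g" if "admissible T g k" for T g
    using le[OF _ that] h by (intro L_var_least) (auto simp: algebra_simps)
  then have "L_var k \<le> L_var (\<lambda>x. h x + k x) - L_var h"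
    using k by (intro L_var_least) (auto simp: algebra_simps)
  then show ?thesis
    by simp
qed

lemma admissible_mult:
  assumes f: "admissible S f h" and g: "C1b g" "\<And>x. 0 \<le> g x"
  shows "admissible S (\<lambda>e x. f e x * g x) (\<lambda>x. h x * g x)"
proof -
  have "L2_set (\<lambda>e. f e x * g x) S \<le> h x * g x" for x
  proof -
    have "L2_set (\<lambda>e. f e x * g x) S = L2_set (\<lambda>e. f e x) S * g x"
      using g(2) by (intro L2_set_left_distrib[symmetric])
    also have "\<dots> \<le> h x * g x"
      using f g(2) by (intro mult_right_mono) (auto simp: admissible_def)
    finally show ?thesis .
  qed
  then show ?thesis
    using f g(1) by (auto simp: admissible_def intro: C1b_mult)
qed

lemma admissible_weaken: "admissible S f h \<Longrightarrow> (\<And>x. h x \<le> k x) \<Longrightarrow> admissible S f k"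
  by (auto simp: admissible_def intro: order_trans)

text \<open>Riesz decomposition: a field dominated by \<open>\<phi> + \<psi>\<close> is split in the proportions
  \<open>\<phi> : \<psi> : \<delta>\<close>, where the small constant \<open>\<delta>\<close> keeps the denominators away from 0.\<close>

lemma L_var_subadd:
  assumes \<phi>: "C1b \<phi>" "\<And>x. 0 \<le> \<phi> x" and \<psi>: "C1b \<psi>" "\<And>x. 0 \<le> \<psi> x"
  shows "L_var (\<lambda>x. \<phi> x + \<psi> x) \<le> L_var \<phi> + L_var \<psi>"
proof (rule L_var_least)
  fix S f assume f: "admissible S f (\<lambda>x. \<phi> x + \<psi> x)"
  obtain A where A: "\<And>x. \<bar>\<phi> x\<bar> \<le> A"
    using C1b_bound[OF \<phi>(1)] by blast
  obtain B where B: "\<And>x. \<bar>\<psi> x\<bar> \<le> B"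
    using C1b_bound[OF \<psi>(1)] by blast
  have fC: "C1b (f e)" and S: "S \<subseteq> E" for e
    using f by (auto simp: admissible_def)
  show "L_field S f \<le> L_var \<phi> + L_var \<psi>"
  proof (rule le_if_le_add_mult_epsilon[OF V_nonneg])
    fix \<delta> :: real assume \<delta>: "0 < \<delta>"
    let ?q = "\<lambda>x. inverse (\<phi> x + \<psi> x + \<delta>)"
    have pos: "0 < \<phi> x + \<psi> x + \<delta>" for x
      using \<phi>(2)[of x] \<psi>(2)[of x] \<delta> by linarith
    have q: "C1b ?q"
      by (rule C1b_inverse[OF _ \<delta>]) (use \<phi> \<psi> in \<open>auto intro!: C1b_add C1b_const\<close>)
    have q0: "0 \<le> ?q x" for x
      using pos[of x] by simp
    have part: "admissible S (\<lambda>e x. f e x * (g x * ?q x)) g" if g: "C1b g" "\<And>x. 0 \<le> g x" for g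
    proof (rule admissible_weaken[OF admissible_mult[OF f]])
      show "C1b (\<lambda>x. g x * ?q x)"
        by (intro C1b_mult g q)
      show "0 \<le> g x * ?q x" for x
        using g(2) q0 by (intro mult_nonneg_nonneg) auto
      show "(\<phi> x + \<psi> x) * (g x * ?q x) \<le> g x" for x
      proof -
        have "(\<phi> x + \<psi> x) * ?q x \<le> 1"
          using pos[of x] \<delta> by (simp add: field_simps)
        then have "g x * ((\<phi> x + \<psi> x) * ?q x) \<le> g x * 1"
          by (intro mult_left_mono g)
        then show ?thesis
          by (simp add: mult_ac)
      qed
    qed
    note p1 = part[OF \<phi>] and p2 = part[OF \<psi>] and p3 = part[OF C1b_const less_imp_le[OF \<delta>]]
    have c1: "C1b (\<lambda>x. f e x * (\<phi> x * ?q x))" "C1b (\<lambda>x. f e x * (\<psi> x * ?q x))" "C1b (\<lambda>x. f e x * (\<delta> * ?q x))" for e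
      by (intro C1b_mult fC \<phi> \<psi> q C1b_const)+
    have "f e x = f e x * (\<phi> x * ?q x) + (f e x * (\<psi> x * ?q x) + f e x * (\<delta> * ?q x))" for e x
    proof -
      have "(\<phi> x + \<psi> x + \<delta>) * ?q x = 1"
        using pos[of x] by simp
      then have "f e x = f e x * ((\<phi> x + \<psi> x + \<delta>) * ?q x)"
        by simp
      then show ?thesis
        by (simp only: distrib_right distrib_left add.assoc)
    qed
    then have "L_field S f = L_field S (\<lambda>e x. f e x * (\<phi> x * ?q x) + (f e x * (\<psi> x * ?q x) + f e x * (\<delta> * ?q x)))"
      by presburger
    also have "\<dots> = L_field S (\<lambda>e x. f e x * (\<phi> x * ?q x)) + (L_field S (\<lambda>e x. f e x * (\<psi> x * ?q x)) + L_field S (\<lambda>e x. f e x * (\<delta> * ?q x)))"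
      by (subst L_field_add[OF S] L_field_add[OF S] | intro c1 C1b_add)+ simp
    also have "\<dots> \<le> L_var \<phi> + (L_var \<psi> + V * \<delta>)"
      using A B by (intro add_mono L_var_upper[OF p1, of A] L_var_upper[OF p2, of B] admissible_le[OF p3]) (auto simp: abs_le_iff)
    finally show "L_field S f \<le> L_var \<phi> + L_var \<psi> + V * \<delta>"
      by simp
  qed
qed (use \<phi> \<psi> in auto)

lemma L_var_zero: "L_var (\<lambda>_. 0) = 0"
  using L_var_le[of "\<lambda>_. 0" 0] L_var_nonneg[of "\<lambda>_. 0" 0] by simp

lemma L_var_sum:
  assumes "finite I" "\<And>i. i \<in> I \<Longrightarrow> C1b (\<phi> i)" "\<And>i x. i \<in> I \<Longrightarrow> 0 \<le> \<phi> i x"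
  shows "L_var (\<lambda>x. \<Sum>i\<in>I. \<phi> i x) \<le> (\<Sum>i\<in>I. L_var (\<phi> i))"
  using assms
proof (induction I)
  case (insert i I)
  have "L_var (\<lambda>x. \<Sum>j\<in>insert i I. \<phi> j x) = L_var (\<lambda>x. \<phi> i x + (\<Sum>j\<in>I. \<phi> j x))"
    using insert.hyps by simp
  also have "\<dots> \<le> L_var (\<phi> i) + L_var (\<lambda>x. \<Sum>j\<in>I. \<phi> j x)"
    using insert.prems by (intro L_var_subadd C1b_sum sum_nonneg) auto
  also have "L_var (\<lambda>x. \<Sum>j\<in>I. \<phi> j x) \<le> (\<Sum>j\<in>I. L_var (\<phi> j))"
    using insert.prems by (intro insert.IH) auto
  finally show ?case
    using insert.hyps by simp
qed (simp add: L_var_zero)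

lemma L_var_cmult:
  assumes c: "0 \<le> c" and \<phi>: "\<And>x. 0 \<le> \<phi> x" "\<And>x. \<phi> x \<le> C"
  shows "L_var (\<lambda>x. c * \<phi> x) \<le> c * L_var \<phi>"
proof (cases "c = 0")
  case False
  with c have c: "c > 0"
    by simp
  show ?thesis
  proof (rule L_var_least)
    fix S f assume f: "admissible S f (\<lambda>x. c * \<phi> x)"
    have "admissible S (\<lambda>e x. f e x * inverse c) (\<lambda>x. c * \<phi> x * inverse c)"
      by (rule admissible_mult[OF f C1b_const]) (use c in simp)
    moreover have "(\<lambda>x. c * \<phi> x * inverse c) = \<phi>"
      using c by (simp add: fun_eq_iff)
    ultimately have "L_field S (\<lambda>e x. inverse c * f e x) \<le> L_var \<phi>"
      using \<phi>(2) by (intro L_var_upper[where C = C]) (simp_all add: mult.commute)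
    moreover have "L_field S (\<lambda>e x. inverse c * f e x) = inverse c * L_field S f"
      unfolding L_field_def sum_distrib_left using f by (intro sum.cong L_cmult) (auto simp: admissible_def)
    ultimately have "inverse c * L_field S f \<le> L_var \<phi>"
      by simp
    then have "c * (inverse c * L_field S f) \<le> c * L_var \<phi>"
      using c by (intro mult_left_mono) auto
    then show "L_field S f \<le> c * L_var \<phi>"
      using c by (simp add: mult.assoc[symmetric])
  qed (use c \<phi> in auto)
qed (simp add: L_var_zero)

section \<open>Cutoffs adapted to finitely many directions\<close>

definition proj :: "'a set \<Rightarrow> 'a \<Rightarrow> 'a" where
  "proj S x = (\<Sum>e\<in>S. (x \<bullet> e) *\<^sub>R e)"

lemma bounded_linear_proj: "bounded_linear (proj S)"
  unfolding proj_def
  by (intro bounded_linear_sum bounded_linear_compose[OF bounded_linear_scaleR_left] bounded_linear_inner_left)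

lemma proj_adj: "proj S x \<bullet> y = x \<bullet> proj S y"
  unfolding proj_def inner_sum_left inner_sum_right by (simp add: inner_commute mult.commute)

lemma proj_inner:
  assumes "finite S" "S \<subseteq> E" "e \<in> S"
  shows "proj S x \<bullet> e = x \<bullet> e"
  using orthonormal_inner_sum[OF E_norm E_orth assms(1,2), where e = e and a = "\<lambda>e. x \<bullet> e"] assms
  by (auto simp: proj_def)

lemma proj_basis:
  assumes "finite S" "S \<subseteq> E" "e \<in> S"
  shows "proj S e = e"
proof -
  have "proj S e = (\<Sum>a\<in>S. if a = e then e else 0)"
    unfolding proj_def
  proof (rule sum.cong[OF refl])
    fix a assume "a \<in> S"
    then show "(e \<bullet> a) *\<^sub>R a = (if a = e then e else 0)"
      using E_orth[of e a] E_norm[of e] assms by (auto simp: dot_square_norm subset_iff)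
  qed
  then show ?thesis
    using assms by simp
qed

lemma proj_in_box:
  assumes "finite S" "S \<subseteq> E" "norm (proj S x) \<le> R"
  shows "\<exists>t. (\<forall>e\<in>S. \<bar>t e\<bar> \<le> R) \<and> proj S x = (\<Sum>e\<in>S. t e *\<^sub>R e)"
proof (intro exI conjI ballI)
  fix e assume e: "e \<in> S"
  then have "norm e = 1"
    using E_norm assms(2) by auto
  then show "\<bar>x \<bullet> e\<bar> \<le> R"
    using Cauchy_Schwarz_ineq2[of "proj S x" e] proj_inner[OF assms(1,2) e, of x] assms(3) by simp
qed (simp add: proj_def)

text \<open>A fixed profile in the coordinates of \<open>S\<close>, dilated by \<open>Suc n\<close>:
  it tends to 1 pointwise while its slope along \<open>S\<close> decays.\<close>

definition longitudinal_bump :: "'a set \<Rightarrow> nat \<Rightarrow> 'a \<Rightarrow> real" where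
  "longitudinal_bump S n = bump (\<lambda>x. (1 / Suc n) *\<^sub>R proj S x) 0"

definition transversal_bump :: "'a set \<Rightarrow> real \<Rightarrow> 'a \<Rightarrow> 'a \<Rightarrow> real" where
  "transversal_bump S \<rho> d = bump (\<lambda>x. (1 / \<rho>) *\<^sub>R (x - proj S x)) d"

text \<open>A smooth substitute for the indicator of the union of the cylinders of radius
  \<open>\<rho>\<close> around \<open>d i + span S\<close>, \<open>i < n\<close>. The index plays
  two roles: as the number of centres it exhausts a dense sequence, and as the exponent it drives
  the product to 0 wherever one of the bumps is positive.\<close>

definition transversal_cutoff :: "'a set \<Rightarrow> real \<Rightarrow> (nat \<Rightarrow> 'a) \<Rightarrow> nat \<Rightarrow> 'a \<Rightarrow> real" where
  "transversal_cutoff S \<rho> d n x = 1 - (\<Prod>i<n. (1 - transversal_bump S \<rho> (d i) x) ^ n)"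

lemma
  shows C1b_longitudinal_bump: "C1b (longitudinal_bump S n)"
    and longitudinal_bump_range: "0 \<le> longitudinal_bump S n x" "longitudinal_bump S n x \<le> 1"
    and longitudinal_bump_pos: "0 < longitudinal_bump S n x \<Longrightarrow> norm (proj S x) \<le> Suc n"
    and longitudinal_bump_tendsto: "(\<lambda>n. longitudinal_bump S n x) \<longlonglongrightarrow> 1"
proof -
  let ?T = "\<lambda>x. (1 / Suc n) *\<^sub>R proj S x"
  have bl: "bounded_linear ?T"
    by (intro bounded_linear_compose[OF bounded_linear_scaleR_right] bounded_linear_proj)
  show "C1b (longitudinal_bump S n)"
    unfolding longitudinal_bump_def by (rule C1b_bump[OF bl bl]) (simp add: proj_adj)
  show "0 \<le> longitudinal_bump S n x" "longitudinal_bump S n x \<le> 1"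
    by (simp_all add: longitudinal_bump_def bump_range)
  show "norm (proj S x) \<le> Suc n" if "0 < longitudinal_bump S n x"
    using that by (simp add: longitudinal_bump_def bump_pos_iff field_simps)
  have "(\<lambda>n. 1 / real (Suc n)) \<longlonglongrightarrow> 0"
    using LIMSEQ_inverse_real_of_nat by (simp add: inverse_eq_divide)
  then have "(\<lambda>n. (max 0 (1 - (\<bar>1 / real (Suc n)\<bar> * norm (proj S x))\<^sup>2))\<^sup>2) \<longlonglongrightarrow> (max 0 (1 - (\<bar>0\<bar> * norm (proj S x))\<^sup>2))\<^sup>2"
    by (intro tendsto_intros)
  then show "(\<lambda>n. longitudinal_bump S n x) \<longlonglongrightarrow> 1"
    by (simp add: longitudinal_bump_def bump_def)
qed

text \<open>The dilation contributes one factor \<open>1 / Suc n\<close> through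
  \<open>?T e\<close>. The other factor \<open>max 0 (1 - t\<^sup>2) * t\<close> is at most 1: for
  \<open>t \<le> 1\<close> both terms are, and for \<open>t > 1\<close> the first one is 0. The
  constant 4 comes from differentiating a square of a square.\<close>

lemma longitudinal_bump_grad:
  assumes S: "finite S" "S \<subseteq> E" "e \<in> S"
  shows "\<bar>grad (longitudinal_bump S n) x \<bullet> e\<bar> \<le> 4 / Suc n"
proof -
  let ?T = "\<lambda>x. (1 / Suc n) *\<^sub>R proj S x"
  have bl: "bounded_linear ?T"
    by (intro bounded_linear_compose[OF bounded_linear_scaleR_right] bounded_linear_proj)
  have "norm e = 1"
    using S E_norm by auto
  then have Te: "norm (?T e) = 1 / Suc n"
    using proj_basis[OF S] by simp
  have "grad (longitudinal_bump S n) x \<bullet> e = - 4 * max 0 (1 - (norm (?T (x - 0)))\<^sup>2) * (?T (x - 0) \<bullet> ?T e)"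
    unfolding longitudinal_bump_def by (rule grad_bump[OF bl bl]) (simp add: proj_adj)
  then have "\<bar>grad (longitudinal_bump S n) x \<bullet> e\<bar> = 4 * (max 0 (1 - (norm (?T x))\<^sup>2) * \<bar>?T x \<bullet> ?T e\<bar>)"
    by (simp add: abs_mult)
  also have "\<dots> \<le> 4 * (max 0 (1 - (norm (?T x))\<^sup>2) * (norm (?T x) * norm (?T e)))"
    by (intro mult_left_mono Cauchy_Schwarz_ineq2) auto
  also have "\<dots> = 4 * ((max 0 (1 - (norm (?T x))\<^sup>2) * norm (?T x)) * (1 / Suc n))"
    by (simp only: Te mult.assoc)
  also have "\<dots> \<le> 4 * (1 * (1 / Suc n))"
  proof (intro mult_left_mono mult_right_mono)
    have "max 0 (1 - t\<^sup>2) * t \<le> 1" if "t \<ge> 0" for t :: real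
    proof (cases "t \<le> 1")
      case True
      have "max 0 (1 - t\<^sup>2) * t \<le> 1 * 1"
        using True that by (intro mult_mono) auto
      then show ?thesis by simp
    next
      case False
      then have "1 \<le> t\<^sup>2"
        by (simp add: one_le_power)
      then show ?thesis by simp
    qed
    from this[OF norm_ge_zero] show "max 0 (1 - (norm (?T x))\<^sup>2) * norm (?T x) \<le> 1" .
  qed auto
  finally show ?thesis
    by simp
qed

text \<open>The bump depends only on the component orthogonal to \<open>S\<close>, and
  \<open>e - proj S e = 0\<close> for \<open>e\<close> in \<open>S\<close>. Hence its derivatives
  along \<open>S\<close> vanish exactly, however small \<open>\<rho>\<close> is.\<close>

lemma
  shows C1b_transversal_bump: "C1b (transversal_bump S \<rho> d)"
    and transversal_bump_range: "0 \<le> transversal_bump S \<rho> d x" "transversal_bump S \<rho> d x \<le> 1"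
    and transversal_bump_grad: "finite S \<Longrightarrow> S \<subseteq> E \<Longrightarrow> e \<in> S \<Longrightarrow> grad (transversal_bump S \<rho> d) x \<bullet> e = 0"
proof -
  let ?T = "\<lambda>x. (1 / \<rho>) *\<^sub>R (x - proj S x)"
  have bl: "bounded_linear ?T"
    by (intro bounded_linear_compose[OF bounded_linear_scaleR_right] bounded_linear_sub
        bounded_linear_proj bounded_linear_ident)
  have adj: "?T x \<bullet> y = x \<bullet> ?T y" for x y
    by (simp add: inner_diff_left inner_diff_right proj_adj)
  show "C1b (transversal_bump S \<rho> d)"
    unfolding transversal_bump_def by (rule C1b_bump[OF bl bl adj])
  show "0 \<le> transversal_bump S \<rho> d x" "transversal_bump S \<rho> d x \<le> 1"
    by (simp_all add: transversal_bump_def bump_range)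
  assume S: "finite S" "S \<subseteq> E" "e \<in> S"
  then show "grad (transversal_bump S \<rho> d) x \<bullet> e = 0"
    unfolding transversal_bump_def by (subst grad_bump[OF bl bl adj]) (simp add: proj_basis)
qed

lemma transversal_bump_pos_ex:
  assumes "0 < \<rho>" "closure (range d) = UNIV"
  shows "\<exists>i::nat. 0 < transversal_bump S \<rho> (d i) x"
proof -
  let ?T = "\<lambda>x. (1 / \<rho>) *\<^sub>R (x - proj S x)"
  have "bounded_linear ?T"
    by (intro bounded_linear_compose[OF bounded_linear_scaleR_right] bounded_linear_sub
        bounded_linear_proj bounded_linear_ident)
  then obtain K where K: "K > 0" "\<And>x. norm (?T x) \<le> norm x * K"
    using bounded_linear.pos_bounded by blast
  have "x \<in> closure (range d)"
    using assms by simp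
  then obtain i where i: "dist (d i) x < 1 / K"
    using K(1) unfolding closure_approachable by (metis divide_pos_pos rangeE zero_less_one)
  have "norm (?T (x - d i)) \<le> norm (x - d i) * K"
    by (rule K)
  also have "\<dots> < 1"
    using i K(1) by (simp add: dist_norm norm_minus_commute field_simps)
  finally show ?thesis
    unfolding transversal_bump_def bump_pos_iff by blast
qed

lemma C1b_transversal_cutoff: "C1b (transversal_cutoff S \<rho> d n)"
  unfolding transversal_cutoff_def
  by (intro C1b_diff C1b_const C1b_prod C1b_power C1b_transversal_bump)

lemma transversal_cutoff_range: "0 \<le> transversal_cutoff S \<rho> d n x" "transversal_cutoff S \<rho> d n x \<le> 1"
  unfolding transversal_cutoff_def using transversal_bump_range
  by (auto intro!: prod_le_1 prod_nonneg power_le_one)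

lemma transversal_cutoff_pos:
  assumes "0 < transversal_cutoff S \<rho> d n x" "0 < \<rho>"
  obtains i where "i < n" "norm (x - d i - proj S (x - d i)) < \<rho>"
proof -
  have "\<exists>i<n. transversal_bump S \<rho> (d i) x \<noteq> 0"
  proof (rule ccontr)
    assume "\<not> ?thesis"
    then have "transversal_cutoff S \<rho> d n x = 0"
      by (simp add: transversal_cutoff_def)
    then show False
      using assms by simp
  qed
  then obtain i where "i < n" "0 < transversal_bump S \<rho> (d i) x"
    using transversal_bump_range(1) by (metis less_eq_real_def)
  then show thesis
    using that[of i] \<open>0 < \<rho>\<close> by (simp add: transversal_bump_def bump_pos_iff)
qed

text \<open>By density some centre \<open>d i\<close> has a positive bump at \<open>x\<close>. From
  \<open>n > i\<close> on its factor \<open>?b ^ n\<close> occurs in the product and forces it to 0,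
  all other factors being at most 1.\<close>

lemma transversal_cutoff_tendsto:
  assumes "0 < \<rho>" "closure (range d) = UNIV"
  shows "(\<lambda>n. transversal_cutoff S \<rho> d n x) \<longlonglongrightarrow> 1"
proof -
  obtain i where i: "0 < transversal_bump S \<rho> (d i) x"
    using transversal_bump_pos_ex[OF assms] by blast
  let ?b = "1 - transversal_bump S \<rho> (d i) x"
  have b: "0 \<le> ?b" "?b < 1"
    using i transversal_bump_range[of S \<rho> "d i" x] by auto
  have "(\<lambda>n. \<Prod>j<n. (1 - transversal_bump S \<rho> (d j) x) ^ n) \<longlonglongrightarrow> 0"
  proof (rule tendsto_sandwich[OF _ _ tendsto_const LIMSEQ_realpow_zero[OF b]])
    show "\<forall>\<^sub>F n in sequentially. 0 \<le> (\<Prod>j<n. (1 - transversal_bump S \<rho> (d j) x) ^ n)"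
      using transversal_bump_range by (auto intro!: always_eventually prod_nonneg zero_le_power)
    show "\<forall>\<^sub>F n in sequentially. (\<Prod>j<n. (1 - transversal_bump S \<rho> (d j) x) ^ n) \<le> ?b ^ n"
    proof (intro eventually_sequentiallyI[of "Suc i"])
      fix n assume "Suc i \<le> n"
      then have "(\<Prod>j<n. (1 - transversal_bump S \<rho> (d j) x) ^ n)
          = ?b ^ n * (\<Prod>j\<in>{..<n} - {i}. (1 - transversal_bump S \<rho> (d j) x) ^ n)"
        by (intro prod.remove) auto
      also have "\<dots> \<le> ?b ^ n * 1"
        using transversal_bump_range b(1) by (intro mult_left_mono prod_le_1) (auto intro: power_le_one)
      finally show "(\<Prod>j<n. (1 - transversal_bump S \<rho> (d j) x) ^ n) \<le> ?b ^ n"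
        by simp
    qed
  qed
  from tendsto_diff[OF tendsto_const[of 1] this] show ?thesis
    by (simp add: transversal_cutoff_def)
qed

lemma grad_inner_diff: 
  assumes "C1b f" "C1b g"
  shows "grad (\<lambda>x. f x - g x) x \<bullet> e = grad f x \<bullet> e - grad g x \<bullet> e"
  using grad_add[OF assms(1) C1b_cmult[OF assms(2), of "- 1"], of x] grad_cmult[OF assms(2), of "- 1" x]
  by (simp add: inner_diff_left)

lemma grad_power_inner_zero:
  assumes "C1b f" "grad f x \<bullet> e = 0"
  shows "grad (\<lambda>x. f x ^ n) x \<bullet> e = 0"
proof (induction n)
  case (Suc n)
  then show ?case
    using grad_mult[OF assms(1) C1b_power[OF assms(1)], of n x] assms by (simp add: inner_add_left)
qed (simp add: grad_const)

lemma grad_prod_inner_zero: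
  assumes "finite I" "\<And>i. i \<in> I \<Longrightarrow> C1b (f i)" "\<And>i. i \<in> I \<Longrightarrow> grad (f i) x \<bullet> e = 0"
  shows "grad (\<lambda>x. \<Prod>i\<in>I. f i x) x \<bullet> e = 0"
  using assms
proof (induction I)
  case (insert i I)
  then show ?case
    using grad_mult[of "f i" "\<lambda>x. \<Prod>i\<in>I. f i x" x] C1b_prod[of I f] by (simp add: inner_add_left)
qed (simp add: grad_const)

lemma transversal_cutoff_grad:
  assumes S: "finite S" "S \<subseteq> E" "e \<in> S"
  shows "grad (transversal_cutoff S \<rho> d n) x \<bullet> e = 0"
proof -
  have 1: "grad (\<lambda>x. 1 - transversal_bump S \<rho> (d i) x) x \<bullet> e = 0" for i
    using grad_inner_diff[OF C1b_const C1b_transversal_bump, of 1 S \<rho> "d i" x e] transversal_bump_grad[OF S, of \<rho> "d i" x]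
    by (simp add: grad_const)
  have 2: "grad (\<lambda>x. \<Prod>i<n. (1 - transversal_bump S \<rho> (d i) x) ^ n) x \<bullet> e = 0"
    by (intro grad_prod_inner_zero grad_power_inner_zero C1b_power C1b_diff C1b_const C1b_transversal_bump 1) auto
  have 3: "C1b (\<lambda>x. \<Prod>i<n. (1 - transversal_bump S \<rho> (d i) x) ^ n)"
    by (intro C1b_prod C1b_power C1b_diff C1b_const C1b_transversal_bump)
  show ?thesis
    using grad_inner_diff[OF C1b_const 3, of 1 x e] 2
    by (simp add: grad_const transversal_cutoff_def[abs_def])
qed

text \<open>An almost optimal field \<open>f\<close> stays almost optimal on every part of the space, so that the variation
  of \<open>L\<close> there is controlled by \<open>L\<close> along the fixed field \<open>f\<close>.\<close>

lemma L_var_cutoff_le: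
  assumes f: "admissible S f (\<lambda>_. 1)" and opt: "L_var (\<lambda>_. 1) - \<epsilon> \<le> L_field S f"
    and \<eta>: "C1b \<eta>" "\<And>x. 0 \<le> \<eta> x" "\<And>x. \<eta> x \<le> 1"
  shows "L_var (\<lambda>x. 1 - \<eta> x) \<le> \<epsilon> + L_field S (\<lambda>e x. f e x * (1 - \<eta> x))"
proof -
  have fC: "C1b (f e)" and S: "S \<subseteq> E" for e
    using f by (auto simp: admissible_def)
  have "L_var (\<lambda>x. 1 - \<eta> x) + L_var \<eta> \<le> L_var (\<lambda>x. 1 - \<eta> x + \<eta> x)"
    using \<eta> by (intro L_var_superadd[where C = 1 and D = 1]) auto
  moreover have "L_field S (\<lambda>e x. f e x * \<eta> x) \<le> L_var \<eta>"
    using admissible_mult[OF f \<eta>(1,2)] \<eta>(3) by (intro L_var_upper) auto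
  moreover have "L_field S (\<lambda>e x. f e x * (1 - \<eta> x) + f e x * \<eta> x)
      = L_field S (\<lambda>e x. f e x * (1 - \<eta> x)) + L_field S (\<lambda>e x. f e x * \<eta> x)"
    by (intro L_field_add S C1b_mult C1b_diff C1b_const fC \<eta>)
  ultimately show ?thesis
    using opt by (simp add: algebra_simps)
qed

lemma dense_sequence: "\<exists>d :: nat \<Rightarrow> 'a. closure (range d) = UNIV"
proof -
  obtain D :: "'a set" where D: "countable D" "closure D = UNIV"
    using sep by blast
  then have "D \<noteq> {}"
    by auto
  then have "range (from_nat_into D) = D"
    using D by (simp add: range_from_nat_into)
  then show ?thesis
    using D by metis
qed

text \<open>The cutoffs are products of a slowly varying bump in the finitely many directions of an almost
  optimal field and of a cutoff that is constant in these directions.\<close>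

lemma tight_cutoff:
  assumes r: "0 < r" and \<epsilon>: "0 < \<epsilon>"
  shows "\<exists>\<eta> C. C1b \<eta> \<and> (\<forall>x. 0 \<le> \<eta> x \<and> \<eta> x \<le> 1) \<and> L_var (\<lambda>x. 1 - \<eta> x) \<le> \<epsilon> \<and>
    finite C \<and> (\<forall>x. 0 < \<eta> x \<longrightarrow> (\<exists>c\<in>C. dist c x < r))"
proof -
  \<comment> \<open>One half of the radius is spent on the net in the coordinates of
    \<open>S\<close>, the other on the distance orthogonal to \<open>S\<close>.\<close>
  define \<rho> where "\<rho> = r / 2"
  have \<rho>: "0 < \<rho>" "r = \<rho> + \<rho>"
    using r by (auto simp: \<rho>_def)
  have "\<exists>a\<in>{L_field S f | S f. admissible S f (\<lambda>_. 1)}. L_var (\<lambda>_. 1) - \<epsilon> / 2 < a"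
    unfolding L_var_def
  proof (rule less_cSupD)
    show "{L_field S f | S f. admissible S f (\<lambda>_. 1)} \<noteq> {}"
      using admissible_zero[of "\<lambda>_. 1"] by auto
  qed (use \<epsilon> in simp)
  then obtain S f where f: "admissible S f (\<lambda>_. 1)" and opt: "L_var (\<lambda>_. 1) - \<epsilon> / 2 \<le> L_field S f"
    by (auto intro: less_imp_le)
  have S: "finite S" "S \<subseteq> E" and fC: "C1b (f e)" for e
    using f by (auto simp: admissible_def)
  obtain d :: "nat \<Rightarrow> 'a" where d: "closure (range d) = UNIV"
    using dense_sequence by blast
  define \<eta> where "\<eta> n x = longitudinal_bump S n x * transversal_cutoff S \<rho> d n x" for n x
  have C\<eta>: "C1b (\<eta> n)" for n
    unfolding \<eta>_def by (intro C1b_mult C1b_longitudinal_bump C1b_transversal_cutoff)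
  have \<eta>01: "0 \<le> \<eta> n x" "\<eta> n x \<le> 1" for n x
    unfolding \<eta>_def using longitudinal_bump_range[of S n x] transversal_cutoff_range[of S \<rho> d n x]
    by (auto intro: mult_le_one)
  have \<eta>_lim: "(\<lambda>n. \<eta> n x) \<longlonglongrightarrow> 1" for x
    unfolding \<eta>_def using tendsto_mult[OF longitudinal_bump_tendsto transversal_cutoff_tendsto[OF \<rho>(1) d]] by simp
  have grad_\<eta>: "\<bar>grad (\<lambda>x. 1 - \<eta> n x) x \<bullet> e\<bar> \<le> 4 / Suc n" if e: "e \<in> S" for n x e
  proof -
    have "grad (\<eta> n) x \<bullet> e = transversal_cutoff S \<rho> d n x * (grad (longitudinal_bump S n) x \<bullet> e)"
      unfolding \<eta>_def
      by (simp add: grad_mult[OF C1b_longitudinal_bump C1b_transversal_cutoff] inner_add_left transversal_cutoff_grad[OF S e])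
    moreover have "grad (\<lambda>x. 1 - \<eta> n x) x \<bullet> e = - (grad (\<eta> n) x \<bullet> e)"
      by (simp add: grad_inner_diff[OF C1b_const C\<eta>] grad_const)
    ultimately have "\<bar>grad (\<lambda>x. 1 - \<eta> n x) x \<bullet> e\<bar> = transversal_cutoff S \<rho> d n x * \<bar>grad (longitudinal_bump S n) x \<bullet> e\<bar>"
      using transversal_cutoff_range[of S \<rho> d n x] by (simp add: abs_mult)
    also have "\<dots> \<le> 1 * (4 / Suc n)"
      using transversal_cutoff_range[of S \<rho> d n x] by (intro mult_mono longitudinal_bump_grad S e) auto
    finally show ?thesis by simp
  qed
  have "(\<lambda>n. L_field S (\<lambda>e x. f e x * (1 - \<eta> n x))) \<longlonglongrightarrow> (\<Sum>e\<in>S. 0)"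
    unfolding L_field_def
  proof (intro tendsto_sum)
    fix e assume e: "e \<in> S"
    \<comment> \<open>Here only the derivative along \<open>e\<close> in \<open>S\<close> matters,
      so the steepness of the transversal factor is harmless. The constant 4 bounds
      \<open>4 / Suc n\<close> for all \<open>n\<close>.\<close>
    show "(\<lambda>n. L e (\<lambda>x. f e x * (1 - \<eta> n x))) \<longlonglongrightarrow> 0"
    proof (rule L_lim[where C = 4])
      show "e \<in> E" "C1b (f e)" "\<And>n. C1b (\<lambda>x. 1 - \<eta> n x)"
        using e S by (auto intro: fC C1b_diff C1b_const C\<eta>)
      show "\<bar>1 - \<eta> n x\<bar> \<le> 4" for n x
        using \<eta>01[of n x] by auto
      show "\<bar>grad (\<lambda>x. 1 - \<eta> n x) x \<bullet> e\<bar> \<le> 4" for n x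
        by (rule order.trans[OF grad_\<eta>[OF e]]) (simp add: field_simps)
      show "(\<lambda>n. 1 - \<eta> n x) \<longlonglongrightarrow> 0" for x
        using tendsto_diff[OF tendsto_const[of 1] \<eta>_lim] by simp
      show "(\<lambda>n. grad (\<lambda>x. 1 - \<eta> n x) x \<bullet> e) \<longlonglongrightarrow> 0" for x
      proof (rule Lim_null_comparison)
        show "\<forall>\<^sub>F n in sequentially. norm (grad (\<lambda>x. 1 - \<eta> n x) x \<bullet> e) \<le> 4 / Suc n"
          using grad_\<eta>[OF e] by (intro always_eventually) auto
        show "(\<lambda>n. 4 / real (Suc n)) \<longlonglongrightarrow> 0"
          using tendsto_mult_right_zero[OF LIMSEQ_inverse_real_of_nat, of 4] by (simp add: divide_inverse)
      qed
    qed
  qed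
  then have "\<forall>\<^sub>F n in sequentially. L_field S (\<lambda>e x. f e x * (1 - \<eta> n x)) < \<epsilon> / 2"
    using \<epsilon> by (intro order_tendstoD(2)[of _ "\<Sum>e\<in>S. 0"]) auto
  then obtain n where n: "L_field S (\<lambda>e x. f e x * (1 - \<eta> n x)) < \<epsilon> / 2"
    by (auto simp: eventually_sequentially)
  have small: "L_var (\<lambda>x. 1 - \<eta> n x) \<le> \<epsilon>"
    using L_var_cutoff_le[OF f opt C\<eta> \<eta>01, of n] n by simp
  let ?K = "{x. \<exists>t. (\<forall>e\<in>S. \<bar>t e\<bar> \<le> real (Suc n)) \<and> x = (\<Sum>e\<in>S. t e *\<^sub>R e)}"
  obtain K where K: "finite K" "?K \<subseteq> (\<Union>k\<in>K. ball k \<rho>)"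
    using compact_coordinate_box[OF S(1), of "real (Suc n)"] \<rho>(1) unfolding compact_eq_totally_bounded by blast
  \<comment> \<open>A centre takes its component along \<open>S\<close> from the finite net
    \<open>K\<close> and its orthogonal component from one of the first \<open>n\<close> members of
    the dense sequence.\<close>
  define C where "C = (\<lambda>(k, i). k + (d i - proj S (d i))) ` (K \<times> {..<n})"
  have "\<exists>c\<in>C. dist c x < r" if "0 < \<eta> n x" for x
  proof -
    have "0 < longitudinal_bump S n x" "0 < transversal_cutoff S \<rho> d n x"
      using that longitudinal_bump_range[of S n x] transversal_cutoff_range[of S \<rho> d n x]
      by (auto simp: \<eta>_def zero_less_mult_iff)
    then have P: "norm (proj S x) \<le> Suc n"
      by (intro longitudinal_bump_pos)
    obtain i where i: "i < n" "norm (x - d i - proj S (x - d i)) < \<rho>"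
      using transversal_cutoff_pos[OF \<open>0 < transversal_cutoff S \<rho> d n x\<close> \<rho>(1)] by blast
    obtain k where k: "k \<in> K" "dist k (proj S x) < \<rho>"
      using proj_in_box[OF S P] K(2) by fastforce
    have "proj S (x - d i) = proj S x - proj S (d i)"
      using bounded_linear.linear[OF bounded_linear_proj] linear_diff by blast
    then have "k + (d i - proj S (d i)) - x = (k - proj S x) - (x - d i - proj S (x - d i))"
      by (simp add: algebra_simps)
    then have "dist (k + (d i - proj S (d i))) x \<le> norm (k - proj S x) + norm (x - d i - proj S (x - d i))"
      unfolding dist_norm by (metis norm_triangle_ineq4)
    also have "\<dots> < \<rho> + \<rho>"
      using k i by (intro add_strict_mono) (auto simp: dist_norm)
    finally have "dist (k + (d i - proj S (d i))) x < \<rho> + \<rho>" .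
    then show ?thesis
      using k(1) i(1) by (auto simp: C_def \<rho>(2))
  qed
  moreover have "finite C"
    using K by (simp add: C_def)
  ultimately show ?thesis
    using C\<eta> \<eta>01 small by (intro exI[of _ "\<eta> n"] exI[of _ C]) auto
qed

end

section \<open>The measure dominating a tight functional\<close>

context gradient_functional
begin

lemma L_var_nonneg_C1b:
  assumes "C1b \<phi>" "\<And>x. 0 \<le> \<phi> x"
  shows "0 \<le> L_var \<phi>"
proof -
  obtain A where "\<And>x. \<bar>\<phi> x\<bar> \<le> A"
    using C1b_bound[OF assms(1)] by blast
  then show ?thesis
    using assms(2) by (intro L_var_nonneg[of _ A]) (auto simp: abs_le_iff)
qed

lemma L_var_superadd_C1b:
  assumes "C1b \<phi>" "\<And>x. 0 \<le> \<phi> x" "C1b \<psi>" "\<And>x. 0 \<le> \<psi> x"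
  shows "L_var \<phi> + L_var \<psi> \<le> L_var (\<lambda>x. \<phi> x + \<psi> x)"
proof -
  obtain A where "\<And>x. \<bar>\<phi> x\<bar> \<le> A"
    using C1b_bound[OF assms(1)] by blast
  moreover obtain B where "\<And>x. \<bar>\<psi> x\<bar> \<le> B"
    using C1b_bound[OF assms(3)] by blast
  ultimately show ?thesis
    using assms by (intro L_var_superadd[of _ A _ B]) (auto simp: abs_le_iff)
qed

lemma L_var_superadd_sum:
  assumes "finite I" "\<And>i. i \<in> I \<Longrightarrow> C1b (\<phi> i)" "\<And>i x. i \<in> I \<Longrightarrow> 0 \<le> \<phi> i x"
  shows "(\<Sum>i\<in>I. L_var (\<phi> i)) \<le> L_var (\<lambda>x. \<Sum>i\<in>I. \<phi> i x)"
  using assms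
proof (induction I)
  case (insert i I)
  have "(\<Sum>j\<in>I. L_var (\<phi> j)) \<le> L_var (\<lambda>x. \<Sum>j\<in>I. \<phi> j x)"
    using insert.prems by (intro insert.IH) auto
  then have "(\<Sum>j\<in>insert i I. L_var (\<phi> j)) \<le> L_var (\<phi> i) + L_var (\<lambda>x. \<Sum>j\<in>I. \<phi> j x)"
    using insert.hyps by simp
  also have "\<dots> \<le> L_var (\<lambda>x. \<phi> i x + (\<Sum>j\<in>I. \<phi> j x))"
    using insert.prems by (intro L_var_superadd_C1b C1b_sum sum_nonneg) auto
  finally show ?case
    using insert.hyps by simp
qed (simp add: L_var_zero)

text \<open>Dini's argument without compactness: if it failed, there would be for each
  \<open>k\<close> a bad point \<open>x k\<close> where the first \<open>k\<close> cutoffs are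
  positive. That is just enough for a convergent subsequence, and at its limit the series stays
  \<open>\<epsilon>\<close> below \<open>h\<close>, against the covering assumption.\<close>

lemma cover_up_to_cutoffs:
  fixes h :: "'a \<Rightarrow> real" and C :: "nat \<Rightarrow> 'a set"
  assumes h: "continuous_on UNIV h" and \<psi>: "\<And>n. C1b (\<psi> n)" "\<And>n x. 0 \<le> \<psi> n x"
    and cover: "\<And>x. ennreal (h x) \<le> (\<Sum>n. ennreal (\<psi> n x))"
    and C: "\<And>j. finite (C j)" "\<And>j x. 0 < \<eta> j x \<Longrightarrow> \<exists>c\<in>C j. dist c x < 1 / Suc j"
    and \<epsilon>: "0 < \<epsilon>"
  shows "\<exists>k::nat. \<forall>x. (\<forall>j<k. 0 < \<eta> j x) \<longrightarrow> h x \<le> (\<Sum>n<k. \<psi> n x) + \<epsilon>"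
proof (rule ccontr)
  assume "\<not> ?thesis"
  then have "\<forall>k. \<exists>x. (\<forall>j<k. 0 < \<eta> j x) \<and> (\<Sum>n<k. \<psi> n x) + \<epsilon> < h x"
    by (auto simp: not_le)
  then obtain x where x: "\<And>k j. j < k \<Longrightarrow> 0 < \<eta> j (x k)" "\<And>k. (\<Sum>n<k. \<psi> n (x k)) + \<epsilon> < h (x k)"
    by metis
  have "\<exists>l s. strict_mono (s :: nat \<Rightarrow> nat) \<and> (x \<circ> s) \<longlonglongrightarrow> l"
    by (rule convergent_subsequence_if_tail_coverings[of C, OF C(1) C(2)[OF x(1)]])
  then obtain l s where s: "strict_mono (s :: nat \<Rightarrow> nat)" and l: "(x \<circ> s) \<longlonglongrightarrow> l"
    by blast
  have lim: "(\<lambda>i. g (x (s i))) \<longlonglongrightarrow> g l" if "continuous_on UNIV g" for g :: "'a \<Rightarrow> real"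
    using continuous_on_tendsto_compose[OF that l] by (simp add: comp_def)
  have "(\<Sum>n<N. \<psi> n l) + \<epsilon> \<le> h l" for N
  proof (rule tendsto_le[OF _ lim[OF h]])
    show "(\<lambda>i. (\<Sum>n<N. \<psi> n (x (s i))) + \<epsilon>) \<longlonglongrightarrow> (\<Sum>n<N. \<psi> n l) + \<epsilon>"
      by (intro tendsto_intros lim C1b_continuous \<psi>)
    show "\<forall>\<^sub>F i in sequentially. (\<Sum>n<N. \<psi> n (x (s i))) + \<epsilon> \<le> h (x (s i))"
    proof (intro eventually_sequentiallyI[of N])
      fix i assume "N \<le> i"
      then have "N \<le> s i"
        using seq_suble[OF s, of i] by simp
      then have "(\<Sum>n<N. \<psi> n (x (s i))) \<le> (\<Sum>n<s i. \<psi> n (x (s i)))"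
        using \<psi>(2) by (intro sum_mono2) auto
      then show "(\<Sum>n<N. \<psi> n (x (s i))) + \<epsilon> \<le> h (x (s i))"
        using x(2)[of "s i"] by simp
    qed
  qed simp
  then have le: "(\<Sum>n<N. \<psi> n l) \<le> h l - \<epsilon>" for N
    by (simp add: algebra_simps)
  \<comment> \<open>Needed because \<open>ennreal\<close> truncates negative numbers to 0, which
    would spoil the final comparison.\<close>
  have "0 \<le> h l - \<epsilon>"
    using le[of 0] by simp
  have "(\<Sum>n. ennreal (\<psi> n l)) \<le> ennreal (h l - \<epsilon>)"
    unfolding suminf_eq_SUP
  proof (rule SUP_least)
    show "(\<Sum>n<N. ennreal (\<psi> n l)) \<le> ennreal (h l - \<epsilon>)" for N
      using le[of N] \<psi>(2) by (simp add: sum_ennreal ennreal_leI)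
  qed
  then have "ennreal (h l) \<le> ennreal (h l - \<epsilon>)"
    using cover[of l] by (rule order_trans[rotated])
  then show False
    using \<open>0 \<le> h l - \<epsilon>\<close> \<epsilon> by (simp add: ennreal_le_iff)
qed

text \<open>Where all cutoffs are positive, finitely many \<open>\<psi> n\<close> dominate
  \<open>h\<close> up to \<open>\<epsilon>\<close>; where some \<open>\<eta> j\<close> vanishes, the
  term \<open>B * (1 - \<eta> j x)\<close> equals \<open>B\<close> and dominates \<open>h\<close>.
  Finite subadditivity then applies, and tightness makes the variation of these correction terms
  summable to something small.\<close>

lemma L_var_countably_subadditive:
  assumes h: "continuous_on UNIV h" "\<And>x. 0 \<le> h x" "\<And>x. h x \<le> B"
    and \<psi>: "\<And>n. C1b (\<psi> n)" "\<And>n x. 0 \<le> \<psi> n x"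
    and cover: "\<And>x. ennreal (h x) \<le> (\<Sum>n. ennreal (\<psi> n x))"
  shows "ennreal (L_var h) \<le> (\<Sum>n. ennreal (L_var (\<psi> n)))"
proof (rule ennreal_le_epsilon)
  fix e :: real assume e: "0 < e"
  have B: "0 \<le> B"
    using h(2,3) order_trans by blast
  \<comment> \<open>The constant \<open>\<epsilon>\<close> contributes \<open>V * \<epsilon>\<close>
    and the corrections, weighted by powers of one half, contribute at most
    \<open>B * \<epsilon>\<close>; the summand 1 keeps the denominator positive.\<close>
  define \<epsilon> where "\<epsilon> = e / (V + B + 1)"
  have \<epsilon>: "0 < \<epsilon>" "(V + B) * \<epsilon> \<le> e"
    using e B V_nonneg by (auto simp: \<epsilon>_def field_simps)
  have "\<forall>j::nat. \<exists>\<eta>C. C1b (fst \<eta>C) \<and> (\<forall>x. 0 \<le> fst \<eta>C x \<and> fst \<eta>C x \<le> 1) \<and>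
      L_var (\<lambda>x. 1 - fst \<eta>C x) \<le> \<epsilon> * (1 / 2) ^ Suc j \<and>
      finite (snd \<eta>C) \<and> (\<forall>x. 0 < fst \<eta>C x \<longrightarrow> (\<exists>c\<in>snd \<eta>C. dist c x < 1 / Suc j))"
    using tight_cutoff[where r = "1 / Suc _" and \<epsilon> = "\<epsilon> * (1 / 2) ^ Suc _"] \<epsilon>(1) by simp
  then obtain \<eta>C where \<eta>C: "\<forall>j::nat. C1b (fst (\<eta>C j)) \<and> (\<forall>x. 0 \<le> fst (\<eta>C j) x \<and> fst (\<eta>C j) x \<le> 1) \<and>
      L_var (\<lambda>x. 1 - fst (\<eta>C j) x) \<le> \<epsilon> * (1 / 2) ^ Suc j \<and>
      finite (snd (\<eta>C j)) \<and> (\<forall>x. 0 < fst (\<eta>C j) x \<longrightarrow> (\<exists>c\<in>snd (\<eta>C j). dist c x < 1 / Suc j))"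
    by (rule choice[THEN exE])
  define \<eta> C where "\<eta> j = fst (\<eta>C j)" and "C j = snd (\<eta>C j)" for j
  have \<eta>: "C1b (\<eta> j)" "0 \<le> \<eta> j x" "\<eta> j x \<le> 1" "L_var (\<lambda>x. 1 - \<eta> j x) \<le> \<epsilon> * (1 / 2) ^ Suc j"
    and C: "finite (C j)" "0 < \<eta> j x \<Longrightarrow> \<exists>c\<in>C j. dist c x < 1 / Suc j" for j x
    using \<eta>C unfolding \<eta>_def C_def by blast+
  obtain k where k: "\<And>x. (\<forall>j<k. 0 < \<eta> j x) \<Longrightarrow> h x \<le> (\<Sum>n<k. \<psi> n x) + \<epsilon>"
    using cover_up_to_cutoffs[OF h(1) \<psi> cover C \<epsilon>(1)] by blast
  have 1: "C1b (\<lambda>x. \<Sum>n<k. \<psi> n x)" "\<And>x. 0 \<le> (\<Sum>n<k. \<psi> n x)"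
    using \<psi> by (auto intro!: C1b_sum sum_nonneg)
  have 2: "C1b (\<lambda>x. 1 - \<eta> j x)" "\<And>x. 0 \<le> 1 - \<eta> j x" for j
    using \<eta> by (auto intro!: C1b_diff C1b_const)
  have 3: "C1b (\<lambda>x. \<Sum>j<k. B * (1 - \<eta> j x))" "\<And>x. 0 \<le> (\<Sum>j<k. B * (1 - \<eta> j x))"
    using 2 B by (auto intro!: C1b_sum C1b_cmult sum_nonneg)
  have 4: "C1b (\<lambda>x. (\<Sum>n<k. \<psi> n x) + (\<epsilon> + (\<Sum>j<k. B * (1 - \<eta> j x))))"
    by (intro C1b_add C1b_const 1 3)
  have le: "h x \<le> (\<Sum>n<k. \<psi> n x) + (\<epsilon> + (\<Sum>j<k. B * (1 - \<eta> j x)))" for x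
  proof (cases "\<forall>j<k. 0 < \<eta> j x")
    case True
    then show ?thesis
      using k[OF True] 3(2)[of x] by simp
  next
    case False
    then obtain j where "j < k" "\<eta> j x = 0"
      using \<eta>(2) by (metis less_eq_real_def)
    then have "B \<le> (\<Sum>j<k. B * (1 - \<eta> j x))"
      using member_le_sum[of j "{..<k}" "\<lambda>j. B * (1 - \<eta> j x)"] 2 B by simp
    then show ?thesis
      using 1(2)[of x] \<epsilon>(1) h(3)[of x] by simp
  qed
  obtain A where A: "\<And>x. \<bar>(\<Sum>n<k. \<psi> n x) + (\<epsilon> + (\<Sum>j<k. B * (1 - \<eta> j x)))\<bar> \<le> A"
    using C1b_bound[OF 4] by blast
  have "L_var h \<le> L_var (\<lambda>x. (\<Sum>n<k. \<psi> n x) + (\<epsilon> + (\<Sum>j<k. B * (1 - \<eta> j x))))"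
    using h(2) le A by (intro L_var_mono[of _ _ A]) (auto simp: abs_le_iff)
  also have "\<dots> \<le> L_var (\<lambda>x. \<Sum>n<k. \<psi> n x) + L_var (\<lambda>x. \<epsilon> + (\<Sum>j<k. B * (1 - \<eta> j x)))"
    using 3(2) \<epsilon>(1) by (intro L_var_subadd 1 C1b_add C1b_const 3) (simp add: less_imp_le)
  also have "L_var (\<lambda>x. \<epsilon> + (\<Sum>j<k. B * (1 - \<eta> j x))) \<le> L_var (\<lambda>x. \<epsilon>) + L_var (\<lambda>x. \<Sum>j<k. B * (1 - \<eta> j x))"
    using \<epsilon>(1) by (intro L_var_subadd C1b_const 3) simp
  also have "L_var (\<lambda>x. \<Sum>n<k. \<psi> n x) \<le> (\<Sum>n<k. L_var (\<psi> n))"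
    by (intro L_var_sum \<psi>) auto
  also have "L_var (\<lambda>x. \<epsilon>) \<le> V * \<epsilon>"
    using \<epsilon>(1) by (intro L_var_le) auto
  also have "L_var (\<lambda>x. \<Sum>j<k. B * (1 - \<eta> j x)) \<le> (\<Sum>j<k. L_var (\<lambda>x. B * (1 - \<eta> j x)))"
    using 2 B by (intro L_var_sum C1b_cmult mult_nonneg_nonneg) auto
  also have "\<dots> \<le> (\<Sum>j<k. B * (\<epsilon> * (1 / 2) ^ Suc j))"
    using 2 B \<eta> by (intro sum_mono order.trans[OF L_var_cmult[of _ _ 1]] mult_left_mono) auto
  also have "\<dots> = B * \<epsilon> * (\<Sum>j<k. (1 / 2) ^ Suc j)"
    by (simp add: sum_distrib_left mult.assoc)
  also have "\<dots> \<le> B * \<epsilon> * 1"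
  proof (intro mult_left_mono)
    show "(\<Sum>j<k. (1 / 2) ^ Suc j) \<le> (1 :: real)"
    proof -
      have "(\<Sum>j<k. (1 / 2) ^ Suc j) = 1 - (1 / 2 :: real) ^ k"
        by (induction k) auto
      then show ?thesis by simp
    qed
  qed (use B \<epsilon> in simp)
  finally have "L_var h \<le> (\<Sum>n<k. L_var (\<psi> n)) + e"
    using \<epsilon>(2) by (simp add: distrib_right)
  then have "ennreal (L_var h) \<le> ennreal ((\<Sum>n<k. L_var (\<psi> n)) + e)"
    by (rule ennreal_leI)
  also have "\<dots> = (\<Sum>n<k. ennreal (L_var (\<psi> n))) + ennreal e"
    using e \<psi> by (simp add: ennreal_plus sum_ennreal L_var_nonneg_C1b sum_nonneg)
  also have "(\<Sum>n<k. ennreal (L_var (\<psi> n))) \<le> (\<Sum>n. ennreal (L_var (\<psi> n)))"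
    by (rule sum_le_suminf) auto
  finally show "ennreal (L_var h) \<le> (\<Sum>n. ennreal (L_var (\<psi> n))) + ennreal e"
    by (simp add: add_right_mono)
qed

section \<open>The Daniell outer measure and its restriction to Borel sets\<close>

definition covers :: "(nat \<Rightarrow> 'a \<Rightarrow> real) \<Rightarrow> 'a set \<Rightarrow> bool" where
  "covers \<phi> A \<longleftrightarrow> (\<forall>n. C1b (\<phi> n)) \<and> (\<forall>n x. 0 \<le> \<phi> n x) \<and> (\<forall>x\<in>A. 1 \<le> (\<Sum>n. ennreal (\<phi> n x)))"

text \<open>The Daniell outer measure of the functional \<open>L_var\<close>.\<close>

definition outer :: "'a set \<Rightarrow> ennreal" where
  "outer A = (INF \<phi>\<in>{\<phi>. covers \<phi> A}. \<Sum>n. ennreal (L_var (\<phi> n)))"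

lemma outer_le: "covers \<phi> A \<Longrightarrow> outer A \<le> (\<Sum>n. ennreal (L_var (\<phi> n)))"
  unfolding outer_def by (rule INF_lower) simp

lemma outer_mono: "A \<subseteq> B \<Longrightarrow> outer A \<le> outer B"
  unfolding outer_def by (intro INF_superset_mono order_refl) (auto simp: covers_def)

lemma outer_empty: "outer {} = 0"
proof -
  have "covers (\<lambda>_ _. 0) {}"
    by (simp add: covers_def C1b_const)
  from outer_le[OF this] show ?thesis
    by (simp add: L_var_zero)
qed

lemma outer_le_V: "outer A \<le> ennreal V"
proof -
  have "covers (\<lambda>n _. if n = 0 then 1 else 0) A"
    unfolding covers_def
  proof (intro conjI allI ballI)
    show "1 \<le> (\<Sum>n. ennreal (if n = (0::nat) then 1 else 0))"
      by (subst suminf_finite[of "{0}"]) auto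
  qed (rule C1b_const, simp)
  then have "outer A \<le> (\<Sum>n. ennreal (L_var (\<lambda>_. if n = (0::nat) then 1 else 0)))"
    by (rule outer_le)
  also have "\<dots> = (\<Sum>n\<in>{0}. ennreal (L_var (\<lambda>_. if n = (0::nat) then 1 else 0)))"
    by (rule suminf_finite) (auto simp: L_var_zero)
  also have "\<dots> \<le> ennreal V"
    using L_var_le[of "\<lambda>_. 1" 1] by (simp add: ennreal_leI)
  finally show ?thesis .
qed

lemma outer_approx:
  assumes "0 < e"
  shows "\<exists>\<phi>. covers \<phi> A \<and> (\<Sum>n. ennreal (L_var (\<phi> n))) \<le> outer A + ennreal e"
proof -
  have "outer A < top"
    using outer_le_V[of A] by (simp add: order_le_less_trans)
  then have "outer A < outer A + ennreal e"
    using assms by (simp add: less_top)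
  then have "\<exists>\<phi>\<in>{\<phi>. covers \<phi> A}. (\<Sum>n. ennreal (L_var (\<phi> n))) < outer A + ennreal e"
    unfolding outer_def[of A] INF_less_iff by simp
  then show ?thesis
    by (auto intro: less_imp_le)
qed

lemma outer_countably_subadditive: "outer (\<Union>i::nat. A i) \<le> (\<Sum>i. outer (A i))"
proof (rule ennreal_le_epsilon)
  fix e :: real assume e: "0 < e"
  have "\<forall>i. \<exists>\<phi>. covers \<phi> (A i) \<and> (\<Sum>n. ennreal (L_var (\<phi> n))) \<le> outer (A i) + ennreal (e * (1 / 2) ^ Suc i)"
    using e by (intro allI outer_approx) simp
  then obtain \<phi> where \<phi>: "\<And>i. covers (\<phi> i) (A i)"
    "\<And>i. (\<Sum>n. ennreal (L_var (\<phi> i n))) \<le> outer (A i) + ennreal (e * (1 / 2) ^ Suc i)"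
    by metis
  define \<psi> where "\<psi> n = \<phi> (fst (prod_decode n)) (snd (prod_decode n))" for n
  have "covers \<psi> (\<Union>i. A i)"
    unfolding covers_def
  proof (intro conjI allI ballI)
    show "C1b (\<psi> n)" "0 \<le> \<psi> n x" for n x
      using \<phi>(1) by (auto simp: \<psi>_def covers_def)
    fix x assume "x \<in> (\<Union>i. A i)"
    then obtain i where "x \<in> A i"
      by blast
    then have "1 \<le> (\<Sum>n. ennreal (\<phi> i n x))"
      using \<phi>(1) by (auto simp: covers_def)
    also have "\<dots> \<le> (\<Sum>i. \<Sum>n. ennreal (\<phi> i n x))"
      using sum_le_suminf[of "\<lambda>i. \<Sum>n. ennreal (\<phi> i n x)" "{i}"] by simp
    also have "\<dots> = (\<Sum>n. ennreal (\<psi> n x))"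
      using suminf_ennreal_2dimen[of "\<lambda>i. \<Sum>n. ennreal (\<phi> i n x)" "\<lambda>(i, n). ennreal (\<phi> i n x)"]
      by (simp add: \<psi>_def case_prod_beta)
    finally show "1 \<le> (\<Sum>n. ennreal (\<psi> n x))" .
  qed
  then have "outer (\<Union>i. A i) \<le> (\<Sum>n. ennreal (L_var (\<psi> n)))"
    by (rule outer_le)
  also have "\<dots> = (\<Sum>i. \<Sum>n. ennreal (L_var (\<phi> i n)))"
    using suminf_ennreal_2dimen[of "\<lambda>i. \<Sum>n. ennreal (L_var (\<phi> i n))" "\<lambda>(i, n). ennreal (L_var (\<phi> i n))"]
    by (simp add: \<psi>_def case_prod_beta)
  also have "\<dots> \<le> (\<Sum>i. outer (A i) + ennreal (e * (1 / 2) ^ Suc i))"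
    using \<phi>(2) by (intro suminf_le) auto
  also have "\<dots> = (\<Sum>i. outer (A i)) + (\<Sum>i. ennreal (e * (1 / 2) ^ Suc i))"
    by (intro suminf_add[symmetric]) auto
  also have "(\<Sum>i. ennreal (e * (1 / 2) ^ Suc i)) = ennreal e"
    using sums_mult[OF power_half_series, of e] e by (intro suminf_ennreal_eq) auto
  finally show "outer (\<Union>i. A i) \<le> (\<Sum>i. outer (A i)) + ennreal e" .
qed

lemma outer_measure_space_outer: "outer_measure_space (Pow UNIV) outer"
  unfolding outer_measure_space_def positive_def increasing_def countably_subadditive_def
  by (auto simp: outer_empty intro: outer_mono outer_countably_subadditive)

lemma outer_Un: "outer (A \<union> B) \<le> outer A + outer B"
proof -
  have "outer (\<Union>i::nat. if i = 0 then A else if i = 1 then B else {})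
      \<le> (\<Sum>i. outer (if i = 0 then A else if i = 1 then B else {}))"
    by (rule outer_countably_subadditive)
  also have "\<dots> = (\<Sum>i\<in>{0, 1::nat}. outer (if i = 0 then A else if i = 1 then B else {}))"
    by (rule suminf_finite) (auto simp: outer_empty)
  also have "(\<Union>i::nat. if i = 0 then A else if i = 1 then B else {}) = A \<union> B"
    by (auto split: if_splits)
  finally show ?thesis
    by simp
qed

text \<open>Caratheodory's condition for balls. Given a cover \<open>\<phi>\<close> of
  \<open>A\<close>, the functions \<open>\<phi> n x * (1 - \<kappa> k x)\<close> cover the part
  outside the ball for every \<open>k\<close>, while \<open>\<phi> n x * \<kappa> k x\<close>
  exhausts the part inside as \<open>k\<close> grows. Superadditivity bounds the joint cost of both
  by that of \<open>\<phi>\<close>.\<close>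

lemma outer_split_ball:
  assumes r: "0 < r"
  shows "outer (ball d r \<inter> A) + outer (A - ball d r) \<le> outer A"
  unfolding outer_def[of A]
proof (rule INF_greatest)
  fix \<phi> assume "\<phi> \<in> {\<phi>. covers \<phi> A}"
  then have \<phi>: "C1b (\<phi> n)" "0 \<le> \<phi> n x" "x \<in> A \<Longrightarrow> 1 \<le> (\<Sum>n. ennreal (\<phi> n x))" for n x
    by (auto simp: covers_def)
  from C1b_ball_indicator_limit[OF r, of d]
  obtain \<kappa> :: "nat \<Rightarrow> 'a \<Rightarrow> real" where \<kappa>: "\<forall>k. C1b (\<kappa> k) \<and> unit_borel (\<kappa> k)"
    "\<forall>x. (\<lambda>k. \<kappa> k x) \<longlonglongrightarrow> indicator (ball d r) x" "\<forall>x. \<kappa> 0 x = 0"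
    "\<forall>k x. \<kappa> k x \<le> \<kappa> (Suc k) x" "\<forall>k x. x \<notin> ball d r \<longrightarrow> \<kappa> k x = 0"
    by blast
  then have C\<kappa>: "C1b (\<kappa> k)" and \<kappa>01: "0 \<le> \<kappa> k x" "\<kappa> k x \<le> 1" "\<kappa> k x \<le> \<kappa> (Suc k) x"
    and \<kappa>0: "\<kappa> 0 x = 0" and \<kappa>_out: "x \<notin> ball d r \<Longrightarrow> \<kappa> k x = 0" for k x
    by (auto simp: unit_borel_def)
  have \<kappa>_in: "(\<lambda>k. \<kappa> k x) \<longlonglongrightarrow> 1" if "x \<in> ball d r" for x
    using spec[OF \<kappa>(2), of x] that by simp
  \<comment> \<open>A cover must be a single series, so the increments are used; by telescoping
    their partial sums are \<open>\<phi> n x * \<kappa> k x\<close>.\<close>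
  define g where "g n k x = \<phi> n x * (\<kappa> (Suc k) x - \<kappa> k x)" for n k x
  have g: "C1b (g n k)" "0 \<le> g n k x" for n k x
    unfolding g_def using \<phi>(2)[of n x] \<kappa>01(3)[of k x]
    by (auto intro!: C1b_mult C1b_diff C\<kappa> \<phi>(1))
  have tele: "(\<Sum>j<k. g n j x) = \<phi> n x * \<kappa> k x" for n k x
    unfolding g_def sum_distrib_left[symmetric] by (simp add: sum_lessThan_telescope[of "\<lambda>k. \<kappa> k x" for x] \<kappa>0)
  have out: "outer (A - ball d r) \<le> (\<Sum>n. ennreal (L_var (\<lambda>x. \<phi> n x * (1 - \<kappa> k x))))" for k
    using \<phi> \<kappa>01 \<kappa>_out
    by (intro outer_le) (auto simp: covers_def intro!: C1b_mult C1b_diff C1b_const C\<kappa>)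
  have "covers (\<lambda>i. g (fst (prod_decode i)) (snd (prod_decode i))) (ball d r \<inter> A)"
    unfolding covers_def
  proof (intro conjI allI ballI g)
    fix x assume x: "x \<in> ball d r \<inter> A"
    have "(\<Sum>k. ennreal (g n k x)) = ennreal (\<phi> n x)" for n
    proof (rule suminf_ennreal_eq[OF g(2)])
      have "(\<lambda>k. \<phi> n x * \<kappa> k x) \<longlonglongrightarrow> \<phi> n x * 1"
        using x by (intro tendsto_intros \<kappa>_in) auto
      then show "(\<lambda>k. g n k x) sums \<phi> n x"
        unfolding sums_def tele by simp
    qed
    then have "(\<Sum>n. \<Sum>k. ennreal (g n k x)) = (\<Sum>n. ennreal (\<phi> n x))"
      by simp
    moreover have "(\<Sum>n. \<Sum>k. ennreal (g n k x)) = (\<Sum>i. ennreal (g (fst (prod_decode i)) (snd (prod_decode i)) x))"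
      using suminf_ennreal_2dimen[of "\<lambda>n. \<Sum>k. ennreal (g n k x)" "\<lambda>(n, k). ennreal (g n k x)"]
      by (simp add: case_prod_beta)
    ultimately show "1 \<le> (\<Sum>i. ennreal (g (fst (prod_decode i)) (snd (prod_decode i)) x))"
      using \<phi>(3)[of x] x by simp
  qed
  then have "outer (ball d r \<inter> A) \<le> (\<Sum>i. ennreal (L_var (g (fst (prod_decode i)) (snd (prod_decode i)))))"
    by (rule outer_le)
  also have "\<dots> = (\<Sum>n. \<Sum>k. ennreal (L_var (g n k)))"
    using suminf_ennreal_2dimen[of "\<lambda>n. \<Sum>k. ennreal (L_var (g n k))" "\<lambda>(n, k). ennreal (L_var (g n k))"]
    by (simp add: case_prod_beta)
  also have "\<dots> = (\<Sum>n. SUP k. \<Sum>j<k. ennreal (L_var (g n j)))"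
    by (simp add: suminf_eq_SUP)
  \<comment> \<open>Monotone convergence moves the supremum outside, so that the complementary parts
    for the same fixed \<open>k\<close> can be combined with the increments.\<close>
  also have "\<dots> = (SUP k. \<Sum>n. \<Sum>j<k. ennreal (L_var (g n j)))"
    by (intro ennreal_suminf_SUP_eq incseq_SucI) simp
  finally have "outer (ball d r \<inter> A) + outer (A - ball d r)
      \<le> (SUP k. \<Sum>n. \<Sum>j<k. ennreal (L_var (g n j))) + outer (A - ball d r)"
    by (rule add_right_mono)
  also have "\<dots> = (SUP k. (\<Sum>n. \<Sum>j<k. ennreal (L_var (g n j))) + outer (A - ball d r))"
    by (rule ennreal_SUP_add_left[symmetric]) simp
  also have "\<dots> \<le> (\<Sum>n. ennreal (L_var (\<phi> n)))"
  proof (rule SUP_least)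
    fix k
    have "(\<Sum>n. \<Sum>j<k. ennreal (L_var (g n j))) + outer (A - ball d r)
        \<le> (\<Sum>n. \<Sum>j<k. ennreal (L_var (g n j))) + (\<Sum>n. ennreal (L_var (\<lambda>x. \<phi> n x * (1 - \<kappa> k x))))"
      by (intro add_left_mono out)
    also have "\<dots> = (\<Sum>n. (\<Sum>j<k. ennreal (L_var (g n j))) + ennreal (L_var (\<lambda>x. \<phi> n x * (1 - \<kappa> k x))))"
      by (intro suminf_add) auto
    also have "\<dots> \<le> (\<Sum>n. ennreal (L_var (\<phi> n)))"
    proof (intro suminf_le)
      fix n
      have c: "C1b (\<lambda>x. \<phi> n x * \<kappa> k x)" "C1b (\<lambda>x. \<phi> n x * (1 - \<kappa> k x))"
        by (intro C1b_mult \<phi> C\<kappa> C1b_diff C1b_const)+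
      have p: "0 \<le> \<phi> n x * \<kappa> k x" "0 \<le> \<phi> n x * (1 - \<kappa> k x)" for x
        using \<phi>(2)[of n x] \<kappa>01[of k x] by auto
      have "(\<Sum>j<k. L_var (g n j)) \<le> L_var (\<lambda>x. \<phi> n x * \<kappa> k x)"
        using L_var_superadd_sum[of "{..<k}" "g n"] g by (simp add: tele)
      moreover have "L_var (\<lambda>x. \<phi> n x * \<kappa> k x) + L_var (\<lambda>x. \<phi> n x * (1 - \<kappa> k x)) \<le> L_var (\<lambda>x. \<phi> n x * \<kappa> k x + \<phi> n x * (1 - \<kappa> k x))"
        by (intro L_var_superadd_C1b c p)
      moreover have "(\<lambda>x. \<phi> n x * \<kappa> k x + \<phi> n x * (1 - \<kappa> k x)) = \<phi> n"
        by (simp add: fun_eq_iff algebra_simps)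
      ultimately have le: "(\<Sum>j<k. L_var (g n j)) + L_var (\<lambda>x. \<phi> n x * (1 - \<kappa> k x)) \<le> L_var (\<phi> n)"
        by simp
      have "(\<Sum>j<k. ennreal (L_var (g n j))) + ennreal (L_var (\<lambda>x. \<phi> n x * (1 - \<kappa> k x)))
          = ennreal ((\<Sum>j<k. L_var (g n j)) + L_var (\<lambda>x. \<phi> n x * (1 - \<kappa> k x)))"
        using L_var_nonneg_C1b g c(2) p(2) by (simp add: ennreal_plus sum_ennreal sum_nonneg)
      also have "\<dots> \<le> ennreal (L_var (\<phi> n))"
        using le by (rule ennreal_leI)
      finally show "(\<Sum>j<k. ennreal (L_var (g n j))) + ennreal (L_var (\<lambda>x. \<phi> n x * (1 - \<kappa> k x))) \<le> ennreal (L_var (\<phi> n))" .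
    qed auto
    finally show "(\<Sum>n. \<Sum>j<k. ennreal (L_var (g n j))) + outer (A - ball d r) \<le> (\<Sum>n. ennreal (L_var (\<phi> n)))" .
  qed
  finally show "outer (ball d r \<inter> A) + outer (A - ball d r) \<le> (\<Sum>n. ennreal (L_var (\<phi> n)))" .
qed

definition majorant :: "'a measure" where
  "majorant = measure_of UNIV (sets borel) outer"

lemma measure_space_outer: "measure_space UNIV (lambda_system UNIV (Pow UNIV) outer) outer"
  by (rule sigma_algebra.caratheodory_lemma[OF sigma_algebra_Pow outer_measure_space_outer])

lemma borel_subset_lambda_system: "sets borel \<subseteq> lambda_system UNIV (Pow UNIV) outer"
proof -
  obtain D :: "'a set" where D: "countable D" "closure D = UNIV"
    using sep by blast
  show ?thesis
  proof (rule sets_borel_subset_if_balls[OF D])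
    show "sigma_algebra UNIV (lambda_system UNIV (Pow UNIV) outer)"
      using measure_space_outer by (simp add: measure_space_def)
    fix d :: 'a and r :: real assume r: "0 < r"
    have "outer (ball d r \<inter> A) + outer ((UNIV - ball d r) \<inter> A) = outer A" for A
    proof (rule antisym)
      have eq: "(UNIV - ball d r) \<inter> A = A - ball d r"
        by auto
      show "outer (ball d r \<inter> A) + outer ((UNIV - ball d r) \<inter> A) \<le> outer A"
        unfolding eq by (rule outer_split_ball[OF r])
      have "ball d r \<inter> A \<union> (UNIV - ball d r) \<inter> A = A"
        by auto
      then show "outer A \<le> outer (ball d r \<inter> A) + outer ((UNIV - ball d r) \<inter> A)"
        using outer_Un by metis
    qed
    then show "ball d r \<in> lambda_system UNIV (Pow UNIV) outer"
      by (simp add: lambda_system_def)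
  qed
qed

lemma sets_majorant: "sets majorant = sets borel"
  unfolding majorant_def using sets.sigma_sets_eq[of "borel :: 'a measure"] by (simp add: sets_measure_of_conv)

lemma emeasure_majorant: "B \<in> sets borel \<Longrightarrow> emeasure majorant B = outer B"
  unfolding majorant_def
proof (rule emeasure_measure_of_sigma)
  show "sigma_algebra UNIV (sets (borel :: 'a measure))"
    using sets.sigma_algebra_axioms[of "borel :: 'a measure"] by simp
  show "positive (sets borel) outer"
    by (simp add: positive_def outer_empty)
  show "countably_additive (sets borel) outer"
    using measure_space_outer borel_subset_lambda_system
    unfolding measure_space_def countably_additive_def by blast
qed

lemma finite_measure_majorant: "finite_measure majorant"
proof (rule finite_measureI)
  have "emeasure majorant (space majorant) \<le> ennreal V"
    using outer_le_V[of UNIV] by (simp add: sets_eq_imp_space_eq[OF sets_majorant] emeasure_majorant)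
  then show "emeasure majorant (space majorant) \<noteq> \<infinity>"
    by (auto simp: top_unique)
qed

lemma finite_borel_majorant: "finite_borel majorant"
  by (simp add: finite_borel_def finite_measure_majorant sets_majorant)

text \<open>The function \<open>h\<close> lies below a step function on its level sets. Replacing
  each indicator by an almost optimal cover of its cell gives a countable C1 cover of
  \<open>h\<close>, and countable subadditivity bounds \<open>L_var h\<close> by a sum that
  approximates the integral.\<close>

lemma L_var_le_integral:
  assumes h: "continuous_on UNIV h" "\<And>x. 0 \<le> h x" "\<And>x. h x \<le> B"
  shows "L_var h \<le> (\<integral>x. h x \<partial>majorant)"
proof (rule le_if_le_add_mult_epsilon)
  \<comment> \<open>Two terms \<open>\<epsilon> * measure majorant UNIV\<close> arise, from raising
    the step values by \<open>\<epsilon>\<close> and from comparing the step sum with the integral;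
    the covers cost one further \<open>\<epsilon>\<close>.\<close>
  show "0 \<le> 2 * measure majorant UNIV + 1"
    by simp
  interpret finite_measure majorant by (rule finite_measure_majorant)
  fix \<epsilon> :: real assume \<epsilon>: "0 < \<epsilon>"
  have hm: "h \<in> borel_measurable borel"
    by (rule borel_measurable_continuous_onI[OF h(1)])
  have hb: "\<bar>h x\<bar> \<le> B" for x
    using h(2,3)[of x] by simp
  have "\<exists>(J :: (unit \<Rightarrow> int) set) B p. step_partition (UNIV :: unit set) (\<lambda>_. h) \<epsilon> J B p"
    using hm hb \<epsilon> by (intro step_partition_exists) auto
  then obtain J :: "(unit \<Rightarrow> int) set" and A p where "step_partition (UNIV :: unit set) (\<lambda>_. h) \<epsilon> J A p"
    by blast
  then have J: "finite J" "\<And>j. j \<in> J \<Longrightarrow> A j \<in> sets borel" "disjoint_family_on A J" "(\<Union>j\<in>J. A j) = UNIV"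
    "\<And>j x. j \<in> J \<Longrightarrow> x \<in> A j \<Longrightarrow> \<bar>h x - h (p j)\<bar> \<le> \<epsilon>"
    by (auto simp: step_partition_def)
  \<comment> \<open>An upper bound for \<open>h\<close> on the cell \<open>A j\<close>, rather than
    a sample value, because the cover has to lie above \<open>h\<close>.\<close>
  define a where "a j = h (p j) + \<epsilon>" for j
  have a: "0 \<le> a j" for j
    using h(2) \<epsilon> by (simp add: a_def add_nonneg_nonneg less_imp_le)
  define \<delta> where "\<delta> = \<epsilon> / ((\<Sum>j\<in>J. a j) + 1)"
  have sa: "0 \<le> (\<Sum>j\<in>J. a j)"
    by (intro sum_nonneg a)
  have \<delta>: "0 < \<delta>" "(\<Sum>j\<in>J. a j) * \<delta> \<le> \<epsilon>"
    using \<epsilon> sa by (auto simp: \<delta>_def field_simps add_nonneg_pos)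
  have "\<forall>j. \<exists>\<phi>. covers \<phi> (A j) \<and> (\<Sum>n. ennreal (L_var (\<phi> n))) \<le> outer (A j) + ennreal \<delta>"
    using \<delta>(1) by (intro allI outer_approx)
  then obtain \<phi> where \<phi>: "\<And>j. covers (\<phi> j) (A j)" "\<And>j. (\<Sum>n. ennreal (L_var (\<phi> j n))) \<le> outer (A j) + ennreal \<delta>"
    by metis
  have \<phi>C: "C1b (\<phi> j n)" "0 \<le> \<phi> j n x" for j n x
    using \<phi>(1)[of j] by (auto simp: covers_def)
  define \<psi> where "\<psi> n x = (\<Sum>j\<in>J. a j * \<phi> j n x)" for n x
  have \<psi>: "C1b (\<psi> n)" "0 \<le> \<psi> n x" for n x
    unfolding \<psi>_def by (auto intro!: C1b_sum C1b_cmult sum_nonneg mult_nonneg_nonneg \<phi>C a)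
  have cover: "ennreal (h x) \<le> (\<Sum>n. ennreal (\<psi> n x))" for x
  proof -
    obtain j where j: "j \<in> J" "x \<in> A j"
      using J(4) by blast
    have "ennreal (h x) \<le> ennreal (a j) * 1"
      using J(5)[OF j] by (simp add: a_def ennreal_leI)
    also have "\<dots> \<le> ennreal (a j) * (\<Sum>n. ennreal (\<phi> j n x))"
      using \<phi>(1)[of j] j(2) by (intro mult_left_mono) (auto simp: covers_def)
    also have "\<dots> = (\<Sum>n. ennreal (a j * \<phi> j n x))"
      by (simp add: ennreal_mult[OF a \<phi>C(2)])
    also have "\<dots> \<le> (\<Sum>n. ennreal (\<psi> n x))"
    proof (intro suminf_le)
      show "ennreal (a j * \<phi> j n x) \<le> ennreal (\<psi> n x)" for n
        unfolding \<psi>_def using j(1) J(1)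
        by (intro ennreal_leI member_le_sum[of j J "\<lambda>j. a j * \<phi> j n x"]) (auto intro!: mult_nonneg_nonneg a \<phi>C)
    qed auto
    finally show ?thesis .
  qed
  have "ennreal (L_var h) \<le> (\<Sum>n. ennreal (L_var (\<psi> n)))"
    by (rule L_var_countably_subadditive[OF h \<psi> cover])
  also have "\<dots> \<le> (\<Sum>n. \<Sum>j\<in>J. ennreal (a j) * ennreal (L_var (\<phi> j n)))"
  proof (intro suminf_le)
    fix n
    have "L_var (\<psi> n) \<le> (\<Sum>j\<in>J. L_var (\<lambda>x. a j * \<phi> j n x))"
      unfolding \<psi>_def using J(1) by (intro L_var_sum) (auto intro!: C1b_cmult mult_nonneg_nonneg a \<phi>C)
    also have "\<dots> \<le> (\<Sum>j\<in>J. a j * L_var (\<phi> j n))"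
    proof (intro sum_mono)
      fix j
      obtain D where "\<And>x. \<bar>\<phi> j n x\<bar> \<le> D"
        using C1b_bound[OF \<phi>C(1)[of j n]] by blast
      then show "L_var (\<lambda>x. a j * \<phi> j n x) \<le> a j * L_var (\<phi> j n)"
        by (intro L_var_cmult[of _ _ D] a \<phi>C) (auto simp: abs_le_iff)
    qed
    finally have "ennreal (L_var (\<psi> n)) \<le> ennreal (\<Sum>j\<in>J. a j * L_var (\<phi> j n))"
      by (rule ennreal_leI)
    also have "\<dots> = (\<Sum>j\<in>J. ennreal (a j * L_var (\<phi> j n)))"
      by (intro sum_ennreal[symmetric] mult_nonneg_nonneg a L_var_nonneg_C1b \<phi>C)
    also have "\<dots> = (\<Sum>j\<in>J. ennreal (a j) * ennreal (L_var (\<phi> j n)))"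
      by (intro sum.cong refl ennreal_mult a L_var_nonneg_C1b \<phi>C)
    finally show "ennreal (L_var (\<psi> n)) \<le> (\<Sum>j\<in>J. ennreal (a j) * ennreal (L_var (\<phi> j n)))" .
  qed auto
  also have "\<dots> = (\<Sum>j\<in>J. \<Sum>n. ennreal (a j) * ennreal (L_var (\<phi> j n)))"
    by (intro suminf_sum) auto
  also have "\<dots> = (\<Sum>j\<in>J. ennreal (a j) * (\<Sum>n. ennreal (L_var (\<phi> j n))))"
    by simp
  also have "\<dots> \<le> (\<Sum>j\<in>J. ennreal (a j) * (outer (A j) + ennreal \<delta>))"
    by (intro sum_mono mult_left_mono \<phi>) auto
  also have "\<dots> = (\<Sum>j\<in>J. ennreal (a j * (measure majorant (A j) + \<delta>)))"
  proof (intro sum.cong refl)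
    fix j assume "j \<in> J"
    then have "outer (A j) = ennreal (measure majorant (A j))"
      using J(2) by (simp add: emeasure_majorant[symmetric] emeasure_eq_measure)
    then show "ennreal (a j) * (outer (A j) + ennreal \<delta>) = ennreal (a j * (measure majorant (A j) + \<delta>))"
      using \<delta>(1) a by (simp add: ennreal_mult ennreal_plus)
  qed
  also have "\<dots> = ennreal (\<Sum>j\<in>J. a j * (measure majorant (A j) + \<delta>))"
    using \<delta>(1) by (intro sum_ennreal mult_nonneg_nonneg a) auto
  finally have le: "L_var h \<le> (\<Sum>j\<in>J. a j * (measure majorant (A j) + \<delta>))"
    using \<delta>(1) a by (subst (asm) ennreal_le_iff) (auto intro!: sum_nonneg mult_nonneg_nonneg)
  have sum_eq: "(\<Sum>j\<in>J. a j * (measure majorant (A j) + \<delta>))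
      = (\<Sum>j\<in>J. h (p j) * measure majorant (A j)) + \<epsilon> * (\<Sum>j\<in>J. measure majorant (A j)) + (\<Sum>j\<in>J. a j) * \<delta>"
    by (simp add: a_def distrib_right distrib_left sum.distrib sum_distrib_left sum_distrib_right)
  have total: "(\<Sum>j\<in>J. measure majorant (A j)) = measure majorant UNIV"
    using measure_finite_Union[of J A majorant] J by (simp add: sets_majorant emeasure_eq_measure image_subset_iff)
  have "\<bar>(\<integral>x. h x \<partial>majorant) - (\<Sum>j\<in>J. h (p j) * measure majorant (A j))\<bar> \<le> \<epsilon> * measure majorant UNIV"
    by (rule integral_step_approx[OF finite_borel_majorant hm hb J])
  with le \<delta>(2) sum_eq have "L_var h \<le> (\<integral>x. h x \<partial>majorant) + (2 * (\<epsilon> * measure majorant UNIV) + \<epsilon>)"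
    unfolding total by linarith
  then show "L_var h \<le> (\<integral>x. h x \<partial>majorant) + (2 * measure majorant UNIV + 1) * \<epsilon>"
    by (simp add: algebra_simps)
qed

lemma L_field_le_integral:
  assumes "admissible S f h" "continuous_on UNIV h" "\<And>x. 0 \<le> h x" "\<And>x. h x \<le> B"
  shows "L_field S f \<le> (\<integral>x. h x \<partial>majorant)"
  using L_var_upper[OF assms(1,4)] L_var_le_integral[OF assms(2-4)] by simp

end

section \<open>Representation by a vector measure\<close>

text \<open>Riesz-Fischer without an enumeration of \<open>E\<close>. Finite sets \<open>S n\<close>
  are chosen whose sums of squares approach the supremum; any finite set disjoint from
  \<open>S n\<close> then has sum at most \<open>1 / Suc n\<close>. This makes the partial sums
  Cauchy and shows that a coefficient missed by all \<open>S n\<close> is 0.\<close>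

lemma orthonormal_representation:
  fixes E :: "'a::{real_inner, complete_space} set"
  assumes E: "\<And>e. e \<in> E \<Longrightarrow> norm e = 1" "\<And>e e'. e \<in> E \<Longrightarrow> e' \<in> E \<Longrightarrow> e \<noteq> e' \<Longrightarrow> e \<bullet> e' = 0"
    and bound: "\<And>S. finite S \<Longrightarrow> S \<subseteq> E \<Longrightarrow> L2_set c S \<le> B"
  shows "\<exists>w. (\<forall>e\<in>E. w \<bullet> e = c e) \<and> norm w \<le> B"
proof -
  define q where "q S = (\<Sum>e\<in>S. (c e)\<^sup>2)" for S
  have q_le: "q S \<le> B\<^sup>2" if "finite S" "S \<subseteq> E" for S
  proof -
    have "sqrt (q S) \<le> B"
      using bound[OF that] by (simp add: L2_set_def q_def)
    then show ?thesis
      by (simp add: real_le_rsqrt sqrt_le_D)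
  qed
  define Q where "Q = {q S | S. finite S \<and> S \<subseteq> E}"
  have bdd: "bdd_above Q"
    unfolding Q_def using q_le by (intro bdd_aboveI[of _ "B\<^sup>2"]) auto
  have "q {} \<in> Q"
    by (auto simp: Q_def)
  have "\<exists>S. finite S \<and> S \<subseteq> E \<and> Sup Q - 1 / Suc n < q S" for n
  proof -
    have "\<exists>x\<in>Q. Sup Q - 1 / Suc n < x"
      using \<open>q {} \<in> Q\<close> by (intro less_cSupD) auto
    then show ?thesis
      by (auto simp: Q_def)
  qed
  then obtain T where T: "\<And>n. finite (T n)" "\<And>n. T n \<subseteq> E" "\<And>n. Sup Q - 1 / Suc n < q (T n)"
    by metis
  define S where "S n = (\<Union>k\<le>n. T k)" for n
  have S: "finite (S n)" "S n \<subseteq> E" for n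
    using T by (auto simp: S_def)
  have S_mono: "S m \<subseteq> S n" if "m \<le> n" for m n
    using that by (auto simp: S_def intro: order_trans)
  have q_mono: "q A \<le> q A'" if "A \<subseteq> A'" "finite A'" for A A'
    unfolding q_def using that by (intro sum_mono2) auto
  have q_upper: "q A \<le> Sup Q" if "finite A" "A \<subseteq> E" for A
    using that bdd by (intro cSup_upper) (auto simp: Q_def)
  have q_S: "Sup Q - 1 / Suc n < q (S n)" for n
    using T(3)[of n] q_mono[of "T n" "S n"] S(1)[of n] by (force simp: S_def)
  have q_diff: "q (A - S n) \<le> 1 / Suc n" if "finite A" "A \<subseteq> E" for A n
  proof -
    have "q (A - S n) + q (S n) = q (A - S n \<union> S n)"
      unfolding q_def using that S by (intro sum.union_disjoint[symmetric]) auto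
    also have "\<dots> \<le> Sup Q"
      using that S by (intro q_upper) auto
    finally show ?thesis
      using q_S[of n] by simp
  qed
  define w where "w n = (\<Sum>e\<in>S n. c e *\<^sub>R e)" for n
  have w_diff: "(norm (w n - w m))\<^sup>2 \<le> 1 / Suc m" if "m \<le> n" for m n
  proof -
    have "w n - w m = (\<Sum>e\<in>S n - S m. c e *\<^sub>R e)"
      unfolding w_def using S S_mono[OF that] by (simp add: sum_diff)
    moreover have "norm (\<Sum>e\<in>S n - S m. c e *\<^sub>R e) = L2_set c (S n - S m)"
      using S by (intro norm_orthonormal_sum[OF E]) auto
    ultimately have "(norm (w n - w m))\<^sup>2 = q (S n - S m)"
      by (simp add: L2_set_def q_def sum_nonneg)
    then show ?thesis
      using q_diff[of "S n" m] S by simp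
  qed
  have "Cauchy w"
  proof (rule CauchyI')
    fix e :: real assume e: "0 < e"
    then obtain M :: nat where M: "1 / Suc M < e\<^sup>2"
      by (metis nat_approx_posE zero_less_power)
    have "dist (w m) (w n) < e" if "M \<le> m" "m < n" for m n
    proof -
      have "(norm (w n - w m))\<^sup>2 \<le> 1 / Suc m"
        using that by (intro w_diff) simp
      also have "\<dots> \<le> 1 / Suc M"
        using that by (simp add: field_simps)
      also have "\<dots> < e\<^sup>2"
        by (rule M)
      finally have "norm (w n - w m) < e"
        using e by (simp add: power_less_imp_less_base)
      then show ?thesis
        by (simp add: dist_norm norm_minus_commute)
    qed
    then show "\<exists>M. \<forall>m\<ge>M. \<forall>n>m. dist (w m) (w n) < e"
      by blast
  qed
  then obtain l where l: "w \<longlonglongrightarrow> l"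
    using Cauchy_convergent convergent_def by blast
  have "l \<bullet> e = c e" if e: "e \<in> E" for e
  proof -
    have le: "(w n \<bullet> e - c e)\<^sup>2 \<le> 1 / Suc n" for n
    proof (cases "e \<in> S n")
      case True
      then show ?thesis
        using orthonormal_inner_sum[OF E S(1,2) e, of c] by (simp add: w_def)
    next
      case False
      then have "(c e)\<^sup>2 \<le> 1 / Suc n"
        using q_diff[of "{e}" n] e by (simp add: q_def insert_Diff_if)
      then show ?thesis
        using False orthonormal_inner_sum[OF E S(1,2) e, of c] by (simp add: w_def)
    qed
    have "(\<lambda>n. (w n \<bullet> e - c e)\<^sup>2) \<longlonglongrightarrow> (l \<bullet> e - c e)\<^sup>2"
      by (intro tendsto_intros l)
    moreover have "(\<lambda>n. (w n \<bullet> e - c e)\<^sup>2) \<longlonglongrightarrow> 0"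
    proof (rule Lim_null_comparison)
      show "\<forall>\<^sub>F n in sequentially. norm ((w n \<bullet> e - c e)\<^sup>2) \<le> 1 / Suc n"
        using le by (intro always_eventually) auto
      show "(\<lambda>n. 1 / real (Suc n)) \<longlonglongrightarrow> 0"
        using LIMSEQ_inverse_real_of_nat by (simp add: inverse_eq_divide)
    qed
    ultimately have "(l \<bullet> e - c e)\<^sup>2 = 0"
      by (rule LIMSEQ_unique)
    then show ?thesis
      by simp
  qed
  moreover have "norm l \<le> B"
  proof (rule tendsto_upperbound[OF tendsto_norm[OF l]])
    have "norm (w n) = L2_set c (S n)" for n
      unfolding w_def using S by (intro norm_orthonormal_sum[OF E])
    then show "\<forall>\<^sub>F n in sequentially. norm (w n) \<le> B"
      using bound S by (intro always_eventually) auto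
  qed simp
  ultimately show ?thesis
    by blast
qed

context gradient_functional
begin

lemma vector_eqI:
  assumes "\<And>e. e \<in> E \<Longrightarrow> w \<bullet> e = w' \<bullet> e"
  shows "w = w'"
proof -
  let ?Z = "{z. (w - w') \<bullet> z = 0}"
  have "subspace ?Z"
    by (auto simp: subspace_def inner_add_right)
  moreover have "E \<subseteq> ?Z"
    using assms by (auto simp: inner_diff_left)
  ultimately have "span E \<subseteq> ?Z"
    by (rule span_minimal[rotated])
  moreover have "closed ?Z"
    by (intro closed_Collect_eq continuous_intros)
  ultimately have "closure (span E) \<subseteq> ?Z"
    by (rule closure_minimal)
  then have "w - w' \<in> ?Z"
    using E_dense by blast
  then show ?thesis
    by simp
qed

section \<open>Extension from C1 functions to indicators, Lipschitz in L1\<close>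

lemma majorant_integrable:
  fixes f :: "'a \<Rightarrow> real"
  assumes "f \<in> borel_measurable borel" "\<And>x. \<bar>f x\<bar> \<le> C"
  shows "integrable majorant f"
  using assms by (intro finite_measure_integrable_bounded[OF finite_measure_majorant])
    (auto simp: measurable_cong_sets[OF sets_majorant refl])

lemma majorant_integrable_C1b: "C1b \<phi> \<Longrightarrow> integrable majorant \<phi>"
  using C1b_bound[of \<phi>] C1b_measurable by (auto intro: majorant_integrable)

text \<open>Duality: the field with coefficients \<open>L e \<phi> * \<phi>\<close> has norm
  \<open>N * \<bar>\<phi> x\<bar>\<close>, where \<open>N\<close> is the left-hand side, and its
  pairing with \<open>L\<close> is \<open>N\<^sup>2\<close>. The bound
  \<open>N * \<bar>\<phi> x\<bar>\<close> need not be C1; domination by the majorant asks for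
  continuity only.\<close>

lemma L_L2_set_le:
  assumes \<phi>: "C1b \<phi>" and S: "finite S" "S \<subseteq> E"
  shows "L2_set (\<lambda>e. L e \<phi>) S \<le> (\<integral>x. \<bar>\<phi> x\<bar> \<partial>majorant)"
proof -
  define a where "a e = L e \<phi>" for e
  define N where "N = L2_set a S"
  have N: "0 \<le> N" "N\<^sup>2 = (\<Sum>e\<in>S. a e * a e)"
    by (simp_all add: N_def L2_set_def sum_nonneg power2_eq_square)
  define f where "f e x = (if e \<in> S then a e * \<phi> x else 0)" for e x
  obtain B where B: "\<And>x. \<bar>\<phi> x\<bar> \<le> B"
    using C1b_bound[OF \<phi>] by blast
  have "L2_set (\<lambda>e. f e x) S = N * \<bar>\<phi> x\<bar>" for x
  proof -
    have "L2_set (\<lambda>e. f e x) S = L2_set (\<lambda>e. a e * \<phi> x) S"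
      unfolding f_def by (intro L2_set_cong) auto
    also have "\<dots> = N * \<bar>\<phi> x\<bar>"
      unfolding N_def L2_set_def by (simp add: power_mult_distrib sum_distrib_right[symmetric] real_sqrt_mult)
    finally show ?thesis .
  qed
  moreover have "C1b (f e)" for e
    using \<phi> by (cases "e \<in> S") (simp_all add: f_def[abs_def] C1b_cmult C1b_const)
  moreover have "f e = (\<lambda>_. 0)" if "e \<notin> S" for e
    using that by (simp add: f_def[abs_def])
  ultimately have "admissible S f (\<lambda>x. N * \<bar>\<phi> x\<bar>)"
    using S by (simp add: admissible_def)
  then have "L_field S f \<le> (\<integral>x. N * \<bar>\<phi> x\<bar> \<partial>majorant)"
  proof (rule L_field_le_integral)
    show "continuous_on UNIV (\<lambda>x. N * \<bar>\<phi> x\<bar>)"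
      by (intro continuous_intros C1b_continuous \<phi>)
    show "N * \<bar>\<phi> x\<bar> \<le> N * B" for x
      using N B by (intro mult_left_mono) auto
  qed (use N in simp)
  moreover have "L_field S f = N\<^sup>2"
    unfolding L_field_def N(2)
  proof (rule sum.cong[OF refl])
    fix e assume "e \<in> S"
    then show "L e (f e) = a e * a e"
      using L_cmult[of e \<phi> "a e"] \<phi> S by (auto simp: f_def[abs_def] a_def)
  qed
  ultimately have "N * N \<le> N * (\<integral>x. \<bar>\<phi> x\<bar> \<partial>majorant)"
    by (simp add: power2_eq_square)
  moreover have "0 \<le> (\<integral>x. \<bar>\<phi> x\<bar> \<partial>majorant)"
    by (rule Bochner_Integration.integral_nonneg) simp
  ultimately have "N \<le> (\<integral>x. \<bar>\<phi> x\<bar> \<partial>majorant)"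
    using N(1) by (cases "N = 0") auto
  then show ?thesis
    by (simp add: N_def a_def[abs_def])
qed

text \<open>The vector with coordinates \<open>L e \<phi>\<close>; it will turn out to be the
  integral of \<open>\<phi>\<close> against the vector measure under construction.\<close>

definition L_vec :: "('a \<Rightarrow> real) \<Rightarrow> 'a" where
  "L_vec \<phi> = (SOME w. (\<forall>e\<in>E. w \<bullet> e = L e \<phi>) \<and> norm w \<le> (\<integral>x. \<bar>\<phi> x\<bar> \<partial>majorant))"

lemma
  assumes "C1b \<phi>"
  shows L_vec_inner: "e \<in> E \<Longrightarrow> L_vec \<phi> \<bullet> e = L e \<phi>"
    and norm_L_vec_le: "norm (L_vec \<phi>) \<le> (\<integral>x. \<bar>\<phi> x\<bar> \<partial>majorant)"
proof -
  have "\<exists>w. (\<forall>e\<in>E. w \<bullet> e = L e \<phi>) \<and> norm w \<le> (\<integral>x. \<bar>\<phi> x\<bar> \<partial>majorant)"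
    by (intro orthonormal_representation E_norm E_orth L_L2_set_le assms)
  then have "(\<forall>e\<in>E. L_vec \<phi> \<bullet> e = L e \<phi>) \<and> norm (L_vec \<phi>) \<le> (\<integral>x. \<bar>\<phi> x\<bar> \<partial>majorant)"
    unfolding L_vec_def by (rule someI_ex)
  then show "e \<in> E \<Longrightarrow> L_vec \<phi> \<bullet> e = L e \<phi>" "norm (L_vec \<phi>) \<le> (\<integral>x. \<bar>\<phi> x\<bar> \<partial>majorant)"
    by auto
qed

lemma L_vec_add: "C1b \<phi> \<Longrightarrow> C1b \<psi> \<Longrightarrow> L_vec (\<lambda>x. \<phi> x + \<psi> x) = L_vec \<phi> + L_vec \<psi>"
  by (rule vector_eqI) (simp add: L_vec_inner C1b_add L_add inner_add_left)

lemma L_vec_cmult: "C1b \<phi> \<Longrightarrow> L_vec (\<lambda>x. c * \<phi> x) = c *\<^sub>R L_vec \<phi>"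
  by (rule vector_eqI) (simp add: L_vec_inner C1b_cmult L_cmult)

lemma L_vec_diff: "C1b \<phi> \<Longrightarrow> C1b \<psi> \<Longrightarrow> L_vec (\<lambda>x. \<phi> x - \<psi> x) = L_vec \<phi> - L_vec \<psi>"
  using L_vec_add[OF _ C1b_cmult, of \<phi> \<psi> "- 1"] L_vec_cmult[of \<psi> "- 1"] by simp

lemma L_vec_sum:
  "finite J \<Longrightarrow> (\<And>j. j \<in> J \<Longrightarrow> C1b (\<phi> j)) \<Longrightarrow> L_vec (\<lambda>x. \<Sum>j\<in>J. \<phi> j x) = (\<Sum>j\<in>J. L_vec (\<phi> j))"
proof (induction J rule: finite_induct)
  case empty
  then show ?case
    using L_vec_cmult[OF C1b_const, of 0 0] by simp
next
  case (insert j J)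
  then show ?case
    by (simp add: L_vec_add C1b_sum)
qed

lemma majorant_approx_indicator:
  assumes "B \<in> sets borel" "0 < \<delta>"
  shows "\<exists>\<phi>. C1b \<phi> \<and> L1_dist majorant \<phi> (indicator B) < \<delta>"
proof -
  have "C1b_approximable (UNIV :: unit set) (\<lambda>_. majorant) B"
    by (intro C1b_approximable_borel sep finite_borel_majorant assms ballI) simp
  then show ?thesis
    using assms(2) unfolding C1b_approximable_def by blast
qed

lemma L_vec_dist_le:
  assumes \<phi>: "C1b \<phi>" and \<psi>: "C1b \<psi>" and g: "integrable majorant g"
  shows "norm (L_vec \<phi> - L_vec \<psi>) \<le> L1_dist majorant \<phi> g + L1_dist majorant \<psi> g"
proof -
  note int = majorant_integrable_C1b[OF \<phi>] majorant_integrable_C1b[OF \<psi>] g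
  have "norm (L_vec \<phi> - L_vec \<psi>) \<le> L1_dist majorant \<phi> \<psi>"
    using norm_L_vec_le[OF C1b_diff[OF \<phi> \<psi>]] by (simp add: L_vec_diff \<phi> \<psi> L1_dist_def)
  also have "\<dots> \<le> (\<integral>x. \<bar>\<phi> x - g x\<bar> + \<bar>\<psi> x - g x\<bar> \<partial>majorant)"
    unfolding L1_dist_def using int by (intro integral_mono) auto
  also have "\<dots> = L1_dist majorant \<phi> g + L1_dist majorant \<psi> g"
    unfolding L1_dist_def using int by (intro Bochner_Integration.integral_add) auto
  finally show ?thesis .
qed

lemma majorant_integrable_indicator: "B \<in> sets borel \<Longrightarrow> integrable majorant (indicator B :: 'a \<Rightarrow> real)"
  by (intro majorant_integrable[of _ 1]) (auto simp: indicator_def)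

text \<open>Along C1 functions that approach the indicator in L1 the vectors \<open>L_vec\<close>
  form a Cauchy sequence. The estimate is claimed for every \<open>\<phi>\<close>, so that it
  survives any other choice of approximations.\<close>

lemma L_measure_ex:
  assumes B: "B \<in> sets borel"
  shows "\<exists>w. \<forall>\<phi>. C1b \<phi> \<longrightarrow> norm (L_vec \<phi> - w) \<le> L1_dist majorant \<phi> (indicator B)"
proof -
  have "\<exists>\<phi>. C1b \<phi> \<and> L1_dist majorant \<phi> (indicator B) < 1 / Suc n" for n
    by (rule majorant_approx_indicator[OF B]) simp
  then obtain \<phi> where \<phi>: "\<And>n. C1b (\<phi> n)" "\<And>n. L1_dist majorant (\<phi> n) (indicator B) < 1 / Suc n"
    by metis
  note iB = majorant_integrable_indicator[OF B]
  have "Cauchy (\<lambda>n. L_vec (\<phi> n))"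
  proof (rule CauchyI')
    fix e :: real assume "0 < e"
    then obtain M :: nat where M: "1 / Suc M < e / 2"
      by (metis nat_approx_posE half_gt_zero)
    have "dist (L_vec (\<phi> m)) (L_vec (\<phi> n)) < e" if "M \<le> m" "m < n" for m n
    proof -
      have "1 / Suc m \<le> 1 / Suc M" "1 / Suc n \<le> 1 / Suc M"
        using that by (auto simp: field_simps)
      then show ?thesis
        using L_vec_dist_le[OF \<phi>(1) \<phi>(1) iB, of m n] \<phi>(2)[of m] \<phi>(2)[of n] M by (simp add: dist_norm)
    qed
    then show "\<exists>M. \<forall>m\<ge>M. \<forall>n>m. dist (L_vec (\<phi> m)) (L_vec (\<phi> n)) < e"
      by blast
  qed
  then obtain w where w: "(\<lambda>n. L_vec (\<phi> n)) \<longlonglongrightarrow> w"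
    using Cauchy_convergent convergent_def by blast
  have "norm (L_vec \<psi> - w) \<le> L1_dist majorant \<psi> (indicator B)" if \<psi>: "C1b \<psi>" for \<psi>
  proof (rule tendsto_le)
    show "(\<lambda>n. norm (L_vec \<psi> - L_vec (\<phi> n))) \<longlonglongrightarrow> norm (L_vec \<psi> - w)"
      by (intro tendsto_intros w)
    have "(\<lambda>n. 1 / real (Suc n)) \<longlonglongrightarrow> 0"
      using LIMSEQ_inverse_real_of_nat by (simp add: inverse_eq_divide)
    from tendsto_add[OF tendsto_const this]
    show "(\<lambda>n. L1_dist majorant \<psi> (indicator B) + 1 / Suc n) \<longlonglongrightarrow> L1_dist majorant \<psi> (indicator B)"
      by simp
    show "\<forall>\<^sub>F n in sequentially. norm (L_vec \<psi> - L_vec (\<phi> n)) \<le> L1_dist majorant \<psi> (indicator B) + 1 / Suc n"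
      using L_vec_dist_le[OF \<psi> \<phi>(1) iB] \<phi>(2)
      by (intro always_eventually allI) (meson add_left_mono less_imp_le order_trans)
  qed simp
  then show ?thesis
    by blast
qed

text \<open>The limit of \<open>L_vec \<phi>\<close> as \<open>\<phi>\<close> tends to the indicator of \<open>B\<close> in L1; the defining inequality also
  determines it uniquely.\<close>

definition L_measure :: "'a set \<Rightarrow> 'a" where
  "L_measure B = (SOME w. \<forall>\<phi>. C1b \<phi> \<longrightarrow> norm (L_vec \<phi> - w) \<le> L1_dist majorant \<phi> (indicator B))"

lemma norm_L_vec_diff_L_measure_le:
  assumes "B \<in> sets borel" "C1b \<phi>"
  shows "norm (L_vec \<phi> - L_measure B) \<le> L1_dist majorant \<phi> (indicator B)"
  using someI_ex[OF L_measure_ex[OF assms(1)]] assms(2) unfolding L_measure_def by blast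

text \<open>The source of all properties of \<open>L_measure\<close>: with \<open>\<phi> = 0\<close>
  it bounds linear combinations of values, hence gives additivity and the bound by the majorant, and
  with step functions close to \<open>\<phi>\<close> it identifies the integral. In the error
  \<open>2 * K * \<delta>\<close>, one part comes from the values on the \<open>B j\<close> and one
  from the L1 distance.\<close>

lemma norm_L_vec_diff_step_le:
  assumes J: "finite J" "\<And>j. j \<in> J \<Longrightarrow> B j \<in> sets borel" and \<phi>: "C1b \<phi>"
  shows "norm (L_vec \<phi> - (\<Sum>j\<in>J. c j *\<^sub>R L_measure (B j))) \<le> L1_dist majorant \<phi> (\<lambda>x. \<Sum>j\<in>J. c j * indicator (B j) x)"
proof (rule le_if_le_add_mult_epsilon)
  define K where "K = (\<Sum>j\<in>J. \<bar>c j\<bar>)"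
  show "0 \<le> 2 * K"
    by (simp add: K_def sum_nonneg)
  fix \<delta> :: real assume \<delta>: "0 < \<delta>"
  have "\<forall>j\<in>J. \<exists>\<psi>. C1b \<psi> \<and> L1_dist majorant \<psi> (indicator (B j)) < \<delta>"
    using J \<delta> by (intro ballI majorant_approx_indicator)
  then obtain \<psi> where "\<forall>j\<in>J. C1b (\<psi> j) \<and> L1_dist majorant (\<psi> j) (indicator (B j)) < \<delta>"
    by (rule bchoice[THEN exE])
  then have \<psi>: "\<And>j. j \<in> J \<Longrightarrow> C1b (\<psi> j)" "\<And>j. j \<in> J \<Longrightarrow> L1_dist majorant (\<psi> j) (indicator (B j)) < \<delta>"
    by auto
  have err: "(\<Sum>j\<in>J. \<bar>c j\<bar> * L1_dist majorant (\<psi> j) (indicator (B j))) \<le> K * \<delta>"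
    unfolding K_def sum_distrib_right using \<psi>(2) by (intro sum_mono mult_left_mono) (auto simp: less_imp_le)
  have sC: "C1b (\<lambda>x. \<Sum>j\<in>J. c j * \<psi> j x)"
    by (intro C1b_sum C1b_cmult \<psi>)
  have vs: "L_vec (\<lambda>x. \<Sum>j\<in>J. c j * \<psi> j x) = (\<Sum>j\<in>J. c j *\<^sub>R L_vec (\<psi> j))"
    using J(1) \<psi>(1) by (simp add: L_vec_sum C1b_cmult L_vec_cmult)
  have int: "integrable majorant (\<lambda>x. \<Sum>j\<in>J. c j * indicator (B j) x)"
    "j \<in> J \<Longrightarrow> integrable majorant (\<lambda>x. \<bar>\<psi> j x - indicator (B j) x\<bar>)" for j
    by (intro integrable_abs Bochner_Integration.integrable_diff Bochner_Integration.integrable_sum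
        integrable_mult_right majorant_integrable_indicator majorant_integrable_C1b J \<psi>; assumption)+
  have "norm ((\<Sum>j\<in>J. c j *\<^sub>R L_vec (\<psi> j)) - (\<Sum>j\<in>J. c j *\<^sub>R L_measure (B j)))
      = norm (\<Sum>j\<in>J. c j *\<^sub>R (L_vec (\<psi> j) - L_measure (B j)))"
    by (simp add: sum_subtractf scaleR_diff_right)
  also have "\<dots> \<le> (\<Sum>j\<in>J. \<bar>c j\<bar> * L1_dist majorant (\<psi> j) (indicator (B j)))"
    using J(2) \<psi>(1) by (intro sum_norm_le) (auto intro!: mult_left_mono norm_L_vec_diff_L_measure_le)
  finally have 1: "norm ((\<Sum>j\<in>J. c j *\<^sub>R L_vec (\<psi> j)) - (\<Sum>j\<in>J. c j *\<^sub>R L_measure (B j))) \<le> K * \<delta>"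
    using err by simp
  have "L1_dist majorant (\<lambda>x. \<Sum>j\<in>J. c j * \<psi> j x) (\<lambda>x. \<Sum>j\<in>J. c j * indicator (B j) x)
      \<le> (\<integral>x. (\<Sum>j\<in>J. \<bar>c j\<bar> * \<bar>\<psi> j x - indicator (B j) x\<bar>) \<partial>majorant)"
    unfolding L1_dist_def
  proof (rule integral_mono)
    show "integrable majorant (\<lambda>x. \<bar>(\<Sum>j\<in>J. c j * \<psi> j x) - (\<Sum>j\<in>J. c j * indicator (B j) x)\<bar>)"
      using int(1) majorant_integrable_C1b[OF sC] by simp
    show "integrable majorant (\<lambda>x. \<Sum>j\<in>J. \<bar>c j\<bar> * \<bar>\<psi> j x - indicator (B j) x\<bar>)"
      using int(2) by (intro Bochner_Integration.integrable_sum integrable_mult_right) auto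
    fix x
    have "(\<Sum>j\<in>J. c j * \<psi> j x) - (\<Sum>j\<in>J. c j * indicator (B j) x) = (\<Sum>j\<in>J. c j * (\<psi> j x - indicator (B j) x))"
      by (simp add: sum_subtractf right_diff_distrib)
    also have "\<bar>\<dots>\<bar> \<le> (\<Sum>j\<in>J. \<bar>c j\<bar> * \<bar>\<psi> j x - indicator (B j) x\<bar>)"
      by (rule order.trans[OF sum_abs]) (simp add: abs_mult)
    finally show "\<bar>(\<Sum>j\<in>J. c j * \<psi> j x) - (\<Sum>j\<in>J. c j * indicator (B j) x)\<bar> \<le> (\<Sum>j\<in>J. \<bar>c j\<bar> * \<bar>\<psi> j x - indicator (B j) x\<bar>)" .
  qed
  also have "\<dots> = (\<Sum>j\<in>J. \<bar>c j\<bar> * L1_dist majorant (\<psi> j) (indicator (B j)))"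
    unfolding L1_dist_def using int(2) by (subst Bochner_Integration.integral_sum) (auto intro!: integrable_mult_right)
  finally have 2: "L1_dist majorant (\<lambda>x. \<Sum>j\<in>J. c j * \<psi> j x) (\<lambda>x. \<Sum>j\<in>J. c j * indicator (B j) x) \<le> K * \<delta>"
    using err by simp
  have "norm (L_vec \<phi> - (\<Sum>j\<in>J. c j *\<^sub>R L_measure (B j)))
      \<le> norm (L_vec \<phi> - (\<Sum>j\<in>J. c j *\<^sub>R L_vec (\<psi> j))) + norm ((\<Sum>j\<in>J. c j *\<^sub>R L_vec (\<psi> j)) - (\<Sum>j\<in>J. c j *\<^sub>R L_measure (B j)))"
    using norm_triangle_ineq[of "L_vec \<phi> - (\<Sum>j\<in>J. c j *\<^sub>R L_vec (\<psi> j))" "(\<Sum>j\<in>J. c j *\<^sub>R L_vec (\<psi> j)) - (\<Sum>j\<in>J. c j *\<^sub>R L_measure (B j))"]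
    by simp
  also have "\<dots> \<le> (L1_dist majorant \<phi> (\<lambda>x. \<Sum>j\<in>J. c j * indicator (B j) x) + K * \<delta>) + K * \<delta>"
    using L_vec_dist_le[OF \<phi> sC int(1)] 1 2 unfolding vs by linarith
  finally show "norm (L_vec \<phi> - (\<Sum>j\<in>J. c j *\<^sub>R L_measure (B j)))
      \<le> L1_dist majorant \<phi> (\<lambda>x. \<Sum>j\<in>J. c j * indicator (B j) x) + 2 * K * \<delta>"
    by simp
qed

lemma norm_L_measure_combination_le:
  assumes "finite J" "\<And>j. j \<in> J \<Longrightarrow> B j \<in> sets borel"
  shows "norm (\<Sum>j\<in>J. c j *\<^sub>R L_measure (B j)) \<le> (\<integral>x. \<bar>\<Sum>j\<in>J. c j * indicator (B j) x\<bar> \<partial>majorant)"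
proof -
  have "L_vec (\<lambda>_. 0) = 0"
    using L_vec_cmult[OF C1b_const, of 0 0] by simp
  then show ?thesis
    using norm_L_vec_diff_step_le[OF assms C1b_const[of 0], where c = c] by (simp add: L1_dist_def)
qed

lemma norm_L_measure_le: "B \<in> sets borel \<Longrightarrow> norm (L_measure B) \<le> measure majorant B"
  using norm_L_measure_combination_le[of "{()}" "\<lambda>_. B" "\<lambda>_. 1"] by (simp add: sets_majorant)

lemma L_measure_countably_additive: "countably_additive_vm L_measure"
  unfolding countably_additive_vm_def
proof (intro allI impI)
  fix B :: "nat \<Rightarrow> 'a set" assume B: "\<forall>n. B n \<in> sets borel" and disj: "disjoint_family B"
  define U where "U = (\<Union>n. B n)"
  have [measurable]: "B n \<in> sets borel" "U \<in> sets borel" for n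
    using B by (auto simp: U_def)
  have ind: "(\<Sum>j<n. indicator (B j) x) = (indicator (\<Union>j<n. B j) x :: real)" for n x
    by (rule indicator_UN_disjoint[symmetric])
      (use disj in \<open>auto simp: disjoint_family_on_def\<close>)
  have le: "norm ((\<Sum>j<n. L_measure (B j)) - L_measure U)
      \<le> L1_dist majorant (indicator (\<Union>j<n. B j)) (indicator U)" for n
  proof -
    \<comment> \<open>The index \<open>n\<close> is reserved for the union \<open>U\<close> with
      coefficient \<open>-1\<close>, so that the combination over \<open>j < Suc n\<close> is the
      partial sum minus \<open>L_measure U\<close>.\<close>
    let ?B = "\<lambda>j. if j = n then U else B j" and ?c = "\<lambda>j. if j = n then - 1 else 1 :: real"
    have "(\<Sum>j<n. ?c j *\<^sub>R L_measure (?B j)) = (\<Sum>j<n. L_measure (B j))"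
      "(\<Sum>j<n. ?c j * indicator (?B j) x) = (\<Sum>j<n. indicator (B j) x)" for x
      by (auto intro!: sum.cong)
    then have eqs: "(\<Sum>j<Suc n. ?c j *\<^sub>R L_measure (?B j)) = (\<Sum>j<n. L_measure (B j)) - L_measure U"
      "(\<Sum>j<Suc n. ?c j * indicator (?B j) x) = indicator (\<Union>j<n. B j) x - indicator U x" for x
      by (simp_all add: ind)
    have "norm (\<Sum>j<Suc n. ?c j *\<^sub>R L_measure (?B j)) \<le> (\<integral>x. \<bar>\<Sum>j<Suc n. ?c j * indicator (?B j) x\<bar> \<partial>majorant)"
      by (rule norm_L_measure_combination_le) auto
    then show ?thesis
      unfolding eqs L1_dist_def .
  qed
  have lim: "(\<lambda>n. L1_dist majorant (indicator (\<Union>j<n. B j)) (indicator U)) \<longlonglongrightarrow> 0"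
    unfolding U_def using B by (intro L1_dist_tendsto_zero[OF finite_borel_majorant] unit_borel_indicator LIMSEQ_indicator_UN) auto
  have "(\<lambda>n. (\<Sum>j<n. L_measure (B j)) - L_measure U) \<longlonglongrightarrow> 0"
    by (rule Lim_null_comparison[OF always_eventually[OF allI[OF le]] lim])
  then show "(\<lambda>n. L_measure (B n)) sums L_measure (\<Union>n. B n)"
    unfolding sums_def U_def[symmetric] by (rule LIM_zero_cancel)
qed

lemma vector_measure_L_measure: "vector_measure L_measure"
proof -
  interpret finite_measure majorant by (rule finite_measure_majorant)
  have "total_variation L_measure \<le> emeasure majorant UNIV"
    unfolding total_variation_def
  proof (rule SUP_least, clarify)
    fix B :: "nat \<Rightarrow> 'a set" assume B: "\<forall>n. B n \<in> sets borel" "disjoint_family B" "(\<Union>n. B n) = UNIV"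
    have "(\<Sum>n. ennreal (norm (L_measure (B n)))) \<le> (\<Sum>n. emeasure majorant (B n))"
      using B by (intro suminf_le) (auto simp: emeasure_eq_measure intro!: ennreal_leI norm_L_measure_le)
    also have "\<dots> = emeasure majorant (\<Union>n. B n)"
      using B by (intro suminf_emeasure) (auto simp: sets_majorant)
    finally show "(\<Sum>n. ennreal (norm (L_measure (B n)))) \<le> emeasure majorant UNIV"
      using B by simp
  qed
  then have "total_variation L_measure < \<infinity>"
    using emeasure_eq_measure by (simp add: order_le_less_trans)
  then show ?thesis
    by (simp add: vector_measure_def L_measure_countably_additive)
qed

text \<open>Both sides are close to the same sum of
  \<open>\<phi> (p j) * (L_measure (B j) \<bullet> y)\<close> over a fine partition.\<close>

lemma signed_integral_L_measure:
  assumes \<phi>: "C1b \<phi>"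
  shows "signed_integral (\<lambda>B. L_measure B \<bullet> y) \<phi> = L_vec \<phi> \<bullet> y"
proof -
  obtain P N where PN: "signed_decomp (\<lambda>B. L_measure B \<bullet> y) P N"
    using vector_measure_signed_decomp[OF vector_measure_L_measure] by blast
  obtain C where C: "\<And>x. \<bar>\<phi> x\<bar> \<le> C"
    using C1b_bound[OF \<phi>] by blast
  note m = C1b_measurable[OF \<phi>]
  define s where "s = (\<integral>x. \<phi> x \<partial>P) - (\<integral>x. \<phi> x \<partial>N)"
  define K where "K = measure P UNIV + measure N UNIV + norm y * measure majorant UNIV"
  have "\<bar>s - L_vec \<phi> \<bullet> y\<bar> \<le> 0"
  proof (rule le_if_le_add_mult_epsilon)
    show "0 \<le> K"
      by (simp add: K_def)
    fix \<delta> :: real assume \<delta>: "0 < \<delta>"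
    have "\<exists>(J :: (unit \<Rightarrow> int) set) B p. step_partition (UNIV :: unit set) (\<lambda>_. \<phi>) \<delta> J B p"
      using m C \<delta> by (intro step_partition_exists) auto
    then obtain J :: "(unit \<Rightarrow> int) set" and B p where "step_partition (UNIV :: unit set) (\<lambda>_. \<phi>) \<delta> J B p"
      by blast
    then have J: "finite J" "\<And>j. j \<in> J \<Longrightarrow> B j \<in> sets borel" "disjoint_family_on B J" "(\<Union>j\<in>J. B j) = UNIV"
      "\<And>j x. j \<in> J \<Longrightarrow> x \<in> B j \<Longrightarrow> \<bar>\<phi> x - \<phi> (p j)\<bar> \<le> \<delta>"
      by (auto simp: step_partition_def)
    have 1: "\<bar>s - (\<Sum>j\<in>J. \<phi> (p j) * (L_measure (B j) \<bullet> y))\<bar> \<le> \<delta> * (measure P UNIV + measure N UNIV)"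
      unfolding s_def by (rule signed_decomp_step_approx[OF PN m C J])
    have "norm (L_vec \<phi> - (\<Sum>j\<in>J. \<phi> (p j) *\<^sub>R L_measure (B j)))
        \<le> L1_dist majorant \<phi> (\<lambda>x. \<Sum>j\<in>J. \<phi> (p j) * indicator (B j) x)"
      by (rule norm_L_vec_diff_step_le[OF J(1,2) \<phi>])
    also have "\<dots> \<le> (\<integral>x. \<delta> \<partial>majorant)"
      unfolding L1_dist_def
    proof (rule integral_mono)
      show "integrable majorant (\<lambda>x. \<bar>\<phi> x - (\<Sum>j\<in>J. \<phi> (p j) * indicator (B j) x)\<bar>)"
        using J(2) by (intro integrable_abs Bochner_Integration.integrable_diff majorant_integrable_C1b[OF \<phi>]
            Bochner_Integration.integrable_sum integrable_mult_right majorant_integrable_indicator)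
      show "integrable majorant (\<lambda>x. \<delta>)"
        using finite_measure.integrable_const[OF finite_measure_majorant] .
      show "\<bar>\<phi> x - (\<Sum>j\<in>J. \<phi> (p j) * indicator (B j) x)\<bar> \<le> \<delta>" for x
        by (rule step_function_approx[OF J(1,3,4,5)])
    qed
    also have "\<dots> = \<delta> * measure majorant UNIV"
      by (simp add: sets_eq_imp_space_eq[OF sets_majorant] mult.commute)
    finally have "norm (L_vec \<phi> - (\<Sum>j\<in>J. \<phi> (p j) *\<^sub>R L_measure (B j))) * norm y \<le> \<delta> * measure majorant UNIV * norm y"
      by (rule mult_right_mono) simp
    moreover have "\<bar>(L_vec \<phi> - (\<Sum>j\<in>J. \<phi> (p j) *\<^sub>R L_measure (B j))) \<bullet> y\<bar>
        \<le> norm (L_vec \<phi> - (\<Sum>j\<in>J. \<phi> (p j) *\<^sub>R L_measure (B j))) * norm y"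
      by (rule Cauchy_Schwarz_ineq2)
    ultimately have 2: "\<bar>L_vec \<phi> \<bullet> y - (\<Sum>j\<in>J. \<phi> (p j) * (L_measure (B j) \<bullet> y))\<bar> \<le> \<delta> * (norm y * measure majorant UNIV)"
      by (simp add: inner_diff_left inner_sum_left mult_ac)
    show "\<bar>s - L_vec \<phi> \<bullet> y\<bar> \<le> 0 + K * \<delta>"
      using 1 2 by (simp add: K_def algebra_simps)
  qed
  then show ?thesis
    by (simp add: signed_integral_eq[OF PN m C] s_def)
qed

end

section \<open>Functions of bounded variation\<close>

lemma Lp_mult_integrable:
  assumes pq: "1 < p" "1 < q" "1 / p + 1 / q = 1" and f: "Lp M p f" and g: "Lp M q g"
  shows "integrable M (\<lambda>x. f x * g x)"
proof (rule Bochner_Integration.integrable_bound)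
  show "integrable M (\<lambda>x. \<bar>f x\<bar> powr p / p + \<bar>g x\<bar> powr q / q)"
    using f g by (auto simp: Lp_def)
  show "(\<lambda>x. f x * g x) \<in> borel_measurable M"
    using f g by (auto simp: Lp_def)
  show "AE x in M. norm (f x * g x) \<le> norm (\<bar>f x\<bar> powr p / p + \<bar>g x\<bar> powr q / q)"
  proof (intro AE_I2)
    fix x
    have "\<bar>f x\<bar> * \<bar>g x\<bar> \<le> \<bar>f x\<bar> powr p / p + \<bar>g x\<bar> powr q / q"
      by (rule Youngs_inequality[OF pq]) auto
    then show "norm (f x * g x) \<le> norm (\<bar>f x\<bar> powr p / p + \<bar>g x\<bar> powr q / q)"
      by (simp add: abs_mult)
  qed
qed

lemma integrable_mult_bounded:
  fixes u f :: "'a \<Rightarrow> real"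
  assumes "integrable M u" "f \<in> borel_measurable M" "\<And>x. \<bar>f x\<bar> \<le> C"
  shows "integrable M (\<lambda>x. u x * f x)"
proof (rule Bochner_Integration.integrable_bound)
  show "integrable M (\<lambda>x. C * u x)"
    using assms(1) by simp
  show "AE x in M. norm (u x * f x) \<le> norm (C * u x)"
  proof (intro AE_I2)
    fix x
    show "norm (u x * f x) \<le> norm (C * u x)"
      using mult_left_mono[OF assms(3)[of x], of "\<bar>u x\<bar>"] assms(3)[of x] by (simp add: abs_mult mult.commute)
  qed
qed (use assms in measurable)

section \<open>The pairing of u with fields and the two notions of bounded variation\<close>

locale bv_setting =
  fixes \<nu> :: "'a::{real_inner, complete_space} measure"
    and R :: "'a \<Rightarrow> 'a" and v :: "'a \<Rightarrow> 'a \<Rightarrow> real" and u :: "'a \<Rightarrow> real" and E :: "'a set"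
  assumes sep: "\<exists>D :: 'a set. countable D \<and> closure D = UNIV"
    and borel_sets: "sets \<nu> = sets borel"
    and R_lin: "bounded_linear R" and R_inj: "inj R"
    and E_norm: "\<And>e. e \<in> E \<Longrightarrow> norm e = 1"
    and E_orth: "\<And>e e'. e \<in> E \<Longrightarrow> e' \<in> E \<Longrightarrow> e \<noteq> e' \<Longrightarrow> e \<bullet> e' = 0"
    and E_dense: "closure (span E) = UNIV"
    and E_eigen: "\<And>e. e \<in> E \<Longrightarrow> \<exists>c::real. R e = c *\<^sub>R e"
    and u_int: "integrable \<nu> u" and uv_int: "\<And>z. integrable \<nu> (\<lambda>x. u x * v z x)"
begin

text \<open>The pairing of \<open>u\<close> with \<open>nabla_star\<close> of the single field
  \<open>\<phi> y\<close>, and minus the left-hand side of the identity in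
  \<open>BV0_measure\<close>. So \<open>V0\<close> is a supremum of sums of such terms, and the
  identity says that \<open>L y\<close> is integration against
  \<open>m0 \<bullet> y\<close>.\<close>

definition L :: "'a \<Rightarrow> ('a \<Rightarrow> real) \<Rightarrow> real" where
  "L y \<phi> = (\<integral>x. u x * (v (inv R y) x * \<phi> x - grad \<phi> x \<bullet> y) \<partial>\<nu>)"

lemma borel_measurable_nu [simp]: "borel_measurable \<nu> = borel_measurable borel"
  using measurable_cong_sets[OF borel_sets refl] .

lemma L_integrable:
  assumes "C1b \<phi>"
  shows "integrable \<nu> (\<lambda>x. u x * v z x * \<phi> x)" "integrable \<nu> (\<lambda>x. u x * (grad \<phi> x \<bullet> y))"
    "integrable \<nu> (\<lambda>x. u x * (v z x * \<phi> x - grad \<phi> x \<bullet> y))"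
proof -
  obtain B where B: "\<And>x. \<bar>\<phi> x\<bar> \<le> B"
    using C1b_bound[OF assms] by blast
  obtain C where C: "\<And>x. norm (grad \<phi> x) \<le> C"
    using C1b_grad_bound[OF assms] by blast
  show 1: "integrable \<nu> (\<lambda>x. u x * v z x * \<phi> x)"
    by (rule integrable_mult_bounded[OF uv_int _ B]) (simp add: C1b_measurable assms)
  have "\<bar>grad \<phi> x \<bullet> y\<bar> \<le> C * norm y" for x
    by (rule order.trans[OF Cauchy_Schwarz_ineq2]) (intro mult_right_mono C norm_ge_zero)
  then show 2: "integrable \<nu> (\<lambda>x. u x * (grad \<phi> x \<bullet> y))"
    by (intro integrable_mult_bounded[OF u_int]) (simp_all add: C1b_grad_inner_measurable assms)
  have "(\<lambda>x. u x * (v z x * \<phi> x - grad \<phi> x \<bullet> y)) = (\<lambda>x. u x * v z x * \<phi> x - u x * (grad \<phi> x \<bullet> y))"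
    by (simp add: fun_eq_iff algebra_simps)
  then show "integrable \<nu> (\<lambda>x. u x * (v z x * \<phi> x - grad \<phi> x \<bullet> y))"
    using 1 2 by simp
qed

lemma L_add:
  assumes "C1b \<phi>" "C1b \<psi>"
  shows "L y (\<lambda>x. \<phi> x + \<psi> x) = L y \<phi> + L y \<psi>"
proof -
  have "u x * (v (inv R y) x * (\<phi> x + \<psi> x) - grad (\<lambda>x. \<phi> x + \<psi> x) x \<bullet> y)
      = u x * (v (inv R y) x * \<phi> x - grad \<phi> x \<bullet> y) + u x * (v (inv R y) x * \<psi> x - grad \<psi> x \<bullet> y)" for x
    by (simp add: grad_add assms inner_add_left algebra_simps)
  then show ?thesis
    unfolding L_def using L_integrable(3)[OF assms(1)] L_integrable(3)[OF assms(2)] by simp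
qed

lemma L_cmult: "C1b \<phi> \<Longrightarrow> L y (\<lambda>x. c * \<phi> x) = c * L y \<phi>"
  unfolding L_def
  by (subst integral_mult_right_zero[symmetric])
    (auto simp: grad_cmult algebra_simps intro!: Bochner_Integration.integral_cong)

lemma integral_nabla_star:
  assumes "admissible_field R F"
  shows "integrable \<nu> (\<lambda>x. u x * nabla_star R v F x)"
    and "(\<integral>x. u x * nabla_star R v F x \<partial>\<nu>) = sum_list (map (\<lambda>(f, y). L y f) F)"
proof -
  have "integrable \<nu> (\<lambda>x. u x * nabla_star R v F x) \<and>
      (\<integral>x. u x * nabla_star R v F x \<partial>\<nu>) = sum_list (map (\<lambda>(f, y). L y f) F)"
    using assms
  proof (induction F)
    case (Cons a F)
    obtain f y where a: "a = (f, y)"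
      by (cases a)
    have f: "C1b f" and F: "admissible_field R F"
      using Cons.prems by (auto simp: admissible_field_def a)
    have "u x * nabla_star R v (a # F) x
        = u x * (v (inv R y) x * f x - grad f x \<bullet> y) + u x * nabla_star R v F x" for x
      by (simp add: nabla_star_def a algebra_simps)
    then show ?case
      using Cons.IH[OF F] L_integrable(3)[OF f, of "inv R y" y] by (simp add: a L_def)
  qed (simp add: nabla_star_def)
  then show "integrable \<nu> (\<lambda>x. u x * nabla_star R v F x)"
    "(\<integral>x. u x * nabla_star R v F x \<partial>\<nu>) = sum_list (map (\<lambda>(f, y). L y f) F)"
    by auto
qed

lemma V0_upper:
  assumes "admissible_field R F" "\<And>x. norm (field_of F x) \<le> 1"
  shows "ereal (sum_list (map (\<lambda>(f, y). L y f) F)) \<le> V0 \<nu> R v u"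
  unfolding V0_def integral_nabla_star(2)[OF assms(1), symmetric]
  by (rule Sup_upper) (use assms in blast)

lemma V0_least:
  assumes "\<And>F. admissible_field R F \<Longrightarrow> (\<And>x. norm (field_of F x) \<le> 1) \<Longrightarrow>
    ereal (sum_list (map (\<lambda>(f, y). L y f) F)) \<le> c"
  shows "V0 \<nu> R v u \<le> c"
  unfolding V0_def by (rule Sup_least) (use assms integral_nabla_star(2) in auto)

lemma V0_nonneg: "0 \<le> V0 \<nu> R v u"
  using V0_upper[of "[]"] by (simp add: admissible_field_def field_of_def zero_ereal_def)

text \<open>\<open>V0\<close> tests fields bounded by 1; as the pairing is linear in the field, a
  bound \<open>c\<close> costs a factor \<open>c\<close>.\<close>

lemma V0_scaled:
  assumes fin: "V0 \<nu> R v u = ereal V" and F: "admissible_field R F" "\<And>x. norm (field_of F x) \<le> c"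
    and c: "0 < c"
  shows "sum_list (map (\<lambda>(f, y). L y f) F) \<le> V * c"
proof -
  let ?F = "map (\<lambda>(f, y). (\<lambda>x. inverse c * f x, y)) F"
  have adm: "admissible_field R ?F"
    using F(1) by (auto simp: admissible_field_def intro: C1b_cmult)
  have "field_of ?F x = inverse c *\<^sub>R field_of F x" for x
    by (induction F) (auto simp: field_of_def scaleR_add_right)
  then have "norm (field_of ?F x) \<le> 1" for x
    using F(2)[of x] c by (simp add: field_simps)
  then have le: "ereal (sum_list (map (\<lambda>(f, y). L y f) ?F)) \<le> ereal V"
    unfolding fin[symmetric] by (intro V0_upper adm)
  have eq: "sum_list (map (\<lambda>(f, y). L y f) ?F) = inverse c * sum_list (map (\<lambda>(f, y). L y f) F)"
    using F(1)
  proof (induction F)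
    case (Cons a F)
    obtain f y where a: "a = (f, y)"
      by (cases a)
    then have "C1b f" "admissible_field R F"
      using Cons.prems by (auto simp: admissible_field_def)
    then show ?case
      using Cons.IH L_cmult[of f y "inverse c"] by (simp add: a distrib_left)
  qed simp
  have "inverse c * sum_list (map (\<lambda>(f, y). L y f) F) \<le> V"
    using le unfolding eq by simp
  then show ?thesis
    using c by (simp add: field_simps)
qed

lemma E_range: "e \<in> E \<Longrightarrow> e \<in> range R"
proof -
  assume e: "e \<in> E"
  then obtain c where c: "R e = c *\<^sub>R e"
    using E_eigen by blast
  interpret bounded_linear R by (rule R_lin)
  have "c \<noteq> 0"
  proof
    assume "c = 0"
    then have "R e = R 0"
      using c by (simp add: zero)
    then have "e = 0"
      using R_inj by (rule injD[rotated])
    then show False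
      using E_norm[OF e] by simp
  qed
  then have "R ((1 / c) *\<^sub>R e) = e"
    by (simp add: scaleR c)
  then show ?thesis
    by (metis rangeI)
qed

lemma range_subspace: "subspace (range R)"
  using bounded_linear.linear[OF R_lin] by (simp add: linear_subspace_image)

lemma range_dense: "closure (range R) = UNIV"
proof -
  have "span E \<subseteq> range R"
    using E_range by (intro span_minimal range_subspace) auto
  then show ?thesis
    using E_dense closure_mono by blast
qed

lemma BV0_measure_iff:
  "BV0_measure \<nu> R v u m \<longleftrightarrow> vector_measure m \<and>
     (\<forall>y\<in>range R. \<forall>\<phi>. C1b \<phi> \<longrightarrow> L y \<phi> = signed_integral (\<lambda>B. m B \<bullet> y) \<phi>)"
proof -
  have "(\<integral>x. u x * (grad \<phi> x \<bullet> y - v (inv R y) x * \<phi> x) \<partial>\<nu>) = - L y \<phi>" for y \<phi>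
    unfolding L_def by (subst Bochner_Integration.integral_minus[symmetric]) (simp add: algebra_simps)
  then show ?thesis
    unfolding BV0_measure_def by simp
qed

lemma field_list_sum:
  fixes g :: "(('a \<Rightarrow> real) \<times> 'a) \<Rightarrow> 'b::comm_monoid_add"
  shows "sum_list (map g (map (\<lambda>i. (\<psi> i, w i)) [0..<n])) = (\<Sum>i<n. g (\<psi> i, w i))"
  by (simp add: comp_def interv_sum_list_conv_sum_set_nat atLeast0LessThan)

text \<open>Upper and lower bound meet because \<open>R(X)\<close> is a dense subspace: vectors
  norming the values of \<open>m\<close> can be taken in it, and fields with such values are exactly
  the ones that \<open>V0\<close> admits.\<close>

theorem total_variation_eq_V0:
  assumes m: "BV0_measure \<nu> R v u m"
  shows "enn2ereal (total_variation m) = V0 \<nu> R v u"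
proof (rule antisym)
  have vm: "vector_measure m"
    and L: "\<And>y \<phi>. y \<in> range R \<Longrightarrow> C1b \<phi> \<Longrightarrow> L y \<phi> = signed_integral (\<lambda>B. m B \<bullet> y) \<phi>"
    using m by (auto simp: BV0_measure_iff)
  define t where "t = enn2real (total_variation m)"
  have t: "total_variation m = ennreal t" "0 \<le> t"
    using vm by (auto simp: t_def vector_measure_def)
  show upper: "V0 \<nu> R v u \<le> enn2ereal (total_variation m)"
  proof (rule V0_least)
    fix F assume F: "admissible_field R F" and F1: "\<And>x. norm (field_of F x) \<le> 1"
    define n where "n = length F"
    define f y where "f i = fst (F ! i)" and "y i = snd (F ! i)" for i
    have F_eq: "F = map (\<lambda>i. (f i, y i)) [0..<n]"
      by (rule nth_equalityI) (auto simp: n_def f_def y_def)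
    have fy: "C1b (f i)" "y i \<in> range R" if "i < n" for i
    proof -
      have "(f i, y i) \<in> set F"
        using that by (simp add: n_def f_def y_def)
      then have "case (f i, y i) of (f, y) \<Rightarrow> C1b f \<and> y \<in> range R"
        using F unfolding admissible_field_def by blast
      then show "C1b (f i)" "y i \<in> range R"
        by auto
    qed
    have "\<forall>i\<in>{..<n}. \<exists>C. \<forall>x. \<bar>f i x\<bar> \<le> C"
      using fy C1b_bound by blast
    then obtain C where C: "\<And>i x. i < n \<Longrightarrow> \<bar>f i x\<bar> \<le> C i"
      by (metis lessThan_iff)
    have C': "\<bar>f i x\<bar> \<le> Max (C ` {..<n})" if "i < n" for i x
      using C[OF that, of x] that by (meson Max_ge finite_imageI finite_lessThan imageI lessThan_iff order_trans)
    have "norm (\<Sum>i<n. f i x *\<^sub>R y i) \<le> 1" for x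
    proof -
      have "field_of F x = (\<Sum>i<n. f i x *\<^sub>R y i)"
        unfolding field_of_def by (subst F_eq, subst field_list_sum) simp
      then show ?thesis
        using F1[of x] by simp
    qed
    then have "(\<Sum>i<n. signed_integral (\<lambda>B. m B \<bullet> y i) (f i)) \<le> t"
      unfolding t_def using fy C' by (intro field_integral_le_total_variation[OF vm]) (auto intro: C1b_measurable)
    moreover have "sum_list (map (\<lambda>(f, y). L y f) F) = (\<Sum>i<n. signed_integral (\<lambda>B. m B \<bullet> y i) (f i))"
      by (subst F_eq, subst field_list_sum) (auto intro!: sum.cong L fy)
    ultimately show "ereal (sum_list (map (\<lambda>(f, y). L y f) F)) \<le> enn2ereal (total_variation m)"
      using t by (simp add: enn2ereal_ennreal)
  qed
  \<comment> \<open>The first inequality already gives finiteness, so that the second can be proved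
    with a real bound \<open>V\<close>.\<close>
  have "V0 \<nu> R v u < \<infinity>"
    using upper t by (auto simp: enn2ereal_ennreal)
  then obtain V where V: "V0 \<nu> R v u = ereal V" "0 \<le> V"
    using V0_nonneg by (cases "V0 \<nu> R v u") auto
  have "total_variation m \<le> ennreal V"
  proof (rule total_variation_le[OF sep vm range_subspace range_dense])
    fix n and \<psi> :: "nat \<Rightarrow> 'a \<Rightarrow> real" and w :: "nat \<Rightarrow> 'a"
    assume \<psi>: "\<And>i. i < n \<Longrightarrow> C1b (\<psi> i) \<and> w i \<in> range R"
      and le: "\<And>x. norm (\<Sum>i<n. \<psi> i x *\<^sub>R w i) \<le> 1"
    let ?F = "map (\<lambda>i. (\<psi> i, w i)) [0..<n]"
    have "admissible_field R ?F"
      using \<psi> by (auto simp: admissible_field_def)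
    moreover have "norm (field_of ?F x) \<le> 1" for x
      unfolding field_of_def field_list_sum using le by simp
    ultimately have "ereal (sum_list (map (\<lambda>(f, y). L y f) ?F)) \<le> ereal V"
      unfolding V(1)[symmetric] by (rule V0_upper)
    then have "(\<Sum>i<n. L (w i) (\<psi> i)) \<le> V"
      unfolding field_list_sum by simp
    also have "(\<Sum>i<n. L (w i) (\<psi> i)) = (\<Sum>i<n. signed_integral (\<lambda>B. m B \<bullet> w i) (\<psi> i))"
      using \<psi> by (intro sum.cong L) auto
    finally show "(\<Sum>i<n. signed_integral (\<lambda>B. m B \<bullet> w i) (\<psi> i)) \<le> V" .
  qed
  then show "enn2ereal (total_variation m) \<le> V0 \<nu> R v u"
    using V by (simp add: less_eq_ennreal.rep_eq enn2ereal_ennreal)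
qed

lemma field_set_sum:
  fixes g :: "(('a \<Rightarrow> real) \<times> 'a) \<Rightarrow> 'b::comm_monoid_add"
  assumes "distinct xs"
  shows "sum_list (map g (map (\<lambda>e. (f e, e)) xs)) = (\<Sum>e\<in>set xs. g (f e, e))"
  using assms by (simp add: comp_def sum_list_distinct_conv_sum_set)

text \<open>For coefficients in an orthonormal set the \<open>L2_set\<close> is the norm of the
  field. The bound is enlarged by \<open>\<delta>\<close> because the rescaling behind
  \<open>V0_scaled\<close> divides by it, and \<open>c\<close> may be 0.\<close>

lemma L_field_bound:
  assumes V: "V0 \<nu> R v u = ereal V" and S: "finite S" "S \<subseteq> E"
    and f: "\<And>e. C1b (f e)" "\<And>x. L2_set (\<lambda>e. f e x) S \<le> c"
  shows "(\<Sum>e\<in>S. L e (f e)) \<le> V * c"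
proof (rule le_if_le_add_mult_epsilon)
  show "0 \<le> V"
    using V0_nonneg by (simp add: V zero_ereal_def)
  have c: "0 \<le> c"
    using f(2) order.trans[OF L2_set_nonneg] by blast
  fix \<delta> :: real assume \<delta>: "0 < \<delta>"
  obtain xs where xs: "set xs = S" "distinct xs"
    using finite_distinct_list[OF S(1)] by blast
  let ?F = "map (\<lambda>e. (f e, e)) xs"
  have "admissible_field R ?F"
    using S f(1) xs(1) E_range by (auto simp: admissible_field_def)
  moreover have "norm (field_of ?F x) \<le> c + \<delta>" for x
  proof -
    have "norm (field_of ?F x) = norm (\<Sum>e\<in>S. f e x *\<^sub>R e)"
      unfolding field_of_def field_set_sum[OF xs(2)] xs(1) by simp
    also have "\<dots> = L2_set (\<lambda>e. f e x) S"
      by (rule norm_orthonormal_sum[OF E_norm E_orth S])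
    finally show ?thesis
      using f(2)[of x] \<delta> by simp
  qed
  ultimately have "sum_list (map (\<lambda>(f, y). L y f) ?F) \<le> V * (c + \<delta>)"
    using c \<delta> by (intro V0_scaled[OF V]) auto
  then have "(\<Sum>e\<in>S. L e (f e)) \<le> V * (c + \<delta>)"
    unfolding field_set_sum[OF xs(2)] xs(1) by simp
  then show "(\<Sum>e\<in>S. L e (f e)) \<le> V * c + V * \<delta>"
    by (simp add: distrib_left)
qed

text \<open>By the product rule \<open>\<theta> n\<close> enters through its values and its
  derivative along \<open>e\<close>, multiplied by fixed integrable functions, so dominated
  convergence applies.\<close>

lemma L_mult_tendsto_zero:
  assumes f: "C1b f" and \<theta>: "\<And>n. C1b (\<theta> n)" "\<And>n x. \<bar>\<theta> n x\<bar> \<le> C" "\<And>n x. \<bar>grad (\<theta> n) x \<bullet> e\<bar> \<le> C"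
    and lim: "\<And>x. (\<lambda>n. \<theta> n x) \<longlonglongrightarrow> 0" "\<And>x. (\<lambda>n. grad (\<theta> n) x \<bullet> e) \<longlonglongrightarrow> 0"
  shows "(\<lambda>n. L e (\<lambda>x. f x * \<theta> n x)) \<longlonglongrightarrow> 0"
proof -
  let ?z = "inv R e"
  let ?a = "\<lambda>x. u x * (v ?z x * f x - grad f x \<bullet> e)"
  obtain B where B: "\<And>x. \<bar>f x\<bar> \<le> B"
    using C1b_bound[OF f] by blast
  have C: "0 \<le> C"
    using \<theta>(2) abs_ge_zero order_trans by blast
  have eq: "u x * (v ?z x * (f x * \<theta> n x) - grad (\<lambda>x. f x * \<theta> n x) x \<bullet> e)
      = ?a x * \<theta> n x - u x * f x * (grad (\<theta> n) x \<bullet> e)" for n x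
    by (simp add: grad_mult f \<theta>(1) inner_add_left algebra_simps)
  have "(\<lambda>n. L e (\<lambda>x. f x * \<theta> n x)) \<longlonglongrightarrow> (\<integral>x. 0 \<partial>\<nu>)"
    unfolding L_def eq
  proof (rule integral_dominated_convergence[where w = "\<lambda>x. \<bar>?a x\<bar> * C + \<bar>u x\<bar> * (B * C)"])
    show "integrable \<nu> (\<lambda>x. \<bar>?a x\<bar> * C + \<bar>u x\<bar> * (B * C))"
      by (intro Bochner_Integration.integrable_add integrable_mult_left integrable_abs L_integrable f u_int)
    have um: "u \<in> borel_measurable borel" and am: "?a \<in> borel_measurable borel"
      using borel_measurable_integrable[OF u_int] borel_measurable_integrable[OF L_integrable(3)[OF f]] by auto
    show "(\<lambda>x. ?a x * \<theta> n x - u x * f x * (grad (\<theta> n) x \<bullet> e)) \<in> borel_measurable \<nu>" for n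
      unfolding borel_measurable_nu
      by (intro borel_measurable_diff borel_measurable_times[OF am]
          borel_measurable_times[OF borel_measurable_times[OF um C1b_measurable[OF f]]]
          C1b_measurable C1b_grad_inner_measurable \<theta>(1))
    show "AE x in \<nu>. (\<lambda>n. ?a x * \<theta> n x - u x * f x * (grad (\<theta> n) x \<bullet> e)) \<longlonglongrightarrow> 0"
    proof (intro AE_I2)
      fix x
      have "(\<lambda>n. ?a x * \<theta> n x - u x * f x * (grad (\<theta> n) x \<bullet> e)) \<longlonglongrightarrow> ?a x * 0 - u x * f x * 0"
        by (intro tendsto_intros lim)
      then show "(\<lambda>n. ?a x * \<theta> n x - u x * f x * (grad (\<theta> n) x \<bullet> e)) \<longlonglongrightarrow> 0"
        by simp
    qed
    show "AE x in \<nu>. norm (?a x * \<theta> n x - u x * f x * (grad (\<theta> n) x \<bullet> e)) \<le> \<bar>?a x\<bar> * C + \<bar>u x\<bar> * (B * C)" for n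
    proof (intro AE_I2)
      fix x
      have "\<bar>?a x * \<theta> n x\<bar> \<le> \<bar>?a x\<bar> * C"
        unfolding abs_mult[of "?a x"] by (intro mult_left_mono \<theta>(2)) simp
      moreover have "\<bar>u x * f x * (grad (\<theta> n) x \<bullet> e)\<bar> \<le> \<bar>u x\<bar> * (B * C)"
        unfolding abs_mult mult.assoc using B[of x]
        by (intro mult_left_mono mult_mono \<theta>(3)) auto
      ultimately show "norm (?a x * \<theta> n x - u x * f x * (grad (\<theta> n) x \<bullet> e)) \<le> \<bar>?a x\<bar> * C + \<bar>u x\<bar> * (B * C)"
        unfolding real_norm_def by linarith
    qed
  qed simp
  then show ?thesis
    by simp
qed

theorem BV0_measure_exists:
  assumes V: "V0 \<nu> R v u = ereal V"
  shows "\<exists>m. BV0_measure \<nu> R v u m"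
proof -
  have V0: "0 \<le> V"
    using V0_nonneg by (simp add: V zero_ereal_def)
  interpret G: gradient_functional E L V
  proof
    show "\<And>S f c. finite S \<Longrightarrow> S \<subseteq> E \<Longrightarrow> (\<And>e. C1b (f e)) \<Longrightarrow>
        (\<And>x. L2_set (\<lambda>e. f e x) S \<le> c) \<Longrightarrow> (\<Sum>e\<in>S. L e (f e)) \<le> V * c"
      by (rule L_field_bound[OF V])
    show "(\<lambda>n. L e (\<lambda>x. f x * \<theta> n x)) \<longlonglongrightarrow> 0"
      if "e \<in> E" "C1b f" "\<And>n. C1b (\<theta> n)" "\<And>n x. \<bar>\<theta> n x\<bar> \<le> C" "\<And>n x. \<bar>grad (\<theta> n) x \<bullet> e\<bar> \<le> C"
        "\<And>x. (\<lambda>n. \<theta> n x) \<longlonglongrightarrow> 0" "\<And>x. (\<lambda>n. grad (\<theta> n) x \<bullet> e) \<longlonglongrightarrow> 0" for e f \<theta> C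
      by (rule L_mult_tendsto_zero[OF that(2-)])
  qed ((rule sep E_dense V0) | (rule E_norm E_orth L_add L_cmult; assumption))+
  \<comment> \<open>For \<open>y\<close> outside the span of \<open>E\<close> the claim cannot be
    had by continuity of \<open>L y \<phi>\<close> in \<open>y\<close>: the term
    \<open>v (inv R y)\<close> comes with no estimate in terms of \<open>y\<close>. The finiteness
    of \<open>V0\<close> serves instead.\<close>
  have "L y \<phi> = G.L_vec \<phi> \<bullet> y" if y: "y \<in> range R" and \<phi>: "C1b \<phi>" for y \<phi>
  proof -
    obtain B where B: "0 < B" "\<And>x. \<bar>\<phi> x\<bar> \<le> B"
      using C1b_bound[OF \<phi>] by blast
    define K where "K = V * B + norm (G.L_vec \<phi>)"
    have "\<bar>L y \<phi> - G.L_vec \<phi> \<bullet> y\<bar> \<le> 0"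
    proof (rule le_if_le_add_mult_epsilon)
      show "0 \<le> K"
        using V0 B by (simp add: K_def)
      fix \<delta> :: real assume \<delta>: "0 < \<delta>"
      have "y \<in> closure (span E)"
        using E_dense by simp
      then obtain y' where y': "y' \<in> span E" "dist y' y < \<delta>"
        using \<delta> unfolding closure_approachable by blast
      then obtain S a where S: "finite S" "S \<subseteq> E" "y' = (\<Sum>e\<in>S. a e *\<^sub>R e)"
        unfolding span_explicit by blast
      obtain xs where xs: "set xs = S" "distinct xs"
        using finite_distinct_list[OF S(1)] by blast
      have La: "(\<Sum>e\<in>S. a e * L e \<psi>) = G.L_vec \<psi> \<bullet> y'" if "C1b \<psi>" for \<psi>
        unfolding S(3) inner_sum_right using S(2) G.L_vec_inner[OF that] by (intro sum.cong) auto
      \<comment> \<open>The field \<open>\<psi> (y - y')\<close> is listed as one term along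
        \<open>y\<close> and terms along basis vectors, so that its pairing splits into
        \<open>L y \<psi>\<close> and known quantities, although its norm is at most
        \<open>B * \<delta>\<close>.\<close>
      have le: "L y \<psi> - G.L_vec \<psi> \<bullet> y' \<le> V * (B * \<delta>)" if \<psi>: "C1b \<psi>" "\<And>x. \<bar>\<psi> x\<bar> \<le> B" for \<psi>
      proof -
        let ?F = "(\<psi>, y) # map (\<lambda>e. (\<lambda>x. - a e * \<psi> x, e)) xs"
        have "C1b (\<lambda>x. - a e * \<psi> x)" for e
          by (rule C1b_cmult[OF \<psi>(1)])
        then have "admissible_field R ?F"
          using y \<psi>(1) S(2) xs(1) E_range by (auto simp: admissible_field_def)
        moreover have "norm (field_of ?F x) \<le> B * \<delta>" for x
        proof -
          have "field_of ?F x = \<psi> x *\<^sub>R y + (\<Sum>e\<in>S. (- a e * \<psi> x) *\<^sub>R e)"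
            unfolding field_of_def list.map sum_list.Cons field_set_sum[OF xs(2)] xs(1) by simp
          also have "\<dots> = \<psi> x *\<^sub>R (y - y')"
            by (simp add: S(3) scaleR_diff_right scaleR_sum_right sum_negf mult.commute)
          finally have "norm (field_of ?F x) = \<bar>\<psi> x\<bar> * norm (y - y')"
            by simp
          also have "\<dots> \<le> B * \<delta>"
            using \<psi>(2) y'(2) B(1) by (intro mult_mono) (auto simp: dist_norm norm_minus_commute)
          finally show ?thesis .
        qed
        ultimately have "sum_list (map (\<lambda>(f, y). L y f) ?F) \<le> V * (B * \<delta>)"
          using B(1) \<delta> by (intro V0_scaled[OF V]) auto
        moreover have "sum_list (map (\<lambda>(f, y). L y f) ?F) = L y \<psi> + (\<Sum>e\<in>S. L e (\<lambda>x. - a e * \<psi> x))"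
          unfolding list.map sum_list.Cons field_set_sum[OF xs(2)] xs(1) by simp
        moreover have "(\<Sum>e\<in>S. L e (\<lambda>x. - a e * \<psi> x)) = - (\<Sum>e\<in>S. a e * L e \<psi>)"
          unfolding sum_negf[symmetric] by (intro sum.cong refl) (subst L_cmult[OF \<psi>(1)], simp)
        ultimately show ?thesis
          using La[OF \<psi>(1)] by simp
      qed
      \<comment> \<open>The bound is one-sided; applying it to \<open>- \<phi>\<close> gives the
        other side.\<close>
      have m: "C1b (\<lambda>x. - 1 * \<phi> x)"
        by (rule C1b_cmult[OF \<phi>])
      have "L y (\<lambda>x. - 1 * \<phi> x) - G.L_vec (\<lambda>x. - 1 * \<phi> x) \<bullet> y' \<le> V * (B * \<delta>)"
        by (rule le[OF m]) (simp add: B)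
      then have "G.L_vec \<phi> \<bullet> y' - L y \<phi> \<le> V * (B * \<delta>)"
        unfolding L_cmult[OF \<phi>] G.L_vec_cmult[OF \<phi>] by simp
      moreover have "\<bar>G.L_vec \<phi> \<bullet> (y' - y)\<bar> \<le> norm (G.L_vec \<phi>) * \<delta>"
        by (rule order.trans[OF Cauchy_Schwarz_ineq2])
          (use y'(2) in \<open>auto intro!: mult_left_mono simp: dist_norm\<close>)
      ultimately show "\<bar>L y \<phi> - G.L_vec \<phi> \<bullet> y\<bar> \<le> 0 + K * \<delta>"
        using le[OF \<phi> B(2)] by (simp add: K_def inner_diff_right distrib_right mult.assoc)
    qed
    then show ?thesis
      by simp
  qed
  then have "BV0_measure \<nu> R v u G.L_measure"
    by (simp add: BV0_measure_iff G.vector_measure_L_measure G.signed_integral_L_measure)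
  then show ?thesis
    by (rule exI[of _ G.L_measure])
qed

end

theorem theorem3p12:
  fixes \<nu> :: "'a::{real_inner, complete_space} measure"
    and R :: "'a \<Rightarrow> 'a" and v :: "'a \<Rightarrow> 'a \<Rightarrow> real" and u :: "'a \<Rightarrow> real" and p :: real
  assumes separable: "\<exists>D :: 'a set. countable D \<and> closure D = UNIV"
    and prob: "prob_space \<nu>" and borel_sets: "sets \<nu> = sets borel"
    and R_lin: "bounded_linear R"
    and standing: "standing_assumption \<nu> R v"
    and R_selfadj: "\<forall>x y. R x \<bullet> y = x \<bullet> R y"
    and R_inj: "inj R"
    and eigbasis: "\<exists>E :: 'a set. (\<forall>e \<in> E. norm e = 1) \<and>
                     (\<forall>e \<in> E. \<forall>e' \<in> E. e \<noteq> e' \<longrightarrow> e \<bullet> e' = 0) \<and>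
                     closure (span E) = UNIV \<and>
                     (\<forall>e \<in> E. \<exists>c::real. R e = c *\<^sub>R e)"
    and p: "p > 1" and u_Lp: "Lp \<nu> p u"
  shows "(BV0 \<nu> R v u \<longleftrightarrow> V0 \<nu> R v u < \<infinity>) \<and>
         (\<forall>m0. BV0_measure \<nu> R v u m0 \<longrightarrow> enn2ereal (total_variation m0) = V0 \<nu> R v u)"
proof -
  interpret prob_space \<nu> by (rule prob)
  \<comment> \<open>The conjugate exponent: the constant 1 lies in \<open>L^q\<close> since
    \<open>\<nu>\<close> is a probability measure, and so does each \<open>v z\<close> by the
    standing assumption.\<close>
  define q where "q = p / (p - 1)"
  have q: "1 < q" "1 / p + 1 / q = 1"
    using p by (auto simp: q_def field_simps)
  have Lp_const: "Lp \<nu> q (\<lambda>_. 1)"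
    by (simp add: Lp_def)
  have u_int: "integrable \<nu> u"
    using Lp_mult_integrable[OF p q u_Lp Lp_const] by simp
  have uv_int: "integrable \<nu> (\<lambda>x. u x * v z x)" for z
    using standing q(1) unfolding standing_assumption_def by (intro Lp_mult_integrable[OF p q u_Lp]) blast
  obtain E :: "'a set" where E: "\<And>e. e \<in> E \<Longrightarrow> norm e = 1"
    "\<And>e e'. e \<in> E \<Longrightarrow> e' \<in> E \<Longrightarrow> e \<noteq> e' \<Longrightarrow> e \<bullet> e' = 0"
    "closure (span E) = UNIV" "\<And>e. e \<in> E \<Longrightarrow> \<exists>c::real. R e = c *\<^sub>R e"
    using eigbasis by metis
  interpret bv_setting \<nu> R v u E
    by (rule bv_setting.intro[OF separable borel_sets R_lin R_inj E u_int uv_int])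
  have tv: "enn2ereal (total_variation m0) = V0 \<nu> R v u" if "BV0_measure \<nu> R v u m0" for m0
    by (rule total_variation_eq_V0[OF that])
  have "V0 \<nu> R v u < \<infinity>" if "BV0 \<nu> R v u"
  proof -
    obtain m0 where m0: "BV0_measure \<nu> R v u m0"
      using \<open>BV0 \<nu> R v u\<close> by (auto simp: BV0_def)
    then have "total_variation m0 < top"
      by (simp add: BV0_measure_def vector_measure_def)
    then show ?thesis
      unfolding tv[OF m0, symmetric] by (cases "total_variation m0") (auto simp: enn2ereal_ennreal)
  qed
  moreover have "BV0 \<nu> R v u" if fin: "V0 \<nu> R v u < \<infinity>"
  proof -
    obtain V where "V0 \<nu> R v u = ereal V"
      using fin V0_nonneg by (cases "V0 \<nu> R v u") auto
    then show ?thesis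
      using BV0_measure_exists u_int uv_int by (simp add: BV0_def)
  qed
  ultimately show ?thesis
    using tv by blast
qed

end
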